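(* Let $K$ be a finite field and let $d$ be a natural number. For every $i \in \mathbb{N}$ let $V_i$ be a finite-dimensional vector space over $K$ and let $T_i \in V_i^{\otimes d}$. Then there exist $i<j$ such that $T_j \succeq T_i$, i.e. such that there is a linear map $\phi: V_j \to V_i$ with $\phi^{\otimes d} T_j = T_i$.
   Context: For a $K$-vector space $V$, $V^{\otimes d}$ is the $d$-fold tensor product of $V$ with itself over $K$; for a linear map $\phi:V\to W$, $\phi^{\otimes d}:V^{\otimes d}\to W^{\otimes d}$ is the linear map determined by $v_1\otimes\cdots\otimes v_d \mapsto \phi(v_1)\otimes\cdots\otimes\phi(v_d)$. For finite-dimensional $V,W$, $S\in V^{\otimes d}$ and $T\in W^{\otimes d}$, one says that $T$ is a restriction of $S$, written $S\succeq T$, if there exists a linear map $\phi:V\to W$ with $\phi^{\otimes d}S=T$. *)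

theory Defs
  imports Complex_Main "HOL-Library.Poly_Mapping"
begin

text \<open>
  Vector spaces are subspaces of an ambient vector space given by its scalar multiplication
  (\<^locale>\<open>vector_space\<close>). A family of spaces that is indexed by a term has to live in a single
  type; nothing is lost, since any family of vector spaces embeds in its direct sum.
\<close>

definition finite_dim_subspace ::
    "('k::field \<Rightarrow> 'v::ab_group_add \<Rightarrow> 'v) \<Rightarrow> 'v set \<Rightarrow> bool" where
  "finite_dim_subspace s V \<longleftrightarrow>
     module.subspace s V \<and> (\<exists>B. finite B \<and> B \<subseteq> V \<and> module.span s B = V)"

definition linear_map_on ::
    "('k::field \<Rightarrow> 'v::ab_group_add \<Rightarrow> 'v) \<Rightarrow> ('k \<Rightarrow> 'w::ab_group_add \<Rightarrow> 'w) \<Rightarrow>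
     'v set \<Rightarrow> 'w set \<Rightarrow> ('v \<Rightarrow> 'w) \<Rightarrow> bool" where
  "linear_map_on s1 s2 V W \<phi> \<longleftrightarrow>
     (\<forall>x\<in>V. \<phi> x \<in> W) \<and>
     (\<forall>x\<in>V. \<forall>y\<in>V. \<phi> (x + y) = \<phi> x + \<phi> y) \<and>
     (\<forall>c. \<forall>x\<in>V. \<phi> (s1 c x) = s2 c (\<phi> x))"


subsection \<open>Tensor powers\<close>

text \<open>
  The \<open>d\<close>-th tensor power of \<open>V\<close> is the free vector space on \<open>V\<^sup>d\<close> (finitely supported
  functions on lists of length \<open>d\<close>) modulo the span of the multilinearity relations. Its elements
  are cosets. For \<open>d = 0\<close> there are no relations, and the quotient is the ground field.
\<close>

definition tuples :: "nat \<Rightarrow> 'v set \<Rightarrow> 'v list set" where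
  "tuples d V = {l. length l = d \<and> set l \<subseteq> V}"

definition free_scale :: "'k::field \<Rightarrow> ('a \<Rightarrow>\<^sub>0 'k) \<Rightarrow> ('a \<Rightarrow>\<^sub>0 'k)" where
  "free_scale c = Poly_Mapping.map ((*) c)"

definition free_space :: "nat \<Rightarrow> 'v set \<Rightarrow> ('v list \<Rightarrow>\<^sub>0 'k::field) set" where
  "free_space d V = {p. Poly_Mapping.keys p \<subseteq> tuples d V}"

definition multilinearity_rels ::
    "('k::field \<Rightarrow> 'v::ab_group_add \<Rightarrow> 'v) \<Rightarrow> nat \<Rightarrow> 'v set \<Rightarrow> ('v list \<Rightarrow>\<^sub>0 'k) set" where
  "multilinearity_rels s d V =
     {Poly_Mapping.single (l[i := x + y]) 1 - Poly_Mapping.single (l[i := x]) 1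
        - Poly_Mapping.single (l[i := y]) 1 | l i x y.
        l \<in> tuples d V \<and> i < d \<and> x \<in> V \<and> y \<in> V} \<union>
     {Poly_Mapping.single (l[i := s c x]) 1 - Poly_Mapping.single (l[i := x]) c | l i c x.
        l \<in> tuples d V \<and> i < d \<and> x \<in> V}"

definition tensor_rel ::
    "('k::field \<Rightarrow> 'v::ab_group_add \<Rightarrow> 'v) \<Rightarrow> nat \<Rightarrow> 'v set \<Rightarrow> ('v list \<Rightarrow>\<^sub>0 'k) rel" where
  "tensor_rel s d V = {(p, q). p \<in> free_space d V \<and> q \<in> free_space d V \<and>
     p - q \<in> module.span free_scale (multilinearity_rels s d V)}"

definition tensor_power ::
    "('k::field \<Rightarrow> 'v::ab_group_add \<Rightarrow> 'v) \<Rightarrow> nat \<Rightarrow> 'v set \<Rightarrow> ('v list \<Rightarrow>\<^sub>0 'k) set set" where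
  "tensor_power s d V = free_space d V // tensor_rel s d V"

definition pure_tensor ::
    "('k::field \<Rightarrow> 'v::ab_group_add \<Rightarrow> 'v) \<Rightarrow> nat \<Rightarrow> 'v set \<Rightarrow> 'v list \<Rightarrow> ('v list \<Rightarrow>\<^sub>0 'k) set" where
  "pure_tensor s d V l = tensor_rel s d V `` {Poly_Mapping.single l 1}"

definition free_map :: "('v \<Rightarrow> 'w) \<Rightarrow> ('v list \<Rightarrow>\<^sub>0 'k::field) \<Rightarrow> ('w list \<Rightarrow>\<^sub>0 'k)" where
  "free_map \<phi> p =
     (\<Sum>l\<in>Poly_Mapping.keys p. Poly_Mapping.single (map \<phi> l) (Poly_Mapping.lookup p l))"

text \<open>
  The tensor power of \<open>\<phi>\<close>, with values in the \<open>d\<close>-th tensor power of \<open>W\<close>: apply \<open>free_map \<phi>\<close> to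
  any representative. All representatives give the same coset when \<open>\<phi>\<close> is linear, see
  \<open>tensor_power_map_class\<close> below.
\<close>

definition tensor_power_map ::
    "('k::field \<Rightarrow> 'w::ab_group_add \<Rightarrow> 'w) \<Rightarrow> nat \<Rightarrow> 'w set \<Rightarrow> ('v \<Rightarrow> 'w) \<Rightarrow>
     ('v list \<Rightarrow>\<^sub>0 'k) set \<Rightarrow> ('w list \<Rightarrow>\<^sub>0 'k) set" where
  "tensor_power_map s d W \<phi> T = (\<Union>p\<in>T. tensor_rel s d W `` {free_map \<phi> p})"

text \<open>\<open>is_restriction s d V S W T\<close>: the tensor \<open>T\<close> over \<open>W\<close> is a restriction of \<open>S\<close> over \<open>V\<close>.\<close>

definition is_restriction ::
    "('k::field \<Rightarrow> 'v::ab_group_add \<Rightarrow> 'v) \<Rightarrow> nat \<Rightarrow>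
     'v set \<Rightarrow> ('v list \<Rightarrow>\<^sub>0 'k) set \<Rightarrow> 'v set \<Rightarrow> ('v list \<Rightarrow>\<^sub>0 'k) set \<Rightarrow> bool" where
  "is_restriction s d V S W T \<longleftrightarrow>
     (\<exists>\<phi>. linear_map_on s s V W \<phi> \<and> tensor_power_map s d W \<phi> S = T)"


subsection \<open>Well-definedness of the tensor power of a linear map\<close>

lemma lookup_free_scale [simp]:
  "Poly_Mapping.lookup (free_scale c p) k = c * Poly_Mapping.lookup p k"
  unfolding free_scale_def by (simp add: Poly_Mapping.map.rep_eq when_def)

lemma free_scale_single [simp]:
  "free_scale c (Poly_Mapping.single l a) = Poly_Mapping.single l (c * a)"
  by (rule poly_mapping_eqI) (simp add: lookup_single when_def)

interpretation free_vs: vector_space "free_scale :: 'k::field \<Rightarrow> ('a \<Rightarrow>\<^sub>0 'k) \<Rightarrow> _"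
  by unfold_locales (auto intro!: poly_mapping_eqI simp: lookup_add algebra_simps)

lemma subspace_free_space: "free_vs.subspace (free_space d V)"
  unfolding free_vs.subspace_def free_space_def
  by (auto simp: in_keys_iff lookup_add subset_iff, metis add_0)

lemma single_in_free_space: "l \<in> tuples d V \<Longrightarrow> Poly_Mapping.single l c \<in> free_space d V"
  by (auto simp: free_space_def)

lemma list_update_in_tuples: "l \<in> tuples d V \<Longrightarrow> x \<in> V \<Longrightarrow> l[i := x] \<in> tuples d V"
  using set_update_subset_insert[of l i x] by (auto simp: tuples_def)

lemma multilinearity_rels_in_free_space:
  assumes "vector_space s" "module.subspace s V"
  shows "multilinearity_rels s d V \<subseteq> free_space d V"
proof -
  have "Poly_Mapping.single (l[i := x]) c \<in> free_space d V" if "l \<in> tuples d V" "x \<in> V" for l i x c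
    using that by (intro single_in_free_space list_update_in_tuples)
  moreover have m: "module s"
    using assms(1) by (simp add: module_iff_vector_space)
  ultimately show ?thesis
    using module.subspace_add[OF m assms(2)] module.subspace_scale[OF m assms(2)]
    by (auto simp: multilinearity_rels_def
        intro!: free_vs.subspace_diff[OF subspace_free_space])
qed

lemma equiv_tensor_rel: "equiv (free_space d V) (tensor_rel s d V)"
proof (rule equivI)
  show "refl_on (free_space d V) (tensor_rel s d V)"
    by (auto simp: refl_on_def tensor_rel_def free_vs.span_zero)
  show "sym (tensor_rel s d V)"
    unfolding sym_def tensor_rel_def using free_vs.span_neg by fastforce
  show "trans (tensor_rel s d V)"
    unfolding trans_def tensor_rel_def using free_vs.span_add by fastforce
  show "tensor_rel s d V \<subseteq> free_space d V \<times> free_space d V"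
    by (auto simp: tensor_rel_def)
qed

lemma free_map_superset:
  assumes "finite A" "Poly_Mapping.keys p \<subseteq> A"
  shows "free_map \<phi> p = (\<Sum>l\<in>A. Poly_Mapping.single (map \<phi> l) (Poly_Mapping.lookup p l))"
  unfolding free_map_def using assms
  by (intro sum.mono_neutral_left) (auto simp: in_keys_iff)

lemma free_map_add: "free_map \<phi> (p + q) = free_map \<phi> p + free_map \<phi> q"
proof -
  let ?A = "Poly_Mapping.keys p \<union> Poly_Mapping.keys q"
  have "Poly_Mapping.keys (p + q) \<subseteq> ?A" by (rule Poly_Mapping.keys_add)
  then show ?thesis
    by (simp add: free_map_superset[of ?A] lookup_add single_add sum.distrib)
qed

lemma free_map_scale: "free_map \<phi> (free_scale c p) = free_scale c (free_map \<phi> p)"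
proof -
  have "Poly_Mapping.keys (free_scale c p) \<subseteq> Poly_Mapping.keys p"
    by (auto simp: in_keys_iff)
  then show ?thesis
    by (simp add: free_map_superset[of "Poly_Mapping.keys p"] free_vs.scale_sum_right)
qed

lemma free_map_diff: "free_map \<phi> (p - q) = free_map \<phi> p - free_map \<phi> q"
  using free_map_add[of \<phi> "p - q" q] by simp

lemma free_map_single [simp]:
  "free_map \<phi> (Poly_Mapping.single l c) = Poly_Mapping.single (map \<phi> l) c"
  by (cases "c = 0") (simp_all add: free_map_def)

lemma map_in_tuples: "linear_map_on s1 s2 V W \<phi> \<Longrightarrow> l \<in> tuples d V \<Longrightarrow> map \<phi> l \<in> tuples d W"
  by (auto simp: linear_map_on_def tuples_def)

lemma free_map_in_free_space:
  assumes "linear_map_on s1 s2 V W \<phi>" "p \<in> free_space d V"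
  shows "free_map \<phi> p \<in> free_space d W"
  unfolding free_map_def using assms
  by (intro free_vs.subspace_sum[OF subspace_free_space] single_in_free_space
        map_in_tuples[OF assms(1)]) (auto simp: free_space_def)

lemma free_map_rels:
  assumes "linear_map_on s1 s2 V W \<phi>" "p \<in> multilinearity_rels s1 d V"
  shows "free_map \<phi> p \<in> multilinearity_rels s2 d W"
  using assms(2) unfolding multilinearity_rels_def
proof (elim UnE CollectE exE conjE)
  fix l i x y assume *: "l \<in> tuples d V" "i < d" "x \<in> V" "y \<in> V"
    and p: "p = Poly_Mapping.single (l[i := x + y]) 1 - Poly_Mapping.single (l[i := x]) 1
        - Poly_Mapping.single (l[i := y]) 1"
  show "free_map \<phi> p \<in>
     {Poly_Mapping.single (l[i := x + y]) 1 - Poly_Mapping.single (l[i := x]) 1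
        - Poly_Mapping.single (l[i := y]) 1 | l i x y.
        l \<in> tuples d W \<and> i < d \<and> x \<in> W \<and> y \<in> W} \<union>
     {Poly_Mapping.single (l[i := s2 c x]) 1 - Poly_Mapping.single (l[i := x]) c | l i c x.
        l \<in> tuples d W \<and> i < d \<and> x \<in> W}"
    using * assms(1) map_in_tuples[OF assms(1) *(1)]
    by (intro UnI1 CollectI exI[of _ "map \<phi> l"] exI[of _ i] exI[of _ "\<phi> x"] exI[of _ "\<phi> y"])
       (simp add: p free_map_diff map_update linear_map_on_def)
next
  fix l i c x assume *: "l \<in> tuples d V" "i < d" "x \<in> V"
    and p: "p = Poly_Mapping.single (l[i := s1 c x]) 1 - Poly_Mapping.single (l[i := x]) c"
  show "free_map \<phi> p \<in>
     {Poly_Mapping.single (l[i := x + y]) 1 - Poly_Mapping.single (l[i := x]) 1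
        - Poly_Mapping.single (l[i := y]) 1 | l i x y.
        l \<in> tuples d W \<and> i < d \<and> x \<in> W \<and> y \<in> W} \<union>
     {Poly_Mapping.single (l[i := s2 c x]) 1 - Poly_Mapping.single (l[i := x]) c | l i c x.
        l \<in> tuples d W \<and> i < d \<and> x \<in> W}"
    using * assms(1) map_in_tuples[OF assms(1) *(1)]
    by (intro UnI2 CollectI exI[of _ "map \<phi> l"] exI[of _ i] exI[of _ c] exI[of _ "\<phi> x"])
       (simp add: p free_map_diff map_update linear_map_on_def)
qed

lemma free_map_span:
  assumes "linear_map_on s1 s2 V W \<phi>"
    and "p \<in> free_vs.span (multilinearity_rels s1 d V)"
  shows "free_map \<phi> p \<in> free_vs.span (multilinearity_rels s2 d W)"
  using assms(2)
proof (induction rule: free_vs.span_induct_alt)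
  case base
  then show ?case by (simp add: free_map_def free_vs.span_zero)
next
  case (step c x y)
  then show ?case
    using free_map_rels[OF assms(1)]
    by (simp add: free_map_add free_map_scale free_vs.span_add free_vs.span_scale
        free_vs.span_base)
qed

lemma free_map_respects:
  assumes "linear_map_on s1 s2 V W \<phi>" "(p, q) \<in> tensor_rel s1 d V"
  shows "(free_map \<phi> p, free_map \<phi> q) \<in> tensor_rel s2 d W"
  using assms free_map_in_free_space[OF assms(1)] free_map_span[OF assms(1), of "p - q" d]
  by (auto simp: tensor_rel_def free_map_diff)

lemma tensor_power_map_class:
  assumes "linear_map_on s1 s2 V W \<phi>" "p \<in> free_space d V"
  shows "tensor_power_map s2 d W \<phi> (tensor_rel s1 d V `` {p}) = tensor_rel s2 d W `` {free_map \<phi> p}"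
  unfolding tensor_power_map_def
proof (rule UN_equiv_class[OF equiv_tensor_rel _ assms(2)])
  show "(\<lambda>p. tensor_rel s2 d W `` {free_map \<phi> p}) respects tensor_rel s1 d V"
    using free_map_respects[OF assms(1)]
    by (auto intro!: congruentI equiv_class_eq[OF equiv_tensor_rel])
qed

lemma tensor_power_map_in_tensor_power:
  assumes "linear_map_on s1 s2 V W \<phi>" "T \<in> tensor_power s1 d V"
  shows "tensor_power_map s2 d W \<phi> T \<in> tensor_power s2 d W"
proof -
  from assms(2) obtain p where "p \<in> free_space d V" "T = tensor_rel s1 d V `` {p}"
    unfolding tensor_power_def by (rule quotientE)
  then show ?thesis
    using tensor_power_map_class[OF assms(1)] free_map_in_free_space[OF assms(1)]
    unfolding tensor_power_def by (metis quotientI)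
qed

lemma tensor_power_map_pure_tensor:
  assumes "linear_map_on s1 s2 V W \<phi>" "l \<in> tuples d V"
  shows "tensor_power_map s2 d W \<phi> (pure_tensor s1 d V l) = pure_tensor s2 d W (map \<phi> l)"
  unfolding pure_tensor_def
  using tensor_power_map_class[OF assms(1) single_in_free_space[OF assms(2)]] by simp

end

theory Submission
  imports Defs "HOL-Library.Function_Algebras" "HOL-Library.Infinite_Set"
begin

text \<open>
  A tensor over \<open>V\<close> is viewed as a multilinear function on the dual of \<open>V\<close>; choosing bases, all duals
  sit inside the space of sequences over the finite field, and restriction becomes precomposition
  with a linear map \<open>g\<close>. Multilinearity is needed only through its consequence that \<open>g \<mapsto> T \<circ> g\<close> is a
  polynomial map of degree at most \<open>d\<close> (iterated differences of order \<open>d + 1\<close> vanish). One proves by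
  induction on \<open>e\<close> that the well-quasi-order property modulo a submodule \<open>B\<close> descends to a
  submodule \<open>A\<close> of \<open>B\<close> if \<open>B / A\<close> has degree less than \<open>e\<close>, where all notions are relative to maps that
  fix the first \<open>u\<close> coordinates, for arbitrary \<open>u\<close>.

  One may assume \<open>B / A\<close> irreducible. Let \<open>X\<close> be closed under restriction and translation by \<open>A\<close>, but not
  under translation by \<open>B\<close>. Then some \<open>T\<^sub>0 \<in> X\<close>, living on \<open>n\<close> coordinates, is blocked: an element of \<open>X\<close>
  that extends \<open>T\<^sub>0\<close> leaves \<open>X\<close> when an element of \<open>B - A\<close> supported on the remaining coordinates is
  added. Otherwise one extends \<open>T\<^sub>0\<close> again and again, and an argument as in the Chevalley-Warning theorem
  shows that, for some substitution, the new coordinates cancel while the added element of \<open>B\<close>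
  survives. Hence the members of \<open>X\<close> that restrict to a blocked element are determined modulo \<open>A\<close> by
  their class modulo the part of \<open>B\<close> supported away from the first \<open>n\<close> coordinates; after fixing these
  \<open>n\<close> coordinates the quotient of \<open>B\<close> by this part has smaller degree, so the induction hypothesis
  applies. The members of \<open>X\<close> not restricting to the blocked element form a smaller closed set. As \<open>n\<close>
  does not depend on \<open>X\<close> and there are finitely many tensors on \<open>n\<close> coordinates, this can be repeated
  only finitely often before the image of \<open>X\<close> modulo \<open>B\<close> shrinks, and noetherian induction modulo \<open>B\<close>
  finishes the proof.
\<close>

section \<open>Finite differences and polynomial functions\<close>

definition additive_subgroup :: "'a::ab_group_add set \<Rightarrow> bool" where
  "additive_subgroup A \<longleftrightarrow> 0 \<in> A \<and> (\<forall>x\<in>A. \<forall>y\<in>A. x - y \<in> A)"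

lemma additive_subgroup_zero: "additive_subgroup A \<Longrightarrow> 0 \<in> A"
  by (simp add: additive_subgroup_def)

lemma additive_subgroup_diff: "additive_subgroup A \<Longrightarrow> x \<in> A \<Longrightarrow> y \<in> A \<Longrightarrow> x - y \<in> A"
  by (simp add: additive_subgroup_def)

lemma additive_subgroup_uminus: "additive_subgroup A \<Longrightarrow> x \<in> A \<Longrightarrow> - x \<in> A"
  using additive_subgroup_diff[of A 0 x] by (simp add: additive_subgroup_zero)

lemma additive_subgroup_add: "additive_subgroup A \<Longrightarrow> x \<in> A \<Longrightarrow> y \<in> A \<Longrightarrow> x + y \<in> A"
  using additive_subgroup_diff[of A x "- y"] by (simp add: additive_subgroup_uminus)

text \<open>Unfolded, this is the sum over \<open>S \<subseteq> {..<e}\<close> of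
  \<open>F (h + sum \<phi> S)\<close> with sign \<open>(-1) ^ (e - card S)\<close>. The last
  direction \<open>\<phi> e\<close> gives the outermost difference.\<close>

fun fdiff :: "('a::ab_group_add \<Rightarrow> 'b::ab_group_add) \<Rightarrow> 'a \<Rightarrow> (nat \<Rightarrow> 'a) \<Rightarrow> nat \<Rightarrow> 'b" where
  "fdiff F h \<phi> 0 = F h"
| "fdiff F h \<phi> (Suc e) = fdiff F (h + \<phi> e) \<phi> e - fdiff F h \<phi> e"

lemma fdiff_cong: "(\<And>i. i < e \<Longrightarrow> \<phi> i = \<psi> i) \<Longrightarrow> fdiff F h \<phi> e = fdiff F h \<psi> e"
  by (induction e arbitrary: h) simp_all

lemma sum_insert_Suc:
  fixes \<phi> :: "nat \<Rightarrow> 'a::ab_group_add"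
  assumes "S \<subseteq> {..<e}"
  shows "h + \<phi> e + sum \<phi> S = h + sum \<phi> (insert e S)"
proof -
  have "finite S" "e \<notin> S" using assms finite_subset by auto
  then show ?thesis by (simp add: add.assoc)
qed

lemma fdiff_mem:
  assumes "additive_subgroup A" "\<And>S. S \<subseteq> {..<e} \<Longrightarrow> F (h + sum \<phi> S) \<in> A"
  shows "fdiff F h \<phi> e \<in> A"
  using assms(2)
proof (induction e arbitrary: h)
  case 0
  from 0[of "{}"] show ?case by simp
next
  case (Suc e)
  have "fdiff F (h + \<phi> e) \<phi> e \<in> A"
  proof (rule Suc.IH)
    fix S assume "S \<subseteq> {..<e}"
    then show "F (h + \<phi> e + sum \<phi> S) \<in> A"
      using Suc.prems[of "insert e S"] by (fastforce simp: sum_insert_Suc)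
  qed
  moreover have "fdiff F h \<phi> e \<in> A"
    by (rule Suc.IH, rule Suc.prems) auto
  ultimately show ?case using assms(1) by (simp add: additive_subgroup_diff)
qed

text \<open>The full set enters the alternating sum with coefficient one, so its term is determined
  modulo \<open>A\<close> by the total and the other terms. This bounds the size of minimal
  witnesses in \<open>degree_less_detect\<close>.\<close>

lemma fdiff_top:
  assumes "additive_subgroup A" "fdiff F h \<phi> e \<in> A"
    and "\<And>S. S \<subset> {..<e} \<Longrightarrow> F (h + sum \<phi> S) \<in> A"
  shows "F (h + sum \<phi> {..<e}) \<in> A"
  using assms(2,3)
proof (induction e arbitrary: h)
  case 0
  then show ?case by simp
next
  case (Suc e)
  have "fdiff F h \<phi> e \<in> A"
    by (rule fdiff_mem[OF assms(1)], rule Suc.prems(2)) auto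
  then have "fdiff F (h + \<phi> e) \<phi> e \<in> A"
    using Suc.prems(1) additive_subgroup_add[OF assms(1)] by fastforce
  then have "F (h + \<phi> e + sum \<phi> {..<e}) \<in> A"
  proof (rule Suc.IH)
    fix S assume *: "S \<subset> {..<e}"
    then have "insert e S \<subset> {..<Suc e}" by auto
    from Suc.prems(2)[OF this] * show "F (h + \<phi> e + sum \<phi> S) \<in> A"
      by (simp add: sum_insert_Suc psubset_imp_subset)
  qed
  then show ?case by (simp add: sum_insert_Suc lessThan_Suc)
qed

text \<open>The counterpart for the empty set, whose coefficient is a sign; used in the
  Chevalley-Warning argument.\<close>

lemma fdiff_bot:
  assumes "additive_subgroup A" "fdiff F h \<phi> e \<in> A"
    and "\<And>S. S \<subseteq> {..<e} \<Longrightarrow> S \<noteq> {} \<Longrightarrow> F (h + sum \<phi> S) \<in> A"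
  shows "F h \<in> A"
  using assms(2,3)
proof (induction e)
  case 0
  then show ?case by simp
next
  case (Suc e)
  have "fdiff F (h + \<phi> e) \<phi> e \<in> A"
  proof (rule fdiff_mem[OF assms(1)])
    fix S assume "S \<subseteq> {..<e}"
    then show "F (h + \<phi> e + sum \<phi> S) \<in> A"
      using Suc.prems(2)[of "insert e S"] by (fastforce simp: sum_insert_Suc)
  qed
  then have "fdiff F (h + \<phi> e) \<phi> e - fdiff F h \<phi> (Suc e) \<in> A"
    using Suc.prems(1) additive_subgroup_diff[OF assms(1)] by blast
  then have "fdiff F h \<phi> e \<in> A" by simp
  then show ?case
    by (rule Suc.IH, intro Suc.prems(2)) auto
qed

text \<open>Degree less than \<open>e\<close>, with only the zero function at \<open>e = 0\<close>;
  degree at most \<open>d\<close> thus reads \<open>poly_less (Suc d)\<close>.\<close>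

fun poly_less :: "nat \<Rightarrow> ('a::ab_group_add \<Rightarrow> 'b::ab_group_add) \<Rightarrow> bool" where
  "poly_less 0 F \<longleftrightarrow> (\<forall>h. F h = 0)"
| "poly_less (Suc e) F \<longleftrightarrow> (\<forall>g. poly_less e (\<lambda>h. F (h + g) - F h))"

lemma poly_less_zero: "poly_less e (\<lambda>h. 0)"
  by (induction e) simp_all

lemma poly_less_add: "poly_less e F \<Longrightarrow> poly_less e G \<Longrightarrow> poly_less e (\<lambda>h. F h + G h)"
proof (induction e arbitrary: F G)
  case (Suc e)
  have "poly_less e (\<lambda>h. (F (h + g) - F h) + (G (h + g) - G h))" for g
    using Suc.prems by (intro Suc.IH) simp_all
  then show ?case by (simp add: algebra_simps)
qed simp

lemma poly_less_uminus: "poly_less e F \<Longrightarrow> poly_less e (\<lambda>h. - F h)"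
proof (induction e arbitrary: F)
  case (Suc e)
  have "poly_less e (\<lambda>h. - (F (h + g) - F h))" for g
    using Suc.prems by (intro Suc.IH) simp_all
  then show ?case by simp
qed simp

lemma poly_less_diff: "poly_less e F \<Longrightarrow> poly_less e G \<Longrightarrow> poly_less e (\<lambda>h. F h - G h)"
  using poly_less_add[of e F "\<lambda>h. - G h"] poly_less_uminus[of e G] by simp

lemma poly_less_sum: "(\<And>i. i \<in> I \<Longrightarrow> poly_less e (F i)) \<Longrightarrow> poly_less e (\<lambda>h. \<Sum>i\<in>I. F i h)"
  by (induction I rule: infinite_finite_induct) (simp_all add: poly_less_zero poly_less_add)

lemma poly_less_translate: "poly_less e F \<Longrightarrow> poly_less e (\<lambda>h. F (h + a))"
proof (induction e arbitrary: F)
  case (Suc e)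
  show ?case
  proof (simp, intro allI)
    fix g
    have "poly_less e (\<lambda>h. F (h + g) - F h)" using Suc.prems by simp
    from Suc.IH[OF this] show "poly_less e (\<lambda>h. F (h + g + a) - F (h + a))"
      by (simp add: ac_simps)
  qed
qed simp

lemma poly_less_Suc: "poly_less e F \<Longrightarrow> poly_less (Suc e) F"
proof (induction e arbitrary: F)
  case (Suc e)
  show ?case
    unfolding poly_less.simps(2)[of "Suc e"] using Suc.prems
    by (blast intro: Suc.IH dest: poly_less.simps(2)[THEN iffD1])
qed simp

lemma poly_less_mono:
  assumes "poly_less e F" "e \<le> e'"
  shows "poly_less e' F"
  using assms(2,1) by (induction e' rule: dec_induct) (blast intro: poly_less_Suc)+

lemma poly_less_const: "poly_less (Suc e) (\<lambda>h. c)"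
  by (rule poly_less_mono[of "Suc 0"]) (simp, simp)

lemma poly_less_additive:
  assumes "\<And>x y. F (x + y) = F x + F y"
  shows "poly_less (Suc (Suc 0)) F"
  using assms by simp

lemma poly_less_compose_additive:
  assumes "\<And>x y. \<alpha> (x + y) = \<alpha> x + \<alpha> y"
  shows "poly_less e F \<Longrightarrow> poly_less e (\<lambda>h. F (\<alpha> h))"
proof (induction e arbitrary: F)
  case (Suc e)
  have "poly_less e (\<lambda>h. F (\<alpha> h + \<alpha> g) - F (\<alpha> h))" for g
    using Suc.prems by (intro Suc.IH[of "\<lambda>h. F (h + \<alpha> g) - F h"]) simp
  then show ?case by (simp add: assms)
qed simp

text \<open>Leibniz rule: the difference of \<open>F * G\<close> is the difference of
  \<open>F\<close> times a translate of \<open>G\<close>, plus \<open>F\<close> times the difference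
  of \<open>G\<close>. Constant factors have zero difference, which settles \<open>a = 0\<close> and
  \<open>b = 0\<close>.\<close>

lemma poly_less_mult:
  fixes F G :: "'a::ab_group_add \<Rightarrow> 'b::comm_ring_1"
  assumes "poly_less (Suc a) F" "poly_less (Suc b) G"
  shows "poly_less (Suc (a + b)) (\<lambda>h. F h * G h)"
  using assms
proof (induction "a + b" arbitrary: a b F G rule: less_induct)
  case less
  have "poly_less (a + b) (\<lambda>h. F (h + g) * G (h + g) - F h * G h)" for g
  proof -
    let ?DF = "\<lambda>h. F (h + g) - F h" and ?DG = "\<lambda>h. G (h + g) - G h"
    have "poly_less (a + b) (\<lambda>h. ?DF h * G (h + g))"
    proof (cases a)
      case 0
      then have "?DF h = 0" for h using less.prems(1) by simp
      then show ?thesis by (simp add: poly_less_zero)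
    next
      case (Suc a')
      then have "poly_less (Suc a') ?DF" using less.prems(1) by (simp del: poly_less.simps(1))
      then have "poly_less (Suc (a' + b)) (\<lambda>h. ?DF h * G (h + g))"
        using Suc less.prems(2) by (intro less.hyps poly_less_translate) simp_all
      then show ?thesis using Suc by simp
    qed
    moreover have "poly_less (a + b) (\<lambda>h. F h * ?DG h)"
    proof (cases b)
      case 0
      then have "?DG h = 0" for h using less.prems(2) by simp
      then show ?thesis by (simp add: poly_less_zero)
    next
      case (Suc b')
      then have "poly_less (Suc b') ?DG" using less.prems(2) by (simp del: poly_less.simps(1))
      then have "poly_less (Suc (a + b')) (\<lambda>h. F h * ?DG h)"
        using Suc less.prems(1) by (intro less.hyps) simp_all
      then show ?thesis using Suc by simp
    qed
    ultimately have "poly_less (a + b) (\<lambda>h. ?DF h * G (h + g) + F h * ?DG h)"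
      by (rule poly_less_add)
    moreover have "(\<lambda>h. ?DF h * G (h + g) + F h * ?DG h) = (\<lambda>h. F (h + g) * G (h + g) - F h * G h)"
      by (simp add: algebra_simps)
    ultimately show ?thesis by simp
  qed
  then show ?case by simp
qed

lemma poly_less_prod:
  fixes F :: "'i \<Rightarrow> 'a::ab_group_add \<Rightarrow> 'b::comm_ring_1"
  assumes "finite I" "\<And>i. i \<in> I \<Longrightarrow> poly_less (Suc a) (F i)"
  shows "poly_less (Suc (card I * a)) (\<lambda>h. \<Prod>i\<in>I. F i h)"
  using assms
proof (induction I rule: finite_induct)
  case empty
  then show ?case by (simp only: prod.empty poly_less_const)
next
  case (insert i I)
  then have "poly_less (Suc (a + card I * a)) (\<lambda>h. F i h * (\<Prod>i\<in>I. F i h))"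
    by (intro poly_less_mult) blast+
  then show ?case using insert.hyps by (simp del: poly_less.simps)
qed

lemma poly_less_power:
  fixes F :: "'a::ab_group_add \<Rightarrow> 'b::comm_ring_1"
  assumes "poly_less (Suc a) F"
  shows "poly_less (Suc (k * a)) (\<lambda>h. F h ^ k)"
  using poly_less_prod[of "{..<k}" a "\<lambda>_. F"] assms by (simp del: poly_less.simps)

text \<open>Differences commute. This reconciles \<open>poly_less\<close>, which applies a
  difference to \<open>F\<close> first, with \<open>fdiff\<close>, which applies it last.\<close>

lemma fdiff_shift: "fdiff (\<lambda>h. F (h + g) - F h) h \<phi> e = fdiff F (h + g) \<phi> e - fdiff F h \<phi> e"
  by (induction e arbitrary: h) (simp_all add: algebra_simps)

lemma fdiff_poly_less: "poly_less e F \<Longrightarrow> fdiff F h \<phi> e = 0"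
proof (induction e arbitrary: F h)
  case (Suc e)
  then have "fdiff (\<lambda>h. F (h + \<phi> e) - F h) h \<phi> e = 0"
    by simp
  then show ?case by (simp add: fdiff_shift)
qed simp
section \<open>Linear maps of sequences acting on forms\<close>

type_synonym 'k seq = "nat \<Rightarrow> 'k"
type_synonym 'k form = "'k seq list \<Rightarrow> 'k"

lemma sum_fun_apply: "(\<Sum>i\<in>I. f i) x = (\<Sum>i\<in>I. f i x)"
  by (induction I rule: infinite_finite_induct) simp_all

text \<open>Explicit maps are written as such substitutions of coordinates, so that continuity and
  the block conditions become conditions on \<open>\<kappa>\<close>.\<close>

definition cmap :: "(nat \<Rightarrow> nat option) \<Rightarrow> 'k::field seq \<Rightarrow> 'k seq" where
  "cmap \<kappa> w = (\<lambda>j. case \<kappa> j of None \<Rightarrow> 0 | Some i \<Rightarrow> w i)"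

text \<open>Vectors with \<open>n\<close> entries are represented by the sequences fixed by
  \<open>trunc n\<close>, and \<open>T \<bullet> trunc n = T\<close> says that \<open>T\<close>
  lives on the first \<open>n\<close> coordinates.\<close>

definition trunc :: "nat \<Rightarrow> 'k::field seq \<Rightarrow> 'k seq" where
  "trunc n w = (\<lambda>j. if j < n then w j else 0)"

lemma trunc_eq_cmap: "trunc n = cmap (\<lambda>j. if j < n then Some j else None)"
  by (rule ext) (auto simp: trunc_def cmap_def)

lemma trunc_trunc [simp]: "trunc m (trunc n w) = trunc (min m n) w"
  by (auto simp: trunc_def)

lemma trunc_comp_trunc: "trunc m \<circ> trunc n = trunc (min m n)"
  by (rule ext) simp

lemma trunc_zero [simp]: "trunc n 0 = 0"
  by (auto simp: trunc_def)

lemma trunc_add: "trunc n (v + w) = trunc n v + trunc n w"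
  by (auto simp: trunc_def)

lemma trunc_0 [simp]: "trunc 0 w = 0"
  by (auto simp: trunc_def)

text \<open>
  The last conjunct is continuity for the product topology: without it, precomposition with \<open>g\<close> would
  not preserve the forms that depend on finitely many coordinates only.
\<close>

definition lin :: "('k::field seq \<Rightarrow> 'k seq) \<Rightarrow> bool" where
  "lin g \<longleftrightarrow> (\<forall>v w. g (v + w) = g v + g w) \<and> (\<forall>c v. g (\<lambda>i. c * v i) = (\<lambda>i. c * g v i)) \<and>
     (\<forall>n. \<exists>m. \<forall>w. trunc n (g (trunc m w)) = trunc n (g w))"

lemma lin_add: "lin g \<Longrightarrow> g (v + w) = g v + g w"
  by (simp add: lin_def)

lemma lin_zero: "lin g \<Longrightarrow> g 0 = 0"
  using lin_add[of g 0 0] by simp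

lemma lin_diff: "lin g \<Longrightarrow> g (v - w) = g v - g w"
  using lin_add[of g "v - w" w] by (simp add: algebra_simps)

lemma lin_continuous:
  assumes "lin g"
  obtains m where "\<And>m' w. m \<le> m' \<Longrightarrow> trunc n (g (trunc m' w)) = trunc n (g w)"
proof -
  obtain m where m: "\<And>w. trunc n (g (trunc m w)) = trunc n (g w)"
    using assms unfolding lin_def by blast
  have "trunc n (g (trunc m' w)) = trunc n (g w)" if "m \<le> m'" for m' w
    using m[of "trunc m' w"] m[of w] that by (simp add: min_absorb1)
  then show ?thesis by (rule that)
qed

lemma lin_id: "lin id"
  unfolding lin_def by (auto intro: min.idem[THEN arg_cong, of "\<lambda>n. trunc n w" for w])

lemma lin_comp:
  assumes "lin g" "lin h"
  shows "lin (g \<circ> h)"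
proof -
  have "\<exists>m. \<forall>w. trunc n (g (h (trunc m w))) = trunc n (g (h w))" for n
  proof -
    obtain m1 where m1: "\<And>m' w. m1 \<le> m' \<Longrightarrow> trunc n (g (trunc m' w)) = trunc n (g w)"
      using lin_continuous[OF assms(1)] by metis
    obtain m2 where m2: "\<And>m' w. m2 \<le> m' \<Longrightarrow> trunc m1 (h (trunc m' w)) = trunc m1 (h w)"
      using lin_continuous[OF assms(2)] by metis
    have "trunc n (g (h (trunc m2 w))) = trunc n (g (h w))" for w
      using m1[of m1 "h (trunc m2 w)"] m1[of m1 "h w"] m2[of m2 w] by simp
    then show ?thesis by blast
  qed
  then show ?thesis using assms by (simp add: lin_def)
qed

lemma lin_plus:
  assumes "lin g" "lin h"
  shows "lin (g + h)"
proof -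
  have "\<exists>m. \<forall>w. trunc n ((g + h) (trunc m w)) = trunc n ((g + h) w)" for n
  proof -
    obtain m1 where m1: "\<And>m' w. m1 \<le> m' \<Longrightarrow> trunc n (g (trunc m' w)) = trunc n (g w)"
      using lin_continuous[OF assms(1)] by metis
    obtain m2 where m2: "\<And>m' w. m2 \<le> m' \<Longrightarrow> trunc n (h (trunc m' w)) = trunc n (h w)"
      using lin_continuous[OF assms(2)] by metis
    show ?thesis
      by (rule exI[of _ "max m1 m2"]) (simp add: trunc_add m1 m2)
  qed
  then show ?thesis using assms by (simp add: lin_def algebra_simps fun_eq_iff)
qed

lemma lin_zero_map: "lin 0"
  unfolding lin_def by (auto simp: fun_eq_iff)

lemma lin_cmap: "lin (cmap \<kappa> :: 'k::field seq \<Rightarrow> 'k seq)"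
proof -
  have "\<exists>m. \<forall>w :: 'k seq. trunc n (cmap \<kappa> (trunc m w)) = trunc n (cmap \<kappa> w)" for n
  proof -
    \<comment> \<open>The first \<open>n\<close> outputs read finitely many inputs, and the sum of
      their indices bounds each index.\<close>
    define m where "m = Suc (\<Sum>j<n. case \<kappa> j of None \<Rightarrow> 0 | Some i \<Rightarrow> i)"
    have "i < m" if "j < n" "\<kappa> j = Some i" for i j
      using member_le_sum[of j "{..<n}" "\<lambda>j. case \<kappa> j of None \<Rightarrow> 0 | Some i \<Rightarrow> i"] that
      by (simp add: m_def less_Suc_eq_le)
    then have "trunc n (cmap \<kappa> (trunc m w)) = trunc n (cmap \<kappa> w)" for w :: "'k seq"
      by (auto simp: trunc_def cmap_def fun_eq_iff split: option.split)
    then show ?thesis by blast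
  qed
  then show ?thesis by (auto simp: lin_def cmap_def fun_eq_iff split: option.split)
qed

lemma lin_trunc: "lin (trunc n)"
  by (simp add: trunc_eq_cmap lin_cmap)

section \<open>Maps that fix an initial block of coordinates\<close>

definition block_maps :: "nat \<Rightarrow> ('k::field seq \<Rightarrow> 'k seq) set" where
  "block_maps u =
     {g. lin g \<and> (\<forall>w. trunc u (g w) = trunc u w) \<and> (\<forall>w. g (trunc u w) = trunc u w)}"

text \<open>In the splitting into the first \<open>u\<close> coordinates and the rest, block maps
  have the shape \<open>id \<oplus> g'\<close>. The maps \<open>0 \<oplus> g'\<close> are the
  directions in which they may be varied.\<close>

definition block_dirs :: "nat \<Rightarrow> ('k::field seq \<Rightarrow> 'k seq) set" where
  "block_dirs u = {g. lin g \<and> (\<forall>w. trunc u (g w) = 0) \<and> (\<forall>w. g (trunc u w) = 0)}"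

lemma block_maps_lin: "g \<in> block_maps u \<Longrightarrow> lin g"
  by (simp add: block_maps_def)

lemma block_maps_id: "id \<in> block_maps u"
  by (simp add: block_maps_def lin_id)

lemma block_maps_comp: "g \<in> block_maps u \<Longrightarrow> h \<in> block_maps u \<Longrightarrow> g \<circ> h \<in> block_maps u"
  by (simp add: block_maps_def lin_comp)

lemma block_maps_antimono:
  assumes "u \<le> u'"
  shows "block_maps u' \<subseteq> block_maps u"
proof
  fix g :: "'k::field seq \<Rightarrow> 'k seq" assume g: "g \<in> block_maps u'"
  have "trunc u (g w) = trunc u w" for w
  proof -
    have "trunc u (trunc u' (g w)) = trunc u (trunc u' w)"
      using g by (simp add: block_maps_def del: trunc_trunc)
    then show ?thesis using assms by (simp add: min_absorb1)
  qed
  moreover have "g (trunc u w) = trunc u w" for w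
  proof -
    have "g (trunc u' (trunc u w)) = trunc u' (trunc u w)"
      using g by (simp add: block_maps_def del: trunc_trunc)
    then show ?thesis using assms by (simp add: min_absorb2)
  qed
  ultimately show "g \<in> block_maps u" using g by (simp add: block_maps_def)
qed

lemma block_dirs_antimono:
  assumes "u \<le> u'"
  shows "block_dirs u' \<subseteq> block_dirs u"
proof
  fix g :: "'k::field seq \<Rightarrow> 'k seq" assume g: "g \<in> block_dirs u'"
  have "trunc u (g w) = 0" for w
  proof -
    have "trunc u (trunc u' (g w)) = trunc u 0"
      using g by (simp add: block_dirs_def del: trunc_trunc)
    then show ?thesis using assms by (simp add: min_absorb1)
  qed
  moreover have "g (trunc u w) = 0" for w
  proof -
    have "g (trunc u' (trunc u w)) = 0"
      using g by (simp add: block_dirs_def del: trunc_trunc)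
    then show ?thesis using assms by (simp add: min_absorb2)
  qed
  ultimately show "g \<in> block_dirs u" using g by (simp add: block_dirs_def)
qed

lemma block_maps_add_dirs: "g \<in> block_maps u \<Longrightarrow> h \<in> block_dirs u \<Longrightarrow> g + h \<in> block_maps u"
  by (simp add: block_maps_def block_dirs_def lin_plus trunc_add)

lemma block_dirs_add: "g \<in> block_dirs u \<Longrightarrow> h \<in> block_dirs u \<Longrightarrow> g + h \<in> block_dirs u"
  by (simp add: block_dirs_def lin_plus trunc_add)

lemma block_dirs_sum: "(\<And>i. i \<in> I \<Longrightarrow> f i \<in> block_dirs u) \<Longrightarrow> sum f I \<in> block_dirs u"
proof (induction I rule: infinite_finite_induct)
  case (insert x F)
  then have "f x + sum f F \<in> block_dirs u" by (intro block_dirs_add) simp_all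
  then show ?case by (simp only: sum.insert[OF insert.hyps])
qed (simp_all add: block_dirs_def lin_zero_map)

lemma cmap_block_maps:
  assumes "\<And>j. j < u \<Longrightarrow> \<kappa> j = Some j" "\<And>j i. u \<le> j \<Longrightarrow> \<kappa> j = Some i \<Longrightarrow> u \<le> i"
  shows "cmap \<kappa> \<in> (block_maps u :: ('k::field seq \<Rightarrow> 'k seq) set)"
proof -
  have "cmap \<kappa> (trunc u w) j = trunc u w j" for w :: "'k seq" and j
    using assms[of j] by (cases "j < u") (fastforce simp: trunc_def cmap_def split: option.split)+
  moreover have "trunc u (cmap \<kappa> w) j = trunc u w j" for w :: "'k seq" and j
    using assms(1) by (simp add: trunc_def cmap_def)
  ultimately show ?thesis by (simp add: block_maps_def lin_cmap fun_eq_iff)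
qed

lemma cmap_block_dirs:
  assumes "\<And>j. j < u \<Longrightarrow> \<kappa> j = None" "\<And>j i. \<kappa> j = Some i \<Longrightarrow> u \<le> i"
  shows "cmap \<kappa> \<in> (block_dirs u :: ('k::field seq \<Rightarrow> 'k seq) set)"
proof -
  have "cmap \<kappa> (trunc u w) j = 0" for w :: "'k seq" and j
    using assms(2)[of j] by (fastforce simp: trunc_def cmap_def split: option.split)
  moreover have "trunc u (cmap \<kappa> w) j = 0" for w :: "'k seq" and j
    using assms(1) by (simp add: trunc_def cmap_def)
  ultimately show ?thesis by (simp add: block_dirs_def lin_cmap fun_eq_iff)
qed

lemma trunc_block_maps: "u \<le> n \<Longrightarrow> trunc n \<in> block_maps u"
  unfolding trunc_eq_cmap by (rule cmap_block_maps) (auto split: if_splits)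

section \<open>The right action on forms by precomposition\<close>

definition act :: "'k form \<Rightarrow> ('k seq \<Rightarrow> 'k seq) \<Rightarrow> 'k form"  (infixl "\<bullet>" 75) where
  "T \<bullet> g = (\<lambda>l. T (map g l))"

lemma act_apply: "(T \<bullet> g) l = T (map g l)"
  by (simp add: act_def)

lemma act_act: "T \<bullet> g \<bullet> h = T \<bullet> (g \<circ> h)"
  by (simp add: act_def fun_eq_iff)

lemma act_id [simp]: "T \<bullet> id = T"
  by (simp add: act_def)

lemma act_add: "(S + T) \<bullet> g = S \<bullet> g + T \<bullet> g"
  by (simp add: act_def fun_eq_iff)

lemma act_diff: "(S - T) \<bullet> g = S \<bullet> g - T \<bullet> g"
  by (simp add: act_def fun_eq_iff)

lemma act_zero [simp]: "0 \<bullet> g = 0"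
  by (simp add: act_def fun_eq_iff)

lemma act_trunc_mono:
  assumes "T \<bullet> trunc n = T" "n \<le> m"
  shows "T \<bullet> trunc m = T"
  using assms by (metis act_act min_absorb1 trunc_comp_trunc)

text \<open>Multiplication by \<open>x\<close> permutes the nonzero elements; compare their
  products.\<close>

lemma finite_field_power_card_minus_1:
  fixes x :: "'k::{field,finite}"
  assumes "x \<noteq> 0"
  shows "x ^ (card (UNIV :: 'k set) - 1) = 1"
proof -
  let ?A = "UNIV - {0::'k}"
  have bij: "bij_betw ((*) x) ?A ?A"
    by (rule bij_betw_byWitness[where f' = "\<lambda>y. y / x"]) (use assms in auto)
  have "(\<Prod>y\<in>?A. y) = (\<Prod>y\<in>?A. x * y)"
    using prod.reindex_bij_betw[OF bij, of "\<lambda>y. y"] by simp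
  also have "\<dots> = x ^ card ?A * (\<Prod>y\<in>?A. y)"
    by (simp add: prod.distrib)
  finally have "(\<Prod>y\<in>?A. y) * 1 = (\<Prod>y\<in>?A. y) * x ^ card ?A" by simp
  moreover have "(\<Prod>y\<in>?A. y) \<noteq> 0" by simp
  ultimately show ?thesis by (simp add: card_Diff_singleton)
qed

lemma finite_range_trunc: "finite (range (trunc n :: 'k::{field,finite} seq \<Rightarrow> 'k seq))"
proof (rule finite_subset)
  show "range (trunc n :: 'k seq \<Rightarrow> 'k seq) \<subseteq> {f. \<forall>j. (j \<in> {..<n} \<longrightarrow> f j \<in> UNIV) \<and> (j \<notin> {..<n} \<longrightarrow> f j = 0)}"
    by (auto simp: trunc_def)
  show "finite {f :: 'k seq. \<forall>j. (j \<in> {..<n} \<longrightarrow> f j \<in> UNIV) \<and> (j \<notin> {..<n} \<longrightarrow> f j = 0)}"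
    by (rule finite_set_of_finite_funs) simp_all
qed
text \<open>Translates of \<open>r\<close> are added one at a time, which is what
  \<open>generated_walk\<close> follows. Closure under subtraction comes from positive
  characteristic, see \<open>generated_submodule\<close>.\<close>

inductive_set generated ::
    "nat \<Rightarrow> 'k::{field,finite} form set \<Rightarrow> 'k form \<Rightarrow> 'k form set" for u A r where
  base: "a \<in> A \<Longrightarrow> a \<in> generated u A r"
| step: "x \<in> generated u A r \<Longrightarrow> g \<in> block_maps u \<Longrightarrow> x + r \<bullet> g \<in> generated u A r"

definition proj :: "nat \<Rightarrow> nat set \<Rightarrow> 'k::field seq \<Rightarrow> 'k seq" where
  "proj u S w = (\<lambda>j. if j < u \<or> j \<in> S then w j else 0)"

text \<open>\<open>b \<bullet> skip u n = b\<close> expresses that \<open>b\<close> does not see the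
  coordinates in \<open>{u..<n}\<close>.\<close>

definition skip :: "nat \<Rightarrow> nat \<Rightarrow> 'k::field seq \<Rightarrow> 'k seq" where
  "skip u n = proj u {n..}"

text \<open>\<open>r \<bullet> shift u n\<close> is a copy of \<open>r\<close> whose coordinates
  from \<open>u\<close> on have been moved to those from \<open>n\<close> on.\<close>

definition shift :: "nat \<Rightarrow> nat \<Rightarrow> 'k::field seq \<Rightarrow> 'k seq" where
  "shift u n w = (\<lambda>j. if j < u then w j else w (j - u + n))"

lemma proj_block_maps:
  "S \<subseteq> {u..} \<Longrightarrow> (proj u S :: 'k::field seq \<Rightarrow> 'k seq) \<in> block_maps u"
proof -
  have "(proj u S :: 'k::field seq \<Rightarrow> 'k seq) = cmap (\<lambda>j. if j < u \<or> j \<in> S then Some j else None)"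
    by (rule ext) (auto simp: proj_def cmap_def)
  then show "S \<subseteq> {u..} \<Longrightarrow> (proj u S :: 'k seq \<Rightarrow> 'k seq) \<in> block_maps u"
    by (auto intro!: cmap_block_maps split: if_splits)
qed

lemma skip_block_maps: "u \<le> n \<Longrightarrow> skip u n \<in> block_maps u"
  unfolding skip_def by (rule proj_block_maps) auto

lemma shift_block_maps:
  "u \<le> n \<Longrightarrow> (shift u n :: 'k::field seq \<Rightarrow> 'k seq) \<in> block_maps u"
proof -
  have "(shift u n :: 'k::field seq \<Rightarrow> 'k seq) = cmap (\<lambda>j. if j < u then Some j else Some (j - u + n))"
    by (rule ext) (auto simp: shift_def cmap_def)
  then show "u \<le> n \<Longrightarrow> (shift u n :: 'k seq \<Rightarrow> 'k seq) \<in> block_maps u"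
    by (auto intro!: cmap_block_maps split: if_splits)
qed

lemma skip_idem: "skip u n \<circ> skip u n = skip u n"
  by (auto simp: skip_def proj_def fun_eq_iff)

lemma skip_self: "skip u u = id"
  by (auto simp: skip_def proj_def fun_eq_iff)

lemma skip_trunc: "u \<le> n \<Longrightarrow> skip u n \<circ> trunc n = trunc u"
  by (auto simp: skip_def proj_def trunc_def fun_eq_iff)

lemma shift_trunc: "shift u n \<circ> trunc (n + m) = trunc (u + m) \<circ> shift u n" if "u \<le> n"
  using that by (auto simp: shift_def trunc_def fun_eq_iff)

lemma shift_skip: "shift u n \<circ> skip u n = shift u n"
  by (auto simp: shift_def skip_def proj_def fun_eq_iff)
lemma skip_eq: "u \<le> n \<Longrightarrow> skip u n w = w - trunc n w + trunc u w"
  by (auto simp: skip_def proj_def trunc_def fun_eq_iff)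

lemma skip_commute:
  assumes "u \<le> n" "g \<in> block_maps n"
  shows "g \<circ> skip u n = skip u n \<circ> g"
proof
  fix w
  have u: "g \<in> block_maps u" using assms block_maps_antimono by blast
  have "trunc u (g w) = trunc u w" "g (trunc u w) = trunc u w"
    "trunc n (g w) = trunc n w" "g (trunc n w) = trunc n w"
    using u assms(2) by (simp_all add: block_maps_def)
  then show "(g \<circ> skip u n) w = (skip u n \<circ> g) w"
    by (simp only: comp_apply skip_eq[OF assms(1)] lin_add[OF block_maps_lin[OF u]]
        lin_diff[OF block_maps_lin[OF u]])
qed

lemma block_dirs_skip:
  assumes "u \<le> n" "\<phi> \<in> block_dirs n"
  shows "\<phi> \<circ> skip u n = \<phi>"
proof
  fix w
  have "\<phi> \<in> block_dirs u" using assms block_dirs_antimono by blast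
  then have "\<phi> (trunc u w) = 0" "\<phi> (trunc n w) = 0" "lin \<phi>"
    using assms(2) by (simp_all add: block_dirs_def)
  then show "(\<phi> \<circ> skip u n) w = \<phi> w"
    by (simp only: comp_apply skip_eq[OF assms(1)] lin_add lin_diff diff_zero add_0_right)
qed

definition middle :: "nat \<Rightarrow> nat \<Rightarrow> 'k::field seq \<Rightarrow> 'k seq" where
  "middle u n = cmap (\<lambda>j. if u \<le> j \<and> j < n then Some j else None)"

lemma middle_block_dirs: "middle u n \<in> block_dirs u"
  unfolding middle_def by (rule cmap_block_dirs) (auto split: if_splits)

lemma middle_eq: "u \<le> n \<Longrightarrow> middle u n w = trunc n w - trunc u w"
  by (auto simp: middle_def cmap_def trunc_def fun_eq_iff)

text \<open>The single direction \<open>middle u n\<close> leads from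
  \<open>skip u n \<circ> h\<close> to \<open>h\<close>. This extra difference lowers the degree in
  \<open>skipped_degree_less\<close>.\<close>

lemma skip_comp_add_middle:
  assumes "u \<le> n" "h \<in> block_maps n"
  shows "(skip u n \<circ> h) + middle u n = h"
proof (intro ext)
  fix w j
  have "h \<in> block_maps u" using assms block_maps_antimono by blast
  then have "trunc u (h w) = trunc u w" "trunc n (h w) = trunc n w"
    using assms(2) by (simp_all add: block_maps_def)
  then show "((skip u n \<circ> h) + middle u n) w j = h w j"
    by (simp add: skip_eq[OF assms(1)] middle_eq[OF assms(1)])
qed
section \<open>Polynomial forms of bounded degree\<close>

locale form_degree =
  fixes d :: nat
begin

definition trunc_lists :: "nat \<Rightarrow> 'k::{field,finite} seq list set" where
  "trunc_lists n = {l. set l \<subseteq> range (trunc n) \<and> length l = d}"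

lemma finite_trunc_lists: "finite (trunc_lists n)"
  unfolding trunc_lists_def by (rule finite_lists_length_eq[OF finite_range_trunc])

lemma map_trunc_in_trunc_lists: "length l = d \<Longrightarrow> map (trunc n) l \<in> trunc_lists n"
  by (auto simp: trunc_lists_def)

text \<open>Multilinearity is replaced by the degree bound in \<open>h\<close>, where
  \<open>h\<close> runs through all self-maps of the sequence space under pointwise addition.
  Vanishing on lists of other lengths leaves finitely many forms on \<open>n\<close>
  coordinates.\<close>

definition forms :: "'k::{field,finite} form set" where
  "forms = {T. (\<forall>l. length l \<noteq> d \<longrightarrow> T l = 0) \<and> (\<exists>n. T \<bullet> trunc n = T) \<and>
     (\<forall>l. poly_less (Suc d) (\<lambda>h :: 'k seq \<Rightarrow> 'k seq. T (map h l)))}"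

lemma forms_level:
  assumes "T \<in> forms"
  obtains n where "u \<le> n" "T \<bullet> trunc n = T"
proof -
  obtain n where "T \<bullet> trunc n = T" using assms by (auto simp: forms_def)
  then have "T \<bullet> trunc (max u n) = T" by (rule act_trunc_mono) simp
  then show ?thesis by (rule that[rotated]) simp
qed

lemma forms_poly: "T \<in> forms \<Longrightarrow> poly_less (Suc d) (\<lambda>h :: 'k::{field,finite} seq \<Rightarrow> 'k seq. T (map h l))"
  by (simp add: forms_def)

lemma forms_subgroup: "additive_subgroup forms"
  unfolding additive_subgroup_def
proof (intro conjI ballI)
  show "0 \<in> forms" by (auto simp: forms_def poly_less_zero simp del: poly_less.simps)
next
  fix S T :: "'k::{field,finite} form" assume S: "S \<in> forms" and T: "T \<in> forms"
  obtain n where n: "T \<bullet> trunc n = T" using forms_level[OF T] by blast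
  obtain m where m: "n \<le> m" "S \<bullet> trunc m = S" using forms_level[OF S] by blast
  have "(S - T) \<bullet> trunc m = S - T"
    using m act_trunc_mono[OF n m(1)] by (simp add: act_diff)
  moreover have "poly_less (Suc d) (\<lambda>h :: 'k seq \<Rightarrow> 'k seq. (S - T) (map h l))" for l
    using poly_less_diff[OF forms_poly[OF S, of l] forms_poly[OF T, of l]]
    by (simp del: poly_less.simps)
  ultimately show "S - T \<in> forms"
    using S T unfolding forms_def by (simp del: poly_less.simps) blast
qed

lemma forms_act:
  fixes T :: "'k::{field,finite} form"
  assumes T: "T \<in> forms" and g: "lin g"
  shows "T \<bullet> g \<in> forms"
proof -
  obtain n where n: "T \<bullet> trunc n = T" using forms_level[OF T] by blast
  obtain m where "\<And>w. trunc n (g (trunc m w)) = trunc n (g w)"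
    using g unfolding lin_def by blast
  then have "trunc n \<circ> g \<circ> trunc m = trunc n \<circ> g" by (simp add: fun_eq_iff)
  then have "T \<bullet> g \<bullet> trunc m = T \<bullet> g"
    using n by (metis act_act)
  moreover have "poly_less (Suc d) (\<lambda>h :: 'k seq \<Rightarrow> 'k seq. (T \<bullet> g) (map h l))" for l
  proof -
    have "poly_less (Suc d) (\<lambda>h. T (map (g \<circ> h) l))"
      by (rule poly_less_compose_additive[OF _ forms_poly[OF T]])
         (use g in \<open>simp add: fun_eq_iff lin_add\<close>)
    then show ?thesis by (simp add: act_apply)
  qed
  ultimately show ?thesis
    using T unfolding forms_def by (simp add: act_apply del: poly_less.simps) blast
qed

lemma forms_zero_outside: "T \<in> forms \<Longrightarrow> length l \<noteq> d \<Longrightarrow> T l = 0"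
  by (simp add: forms_def)

text \<open>A form on \<open>n\<close> coordinates is determined by its values on the finite set
  \<open>trunc_lists n\<close>. All later counting arguments rest on this finiteness.\<close>

lemma finite_forms_level: "finite {T \<in> forms. T \<bullet> trunc n = (T :: 'k::{field,finite} form)}"
proof (rule finite_subset)
  let ?F = "{f :: 'k form. \<forall>l. (l \<in> trunc_lists n \<longrightarrow> f l \<in> UNIV) \<and> (l \<notin> trunc_lists n \<longrightarrow> f l = 0)}"
  let ?e = "\<lambda>f :: 'k form. \<lambda>l. if length l = d then f (map (trunc n) l) else 0"
  show "finite (?e ` ?F)"
    by (intro finite_imageI finite_set_of_finite_funs finite_trunc_lists) simp
  show "{T \<in> forms. T \<bullet> trunc n = T} \<subseteq> ?e ` ?F"
  proof safe
    fix T :: "'k form" assume T: "T \<in> forms" "T \<bullet> trunc n = T"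
    let ?f = "\<lambda>l. if l \<in> trunc_lists n then T l else 0"
    have "T l = ?e ?f l" for l
      using forms_zero_outside[OF T(1), of l] map_trunc_in_trunc_lists[of l n]
        arg_cong[OF T(2), of "\<lambda>f. f l"] by (simp add: act_apply)
    then have "T = ?e ?f" by (rule ext)
    moreover have "?f \<in> ?F" by auto
    ultimately show "T \<in> ?e ` ?F" by (rule image_eqI[where f = ?e])
  qed
qed

lemma forms_neq_on_trunc_lists:
  assumes "T \<in> forms" "h \<circ> trunc n = h" "h' \<circ> trunc n = h'" "T \<bullet> h \<noteq> T \<bullet> h'"
  obtains l where "l \<in> trunc_lists n" "T (map h l) \<noteq> T (map h' l)"
proof -
  obtain l where l: "T (map h l) \<noteq> T (map h' l)"
    using assms(4) by (auto simp: fun_eq_iff act_apply)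
  then have "length l = d"
    using forms_zero_outside[OF assms(1)] by (metis length_map)
  then have "map (trunc n) l \<in> trunc_lists n" by (rule map_trunc_in_trunc_lists)
  moreover have "map h (map (trunc n) l) = map h l" "map h' (map (trunc n) l) = map h' l"
    using assms(2,3) by (metis list.map_comp)+
  ultimately show ?thesis using l that by metis
qed

text \<open>
  As in Chevalley-Warning: the indicator of the condition \<open>T \<bullet> h = T \<bullet> h0\<close> is a polynomial \<open>\<Psi>\<close> of bounded
  degree in \<open>h\<close>, so its iterated differences of order \<open>N\<close> vanish, which is impossible if \<open>S = {}\<close> is the
  only subset where it does not vanish.
\<close>

lemma exists_subset_sum_same_value:
  "\<exists>N :: nat. \<forall>T\<in>forms. \<forall>h0 \<phi>. h0 \<circ> trunc n = h0 \<longrightarrow> (\<forall>k<N. \<phi> k \<circ> trunc n = \<phi> k) \<longrightarrow>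
     (\<exists>S \<subseteq> {..<N}. S \<noteq> {} \<and> T \<bullet> (h0 + sum \<phi> S) = (T \<bullet> h0 :: 'k::{field,finite} form))"
proof -
  let ?q = "card (UNIV :: 'k set) - 1" and ?L = "trunc_lists n :: 'k seq list set"
  \<comment> \<open>Each factor of \<open>\<Psi>\<close> below has degree at most
    \<open>?q * d\<close>, and there is one factor for each list in \<open>?L\<close>; so
    \<open>\<Psi>\<close> has degree less than \<open>N\<close>, uniformly in \<open>T\<close>,
    \<open>h0\<close> and \<open>\<phi>\<close>.\<close>
  define N where "N = Suc (card ?L * (?q * d))"
  have main: "\<exists>S \<subseteq> {..<N}. S \<noteq> {} \<and> T \<bullet> (h0 + sum \<phi> S) = T \<bullet> h0"
    if T: "T \<in> forms" and h0: "h0 \<circ> trunc n = h0" and \<phi>: "\<forall>k<N. \<phi> k \<circ> trunc n = \<phi> k"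
    for T :: "'k form" and h0 and \<phi> :: "nat \<Rightarrow> 'k seq \<Rightarrow> 'k seq"
  proof (rule ccontr)
    assume neg: "\<not> ?thesis"
    define \<Psi> where "\<Psi> h = (\<Prod>l\<in>?L. 1 - (T (map h l) - T (map h0 l)) ^ ?q)" for h
    have "poly_less N \<Psi>"
      unfolding \<Psi>_def N_def
      by (intro poly_less_prod finite_trunc_lists poly_less_diff poly_less_const poly_less_power
            forms_poly[OF T])
    then have 0: "fdiff \<Psi> h0 \<phi> N \<in> {0}" by (simp add: fdiff_poly_less)
    have "\<Psi> (h0 + sum \<phi> S) \<in> {0}" if S: "S \<subseteq> {..<N}" "S \<noteq> {}" for S
    proof -
      have "(h0 + sum \<phi> S) \<circ> trunc n = h0 + sum \<phi> S"
      proof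
        fix w
        have "\<phi> k (trunc n w) = \<phi> k w" if "k \<in> S" for k
          using \<phi> S that by (metis comp_apply lessThan_iff subsetD)
        moreover have "h0 (trunc n w) = h0 w" using h0 by (metis comp_apply)
        ultimately show "((h0 + sum \<phi> S) \<circ> trunc n) w = (h0 + sum \<phi> S) w"
          by (simp add: sum_fun_apply)
      qed
      moreover have "T \<bullet> (h0 + sum \<phi> S) \<noteq> T \<bullet> h0" using neg S by blast
      ultimately obtain l where l: "l \<in> ?L" "T (map (h0 + sum \<phi> S) l) \<noteq> T (map h0 l)"
        using forms_neq_on_trunc_lists[OF T _ h0] by metis
      then have "1 - (T (map (h0 + sum \<phi> S) l) - T (map h0 l)) ^ ?q = 0"
        using finite_field_power_card_minus_1[of "T (map (h0 + sum \<phi> S) l) - T (map h0 l)"]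
        by (simp del: One_nat_def)
      then show ?thesis unfolding \<Psi>_def using l(1) finite_trunc_lists by (auto intro!: prod_zero)
    qed
    then have "\<Psi> h0 \<in> {0}"
      by (intro fdiff_bot[OF _ 0]) (simp_all add: additive_subgroup_def)
    \<comment> \<open>A positive exponent makes every factor of \<open>\<Psi> h0\<close> equal to
      one.\<close>
    moreover have "?q > 0"
      using card_mono[of "UNIV :: 'k set" "{0, 1}"] by simp
    then have "\<Psi> h0 = 1" by (simp add: \<Psi>_def power_0_left del: One_nat_def)
    ultimately show False by simp
  qed
  show ?thesis
    by (rule exI[of _ N], intro ballI allI impI, rule main)
qed
subsection \<open>Submodules and their degree\<close>

definition submodule :: "nat \<Rightarrow> 'k::{field,finite} form set \<Rightarrow> bool" where
  "submodule u B \<longleftrightarrow>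
     additive_subgroup B \<and> B \<subseteq> forms \<and> (\<forall>T\<in>B. \<forall>g\<in>block_maps u. T \<bullet> g \<in> B)"

definition wqo_mod :: "nat \<Rightarrow> 'k::{field,finite} form set \<Rightarrow> 'k form set \<Rightarrow> bool" where
  "wqo_mod u A X \<longleftrightarrow>
     (\<forall>T :: nat \<Rightarrow> 'k form. (\<forall>i. T i \<in> X) \<longrightarrow>
        (\<exists>i j. i < j \<and> (\<exists>g\<in>block_maps u. T j \<bullet> g - T i \<in> A)))"

text \<open>For \<open>T \<in> B\<close>, the map \<open>h \<mapsto> T \<bullet> h\<close> on block
  maps has degree less than \<open>e\<close> modulo \<open>A\<close>. For \<open>e = 0\<close> this
  amounts to \<open>B \<subseteq> A\<close>.\<close>

definition degree_less ::
    "nat \<Rightarrow> nat \<Rightarrow> 'k::{field,finite} form set \<Rightarrow> 'k form set \<Rightarrow> bool" where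
  "degree_less u e B A \<longleftrightarrow>
     (\<forall>T\<in>B. \<forall>h\<in>block_maps u. \<forall>\<phi>. (\<forall>i<e. \<phi> i \<in> block_dirs u) \<longrightarrow>
        fdiff (\<lambda>h. T \<bullet> h) h \<phi> e \<in> A)"

text \<open>For \<open>A \<subseteq> B\<close> this is simplicity of \<open>B / A\<close>, the case
  \<open>A = B\<close> being included.\<close>

definition irreducible_over :: "nat \<Rightarrow> 'k::{field,finite} form set \<Rightarrow> 'k form set \<Rightarrow> bool" where
  "irreducible_over u A B \<longleftrightarrow> (\<forall>r\<in>B - A. B \<subseteq> generated u A r)"

lemma submodule_subgroup: "submodule u B \<Longrightarrow> additive_subgroup B"
  by (simp add: submodule_def)

lemma submodule_forms: "submodule u B \<Longrightarrow> T \<in> B \<Longrightarrow> T \<in> forms"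
  by (auto simp: submodule_def)

lemma submodule_act: "submodule u B \<Longrightarrow> T \<in> B \<Longrightarrow> g \<in> block_maps u \<Longrightarrow> T \<bullet> g \<in> B"
  by (simp add: submodule_def)

lemma submodule_zero: "submodule u B \<Longrightarrow> 0 \<in> B"
  by (simp add: submodule_def additive_subgroup_zero)

lemma submodule_diff: "submodule u B \<Longrightarrow> x \<in> B \<Longrightarrow> y \<in> B \<Longrightarrow> x - y \<in> B"
  by (simp add: submodule_def additive_subgroup_diff)

lemma submodule_add: "submodule u B \<Longrightarrow> x \<in> B \<Longrightarrow> y \<in> B \<Longrightarrow> x + y \<in> B"
  by (simp add: submodule_def additive_subgroup_add)

lemma submodule_uminus: "submodule u B \<Longrightarrow> x \<in> B \<Longrightarrow> - x \<in> B"
  by (simp add: submodule_def additive_subgroup_uminus)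

lemma submodule_mono: "submodule u B \<Longrightarrow> u \<le> u' \<Longrightarrow> submodule u' B"
  using block_maps_antimono[of u u'] unfolding submodule_def by blast

lemma degree_less_mono:
  assumes "degree_less u e B A" "u \<le> u'" "B' \<subseteq> B"
  shows "degree_less u' e B' A"
  using assms block_maps_antimono[OF assms(2)] block_dirs_antimono[OF assms(2)]
  unfolding degree_less_def by blast

lemma degree_less_forms: "degree_less u (Suc d) (forms :: 'k::{field,finite} form set) {0}"
  unfolding degree_less_def
proof (intro ballI allI impI)
  fix T :: "'k form" and h :: "'k seq \<Rightarrow> 'k seq" and \<phi>
  assume T: "T \<in> forms"
  have "fdiff (\<lambda>h. T \<bullet> h) h \<phi> e l = fdiff (\<lambda>h. T (map h l)) h \<phi> e" for e l
    by (induction e arbitrary: h) (simp_all add: act_apply)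
  then show "fdiff (\<lambda>h. T \<bullet> h) h \<phi> (Suc d) \<in> {0}"
    using fdiff_poly_less[OF forms_poly[OF T]] by (simp add: fun_eq_iff del: fdiff.simps)
qed

text \<open>Take \<open>S\<close> of least size with \<open>b \<bullet> proj u S \<notin> A\<close>.
  If \<open>S\<close> had \<open>e\<close> elements, the projections to \<open>e\<close> of them
  would serve as directions: by minimality every proper partial sum lands in \<open>A\<close>, and
  by the degree bound so does the difference, hence also the full sum by
  \<open>fdiff_top\<close>.\<close>

lemma degree_less_detect:
  fixes A :: "'k::{field,finite} form set"
  assumes A: "submodule u A" and deg: "degree_less u e B A"
    and b: "b \<in> B" "b \<in> forms" "b \<notin> A"
  obtains S where "finite S" "S \<subseteq> {u..}" "card S < e" "b \<bullet> proj u S \<notin> A"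
proof -
  let ?P = "\<lambda>S. finite S \<and> S \<subseteq> {u..} \<and> b \<bullet> proj u S \<notin> A"
  obtain n where n: "u \<le> n" "b \<bullet> trunc n = b" using forms_level[OF b(2)] by blast
  have "(trunc n :: 'k seq \<Rightarrow> 'k seq) = proj u {u..<n}"
    using n(1) by (auto simp: trunc_def proj_def fun_eq_iff)
  then have "?P {u..<n}" using n b(3) by auto
  then obtain S where S: "?P S" and min: "\<And>S'. ?P S' \<Longrightarrow> card S \<le> card S'"
    using ex_has_least_nat[of ?P "{u..<n}" card] by blast
  have "card S < e"
  proof (rule ccontr)
    assume "\<not> card S < e"
    then obtain S1 where S1: "S1 \<subseteq> S" "card S1 = e"
      using obtain_subset_with_card_n[of e S] by auto
    then obtain f where f: "bij_betw f {..<e} S1"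
      using ex_bij_betw_nat_finite[of S1] S finite_subset[of S1 S]
      by (auto simp: atLeast0LessThan)
    define \<phi> :: "nat \<Rightarrow> 'k seq \<Rightarrow> 'k seq"
      where "\<phi> i = cmap (\<lambda>j. if j = f i then Some j else None)" for i
    have sum: "proj u (S - S1) + sum \<phi> Q = proj u (S - S1 \<union> f ` Q)" if Q: "Q \<subseteq> {..<e}" for Q
    proof (intro ext)
      fix w :: "'k seq" and j
      have fin: "finite Q" using Q finite_subset by blast
      have inj: "inj_on f Q" using f Q by (meson bij_betw_imp_inj_on inj_on_subset)
      have "(\<Sum>k\<in>Q. if j = f k then w j else 0) = (\<Sum>k\<in>f ` Q. if j = k then w j else 0)"
        by (rule sum.reindex_cong[OF inj, symmetric]) simp_all
      also have "\<dots> = (if j \<in> f ` Q then w j else 0)"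
        using fin by simp
      finally have "(sum \<phi> Q) w j = (if j \<in> f ` Q then w j else 0)"
        by (simp add: sum_fun_apply \<phi>_def cmap_def if_distrib[of "case_option _ _"] cong: if_cong)
      moreover have "f ` Q \<subseteq> S1" using f Q by (auto simp: bij_betw_def)
      then have "j \<in> f ` Q \<Longrightarrow> j \<notin> S - S1 \<and> \<not> j < u" using S S1 by force
      ultimately show "(proj u (S - S1) + sum \<phi> Q) w j = proj u (S - S1 \<union> f ` Q) w j"
        by (auto simp: proj_def)
    qed
    have "(proj u (S - S1) :: 'k seq \<Rightarrow> 'k seq) \<in> block_maps u" using S by (intro proj_block_maps) auto
    moreover have "\<phi> i \<in> block_dirs u" if "i < e" for i
    proof -
      have "f i \<in> S" using f S1 that by (auto simp: bij_betw_def)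
      then have "u \<le> f i" using S by auto
      then show ?thesis unfolding \<phi>_def by (intro cmap_block_dirs) (auto split: if_splits)
    qed
    ultimately have "fdiff (\<lambda>h. b \<bullet> h) (proj u (S - S1)) \<phi> e \<in> A"
      using deg b(1) by (simp add: degree_less_def)
    moreover have "b \<bullet> (proj u (S - S1) + sum \<phi> Q) \<in> A" if Q: "Q \<subset> {..<e}" for Q
    proof -
      let ?S' = "S - S1 \<union> f ` Q"
      have "f ` Q \<subset> S1"
        using Q f by (metis bij_betw_def inj_on_image_eq_iff psubsetE psubsetI subset_refl image_mono)
      then have "?S' \<subset> S" using S1 by blast
      then have "card ?S' < card S" "finite ?S'" "?S' \<subseteq> {u..}"
        using S by (auto intro: psubset_card_mono dest: finite_subset)
      then have "b \<bullet> proj u ?S' \<in> A" using min[of ?S'] by auto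
      then show ?thesis using sum[of Q] Q by auto
    qed
    ultimately have "b \<bullet> (proj u (S - S1) + sum \<phi> {..<e}) \<in> A"
      by (rule fdiff_top[OF submodule_subgroup[OF A], where F = "\<lambda>h. b \<bullet> h"])
    moreover have "S - S1 \<union> f ` {..<e} = S" using f S1 by (auto simp: bij_betw_def)
    ultimately show False using S sum[of "{..<e}"] by simp
  qed
  then show ?thesis using S that by blast
qed

lemma generated_submodule:
  fixes A :: "'k::{field,finite} form set"
  assumes A: "submodule u A" and r: "r \<in> forms"
  shows "submodule u (generated u A r)"
proof -
  let ?G = "generated u A r"
  have add: "x + y \<in> ?G" if "x \<in> ?G" "y \<in> ?G" for x y
    using that(2,1)
  proof (induction y arbitrary: x)
    case (base a)
    from base(2) show ?case
    proof (induction x)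
      case (base a')
      then show ?case using A \<open>a \<in> A\<close> by (intro generated.base submodule_add)
    next
      case (step x g)
      then have "x + a + r \<bullet> g \<in> ?G" by (intro generated.step)
      then show ?case by (simp only: add_ac)
    qed
  next
    case (step y g)
    then have "x + y + r \<bullet> g \<in> ?G" by (intro generated.step)
    then show ?case by (simp only: add_ac)
  qed
  have zero: "0 \<in> ?G" using submodule_zero[OF A] by (rule generated.base)
  have multiple: "(\<lambda>l. of_nat k * x l) \<in> ?G" if "x \<in> ?G" for k x
  proof (induction k)
    case 0
    then show ?case using zero by (simp add: zero_fun_def)
  next
    case (Suc k)
    from add[OF this that] show ?case by (simp add: plus_fun_def algebra_simps)
  qed
  \<comment> \<open>In characteristic \<open>p\<close> the negative of \<open>x\<close> is its
    multiple by \<open>p - 1\<close>, a repeated sum.\<close>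
  have uminus: "- x \<in> ?G" if "x \<in> ?G" for x
  proof -
    have "CHAR('k) > 0" by (rule finite_imp_CHAR_pos) simp
    then obtain k where "CHAR('k) = Suc k" using gr0_implies_Suc by blast
    then have "of_nat k = (- 1 :: 'k)"
      by (metis of_nat_CHAR of_nat_Suc eq_neg_iff_add_eq_0 add.commute)
    then show ?thesis using multiple[OF that, of k] by (simp add: fun_Compl_def)
  qed
  have diff: "x - y \<in> ?G" if "x \<in> ?G" "y \<in> ?G" for x y
    using add[OF that(1) uminus[OF that(2)]] by simp
  have "x \<in> forms" if "x \<in> ?G" for x
    using that
  proof induction
    case (base a)
    then show ?case using A by (rule submodule_forms[rotated])
  next
    case (step x g)
    then show ?case
      by (intro additive_subgroup_add[OF forms_subgroup] forms_act r block_maps_lin)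
  qed
  moreover have "x \<bullet> g \<in> ?G" if "x \<in> ?G" "g \<in> block_maps u" for x g
    using that(1)
  proof induction
    case (base a)
    then show ?case using that(2) by (intro generated.base submodule_act[OF A])
  next
    case (step x h)
    then have "x \<bullet> g + r \<bullet> (h \<circ> g) \<in> ?G"
      using that(2) by (intro generated.step block_maps_comp)
    then show ?case by (simp only: act_add act_act)
  qed
  ultimately show ?thesis
    using zero diff by (auto simp: submodule_def additive_subgroup_def)
qed

lemma generated_subset:
  assumes B: "submodule u B" and "A \<subseteq> B" "r \<in> B"
  shows "generated u A r \<subseteq> B"
proof
  fix x assume "x \<in> generated u A r"
  then show "x \<in> B"
  proof induction
    case (base a)
    then show ?case using assms(2) by blast
  next
    case (step x g)
    then show ?case using assms(3) by (intro submodule_add[OF B] submodule_act[OF B])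
  qed
qed

lemma generated_self: "submodule u A \<Longrightarrow> r \<in> generated u A r"
  using generated.step[OF generated.base[OF submodule_zero] block_maps_id, of u A r] by simp
subsection \<open>Blocked forms\<close>

definition closed_under :: "nat \<Rightarrow> 'k::{field,finite} form set \<Rightarrow> 'k form set \<Rightarrow> bool" where
  "closed_under u A X \<longleftrightarrow>
     X \<subseteq> forms \<and> (\<forall>T\<in>X. \<forall>g\<in>block_maps u. T \<bullet> g \<in> X) \<and> (\<forall>T\<in>X. \<forall>a\<in>A. T + a \<in> X)"

text \<open>Adding \<open>r\<close> on fresh coordinates from \<open>n\<close> on leads out of
  \<open>X\<close>, whatever member of \<open>X\<close> extends \<open>T0\<close> modulo
  \<open>A\<close>.\<close>

definition blocked_at ::
    "nat \<Rightarrow> 'k::{field,finite} form set \<Rightarrow> 'k form set \<Rightarrow> nat \<Rightarrow> 'k form \<Rightarrow> 'k form \<Rightarrow> bool" where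
  "blocked_at u A X n T0 r \<longleftrightarrow>
     (\<forall>T\<in>X. T \<bullet> trunc n - T0 \<bullet> trunc n \<in> A \<longrightarrow> T + r \<bullet> shift u n \<notin> X)"

text \<open>The strong version, against all members of \<open>B\<close> that do not see
  \<open>{u..<n}\<close> rather than copies of one \<open>r\<close>;
  \<open>blocked_if_blocked_at\<close> reduces it to finitely many \<open>r\<close>.\<close>

definition blocked ::
    "nat \<Rightarrow> 'k::{field,finite} form set \<Rightarrow> 'k form set \<Rightarrow> 'k form set \<Rightarrow> nat \<Rightarrow> 'k form \<Rightarrow> bool" where
  "blocked u A B X n T0 \<longleftrightarrow>
     (\<forall>T\<in>X. T \<bullet> trunc n - T0 \<bullet> trunc n \<in> A \<longrightarrow>
        (\<forall>b\<in>B. b \<bullet> skip u n = b \<longrightarrow> T + b \<in> X \<longrightarrow> b \<in> A))"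

lemma closed_under_forms: "closed_under u A X \<Longrightarrow> T \<in> X \<Longrightarrow> T \<in> forms"
  by (auto simp: closed_under_def)

lemma closed_under_act: "closed_under u A X \<Longrightarrow> T \<in> X \<Longrightarrow> g \<in> block_maps u \<Longrightarrow> T \<bullet> g \<in> X"
  by (simp add: closed_under_def)

lemma closed_under_cong:
  assumes "closed_under u A X" "T \<in> X" "T' - T \<in> A"
  shows "T' \<in> X"
proof -
  have "T + (T' - T) \<in> X" using assms by (simp only: closed_under_def)
  then show ?thesis by simp
qed

text \<open>A violation at \<open>n'\<close> is carried to one at \<open>n\<close> by
  \<open>\<theta>\<close>, which clears the coordinates in \<open>{n..<n'}\<close> and moves those
  from \<open>n'\<close> on down to \<open>n\<close>.\<close>

lemma blocked_at_extend:
  fixes A :: "'k::{field,finite} form set"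
  assumes A: "submodule u A" and X: "closed_under u A X" and n: "u \<le> n" "n \<le> n'"
    and ext: "T0' \<bullet> trunc n - T0 \<bullet> trunc n \<in> A" and bl: "blocked_at u A X n T0 r"
  shows "blocked_at u A X n' T0' r"
  unfolding blocked_at_def
proof (intro ballI impI notI)
  fix T assume T: "T \<in> X" "T \<bullet> trunc n' - T0' \<bullet> trunc n' \<in> A" "T + r \<bullet> shift u n' \<in> X"
  define \<theta> :: "'k seq \<Rightarrow> 'k seq" where
    "\<theta> = cmap (\<lambda>j. if j < n then Some j else if j < n' then None else Some (j - n' + n))"
  have \<theta>: "\<theta> \<in> block_maps u"
    unfolding \<theta>_def using n by (intro cmap_block_maps) (auto split: if_splits)
  have 1: "shift u n' \<circ> \<theta> = shift u n"
    using n by (auto simp: \<theta>_def shift_def cmap_def fun_eq_iff)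
  have 2: "\<theta> \<circ> trunc n = trunc n"
    using n by (auto simp: \<theta>_def trunc_def cmap_def fun_eq_iff)
  have "T \<bullet> \<theta> \<bullet> trunc n - T0 \<bullet> trunc n \<in> A"
  proof -
    have "(T \<bullet> trunc n' - T0' \<bullet> trunc n') \<bullet> trunc n \<in> A"
      using T(2) n by (intro submodule_act[OF A] trunc_block_maps)
    then have "T \<bullet> trunc n - T0' \<bullet> trunc n \<in> A"
      using n by (simp add: act_diff act_act trunc_comp_trunc min_absorb2)
    from submodule_add[OF A this ext] show ?thesis by (simp add: act_act 2)
  qed
  moreover have "T \<bullet> \<theta> \<in> X" using T(1) \<theta> by (rule closed_under_act[OF X])
  moreover have "T \<bullet> \<theta> + r \<bullet> shift u n \<in> X"
    using closed_under_act[OF X T(3) \<theta>] by (simp only: act_add act_act 1)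
  ultimately show False using bl unfolding blocked_at_def by blast
qed

text \<open>The coordinates in \<open>S\<close> are renumbered into a window of length
  \<open>m\<close>: \<open>\<alpha>\<close> and \<open>\<beta>\<close> factor the projection through
  the first \<open>u + m\<close> coordinates, and \<open>\<theta>\<close> is the same renumbering
  with the window placed at \<open>n\<close>.\<close>

lemma relabel_coordinates:
  assumes S: "finite S" "card S \<le> m" "S \<subseteq> {n..}" and n: "u \<le> n"
  obtains \<alpha> \<beta> \<theta> :: "'k::field seq \<Rightarrow> 'k seq"
  where "\<alpha> \<in> block_maps u" "\<beta> \<in> block_maps u" "\<theta> \<in> block_maps u"
    "\<alpha> \<circ> \<beta> = proj u S" "\<alpha> \<circ> trunc (u + m) = \<alpha>"
    "\<alpha> \<circ> shift u n = skip u n \<circ> \<theta>" "\<theta> \<circ> trunc n = trunc n"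
proof -
  obtain f where f: "bij_betw f {..<card S} S"
    using ex_bij_betw_nat_finite[OF S(1)] by (auto simp: atLeast0LessThan)
  define pos where "pos = the_inv_into {..<card S} f"
  have pos: "pos j < card S" "f (pos j) = j" if "j \<in> S" for j
    using f that f_the_inv_into_f[of f "{..<card S}" j]
      the_inv_into_into[of f "{..<card S}" j "{..<card S}"]
    by (auto simp: pos_def bij_betw_def)
  have fS: "n \<le> f i" if "i < card S" for i
    using f that S(3) by (auto simp: bij_betw_def)
  define \<alpha> \<beta> \<theta> :: "'k seq \<Rightarrow> 'k seq" where
    "\<alpha> = cmap (\<lambda>j. if j < u then Some j else if j \<in> S then Some (u + pos j) else None)" and
    "\<beta> = cmap (\<lambda>i. if i < u then Some i else if i < u + card S then Some (f (i - u)) else None)" and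
    "\<theta> = cmap (\<lambda>j. if j < n then Some j else if j \<in> S then Some (n + pos j) else None)"
  show ?thesis
  proof (rule that[of \<alpha> \<beta> \<theta>])
    show "\<alpha> \<in> block_maps u" "\<theta> \<in> block_maps u"
      unfolding \<alpha>_def \<theta>_def using n by (auto intro!: cmap_block_maps split: if_splits)
    show "\<beta> \<in> block_maps u"
      unfolding \<beta>_def using n fS
      by (intro cmap_block_maps) (auto split: if_splits intro: order_trans)
    show "\<alpha> \<circ> \<beta> = proj u S"
      using pos by (auto simp: \<alpha>_def \<beta>_def proj_def cmap_def fun_eq_iff)
    show "\<alpha> \<circ> trunc (u + m) = \<alpha>"
      using pos S(2) by (fastforce simp: \<alpha>_def trunc_def cmap_def fun_eq_iff)
    show "\<alpha> \<circ> shift u n = skip u n \<circ> \<theta>"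
      using n S(3)
      by (auto simp: \<alpha>_def \<theta>_def skip_def proj_def shift_def cmap_def fun_eq_iff add.commute)
    show "\<theta> \<circ> trunc n = trunc n"
      by (auto simp: \<theta>_def trunc_def cmap_def fun_eq_iff)
  qed
qed

text \<open>Fewer than \<open>m\<close> coordinates witness \<open>b \<notin> A\<close>, and
  renumbering moves them below \<open>u + m\<close>. So non-membership is detected at one fixed
  level, where there are finitely many forms.\<close>

lemma degree_less_detect_level:
  fixes A :: "'k::{field,finite} form set"
  assumes A: "submodule u A" and deg: "degree_less u m B A"
    and b: "b \<in> B" "b \<in> forms" "b \<notin> A"
  obtains g where "g \<in> block_maps u" "b \<bullet> g \<notin> A" "b \<bullet> g \<bullet> trunc (u + m) = b \<bullet> g"
proof -
  obtain S where S: "finite S" "S \<subseteq> {u..}" "card S < m" "b \<bullet> proj u S \<notin> A"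
    using degree_less_detect[OF A deg b] by blast
  obtain \<alpha> \<beta> \<theta> :: "'k seq \<Rightarrow> 'k seq"
    where \<alpha>: "\<alpha> \<in> block_maps u" and \<beta>: "\<beta> \<in> block_maps u"
    and eq: "\<alpha> \<circ> \<beta> = proj u S" "\<alpha> \<circ> trunc (u + m) = \<alpha>"
    using relabel_coordinates[OF S(1) less_imp_le[OF S(3)] S(2) order_refl] by metis
  have "b \<bullet> \<alpha> \<notin> A"
    using submodule_act[OF A _ \<beta>, of "b \<bullet> \<alpha>"] S(4) by (auto simp: act_act eq)
  with \<alpha> show ?thesis by (rule that) (simp add: act_act eq)
qed

text \<open>A violating \<open>b\<close> has a restriction \<open>b \<bullet> \<alpha>\<close>
  outside \<open>A\<close> on \<open>u + m\<close> coordinates, and \<open>\<theta>\<close> turns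
  the violation into one of \<open>blocked_at\<close> for that restriction.\<close>

lemma blocked_if_blocked_at:
  fixes A :: "'k::{field,finite} form set"
  assumes A: "submodule u A" and B: "submodule u B" and deg: "degree_less u m B A"
    and X: "closed_under u A X" and n: "u \<le> n"
    and bl: "\<And>r. r \<in> B - A \<Longrightarrow> r \<bullet> trunc (u + m) = r \<Longrightarrow> blocked_at u A X n T0 r"
  shows "blocked u A B X n T0"
  unfolding blocked_def
proof (intro ballI impI, rule ccontr)
  fix T b assume T: "T \<in> X" "T \<bullet> trunc n - T0 \<bullet> trunc n \<in> A"
    and b: "b \<in> B" "b \<bullet> skip u n = b" "T + b \<in> X" "b \<notin> A"
  obtain S0 where S0: "finite S0" "S0 \<subseteq> {u..}" "card S0 < m" "b \<bullet> proj u S0 \<notin> A"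
    using degree_less_detect[OF A deg b(1) submodule_forms[OF B b(1)] b(4)] by blast
  \<comment> \<open>Coordinates in \<open>{u..<n}\<close> are invisible to \<open>b\<close>, so only
    the part of \<open>S0\<close> from \<open>n\<close> on matters.\<close>
  define S where "S = S0 \<inter> {n..}"
  have S: "finite S" "card S \<le> m" "S \<subseteq> {n..}"
    using S0 card_mono[of S0 S] by (auto simp: S_def)
  have "skip u n \<circ> proj u S0 = skip u n \<circ> proj u S"
    by (auto simp: skip_def proj_def S_def fun_eq_iff)
  then have bS: "b \<bullet> proj u S \<notin> A"
    using S0(4) b(2) by (metis act_act)
  obtain \<alpha> \<beta> \<theta> :: "'k seq \<Rightarrow> 'k seq"
    where \<alpha>: "\<alpha> \<in> block_maps u" and \<beta>: "\<beta> \<in> block_maps u" and \<theta>: "\<theta> \<in> block_maps u"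
    and eq: "\<alpha> \<circ> \<beta> = proj u S" "\<alpha> \<circ> trunc (u + m) = \<alpha>"
      "\<alpha> \<circ> shift u n = skip u n \<circ> \<theta>" "\<theta> \<circ> trunc n = trunc n"
    using relabel_coordinates[OF S n] by metis
  have r: "b \<bullet> \<alpha> \<in> B - A"
    using bS submodule_act[OF A _ \<beta>, of "b \<bullet> \<alpha>"] submodule_act[OF B b(1) \<alpha>]
    by (auto simp: act_act eq)
  then have "blocked_at u A X n T0 (b \<bullet> \<alpha>)"
    using bl[OF r] by (simp add: act_act eq)
  moreover have "b \<bullet> \<alpha> \<bullet> shift u n = b \<bullet> \<theta>" using b(2) eq(3) by (metis act_act)
  then have "T \<bullet> \<theta> + b \<bullet> \<alpha> \<bullet> shift u n \<in> X"
    using closed_under_act[OF X b(3) \<theta>] by (simp only: act_add)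
  moreover have "T \<bullet> \<theta> \<in> X" using T(1) \<theta> by (rule closed_under_act[OF X])
  moreover have "T \<bullet> \<theta> \<bullet> trunc n - T0 \<bullet> trunc n \<in> A"
    using T(2) by (simp only: act_act eq)
  ultimately show False unfolding blocked_at_def by blast
qed

text \<open>
  If no extension of \<open>T0\<close> is blocked, one obtains \<open>T \<in> X\<close> on \<open>N\<close> further blocks of \<open>m\<close> coordinates such that
  for each \<open>k < N\<close> the restriction of \<open>T\<close> to the blocks up to \<open>k\<close> stays in \<open>X\<close> when a copy of \<open>r\<close> on block \<open>k\<close> is
  added. Substituting \<open>g\<close> into all blocks of a suitable set \<open>S\<close> does not change \<open>T\<close> on the first \<open>n\<close>
  coordinates, but turns the copy of \<open>r\<close> on block \<open>Max S\<close> into \<open>r \<bullet> g\<close>. It matters that \<open>n'\<close> is independent of \<open>X\<close>.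
\<close>

lemma exists_blocked_at:
  assumes n: "u \<le> n"
  shows "\<exists>n'\<ge>n. \<forall>X A r T0 g. submodule u (A :: 'k::{field,finite} form set) \<longrightarrow>
    closed_under u A X \<longrightarrow> r \<bullet> trunc (u + m) = r \<longrightarrow> T0 \<in> X \<longrightarrow> T0 \<bullet> trunc n = T0 \<longrightarrow>
    g \<in> block_maps u \<longrightarrow> T0 + r \<bullet> (g \<circ> trunc n) \<notin> X \<longrightarrow>
    (\<exists>T\<in>X. T \<bullet> trunc n' = T \<and> T \<bullet> trunc n - T0 \<in> A \<and> blocked_at u A X n' T r)"
proof -
  obtain N :: nat where N: "\<forall>T\<in>forms. \<forall>h0 \<phi>. h0 \<circ> trunc n = h0 \<longrightarrow> (\<forall>k<N. \<phi> k \<circ> trunc n = \<phi> k) \<longrightarrow>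
     (\<exists>S \<subseteq> {..<N}. S \<noteq> {} \<and> T \<bullet> (h0 + sum \<phi> S) = (T \<bullet> h0 :: 'k form))"
    using exists_subset_sum_same_value[of n] ..
  have main: "\<exists>T\<in>X. T \<bullet> trunc (n + N * m) = T \<and> T \<bullet> trunc n - T0 \<in> A \<and>
      blocked_at u A X (n + N * m) T r"
    if A: "submodule u A" and X: "closed_under u A X" and r: "r \<bullet> trunc (u + m) = r"
      and T0: "T0 \<in> X" "T0 \<bullet> trunc n = T0" and g: "g \<in> block_maps u"
      and bad: "T0 + r \<bullet> (g \<circ> trunc n) \<notin> X"
    for X A :: "'k form set" and r T0 g
  proof (rule ccontr)
    assume neg: "\<not> ?thesis"
    \<comment> \<open>Block \<open>i\<close> consists of the \<open>m\<close> coordinates from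
      \<open>n + i * m\<close> on. Since the condition for block \<open>i\<close> concerns only
      \<open>T\<close> truncated to the blocks up to \<open>i\<close>, it survives later extensions
      modulo \<open>A\<close>.\<close>
    have "\<exists>T\<in>X. T \<bullet> trunc (n + k * m) = T \<and> T \<bullet> trunc n - T0 \<in> A \<and>
      (\<forall>i<k. T \<bullet> trunc (n + Suc i * m) + r \<bullet> shift u (n + i * m) \<in> X)" if "k \<le> N" for k
      using that
    proof (induction k)
      case 0
      have "T0 \<bullet> trunc n - T0 \<in> A"
        using submodule_zero[OF A] by (simp only: T0(2) diff_self)
      moreover have "T0 \<bullet> trunc (n + 0 * m) = T0" using T0(2) by simp
      ultimately show ?case using T0(1) by blast
    next
      case (Suc k)
      obtain T where T: "T \<in> X" "T \<bullet> trunc (n + k * m) = T" "T \<bullet> trunc n - T0 \<in> A"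
        and T': "\<And>i. i < k \<Longrightarrow> T \<bullet> trunc (n + Suc i * m) + r \<bullet> shift u (n + i * m) \<in> X"
        using Suc.IH[OF Suc_leD[OF Suc.prems]] by blast
      have le: "n + k * m \<le> n + N * m" using Suc.prems by simp
      \<comment> \<open>A blocked form would remain blocked at \<open>n + N * m\<close>, which
        \<open>neg\<close> excludes.\<close>
      have "\<not> blocked_at u A X (n + k * m) T r"
      proof
        assume bl: "blocked_at u A X (n + k * m) T r"
        have "T \<bullet> trunc (n + k * m) - T \<bullet> trunc (n + k * m) \<in> A"
          by (simp only: diff_self submodule_zero[OF A])
        from blocked_at_extend[OF A X trans_le_add1[OF n] le this bl]
        have "blocked_at u A X (n + N * m) T r" .
        moreover have "T \<bullet> trunc (n + N * m) = T"
          using act_trunc_mono[OF T(2) le] .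
        ultimately show False using neg T(1,3) by blast
      qed
      then obtain U where U: "U \<in> X" "U \<bullet> trunc (n + k * m) - T \<in> A"
        "U + r \<bullet> shift u (n + k * m) \<in> X"
        unfolding blocked_at_def T(2) by blast
      let ?t = "trunc (n + Suc k * m) :: 'k seq \<Rightarrow> 'k seq"
      have t: "?t \<in> block_maps u" using n by (intro trunc_block_maps) simp
      have Ut: "U \<bullet> ?t \<bullet> trunc i - T \<bullet> trunc i \<in> A" if "u \<le> i" "i \<le> n + k * m" for i
      proof -
        have "(U \<bullet> trunc (n + k * m) - T) \<bullet> trunc i \<in> A"
          using U(2) that(1) by (intro submodule_act[OF A] trunc_block_maps)
        then show ?thesis
          using that(2) by (simp add: act_diff act_act trunc_comp_trunc min_absorb2 trans_le_add1 trans_le_add2)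
      qed
      show ?case
      proof (intro bexI[of _ "U \<bullet> ?t"] conjI allI impI)
        show "U \<bullet> ?t \<in> X" using U(1) t by (rule closed_under_act[OF X])
        show "U \<bullet> ?t \<bullet> ?t = U \<bullet> ?t" by (simp add: act_act trunc_comp_trunc)
        have "U \<bullet> ?t \<bullet> trunc n - T \<bullet> trunc n \<in> A" using n by (intro Ut) simp_all
        from submodule_add[OF A this T(3)] show "U \<bullet> ?t \<bullet> trunc n - T0 \<in> A" by simp
        fix i assume i: "i < Suc k"
        show "U \<bullet> ?t \<bullet> trunc (n + Suc i * m) + r \<bullet> shift u (n + i * m) \<in> X"
        proof (cases "i = k")
          case True
          have "shift u (n + k * m) \<circ> ?t = trunc (u + m) \<circ> shift u (n + k * m)"
            using shift_trunc[of u "n + k * m" m] n by (simp add: add_ac)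
          then have "r \<bullet> shift u (n + k * m) \<bullet> ?t = r \<bullet> shift u (n + k * m)"
            using r by (metis act_act)
          then have "U \<bullet> ?t + r \<bullet> shift u (n + k * m) \<in> X"
            using closed_under_act[OF X U(3) t] by (simp only: act_add)
          then show ?thesis using True by (simp add: act_act trunc_comp_trunc)
        next
          case False
          then have "i < k" using i by simp
          then have le: "Suc i * m \<le> k * m" by (intro mult_right_mono) simp_all
          show ?thesis
          proof (rule closed_under_cong[OF X T'[OF \<open>i < k\<close>]])
            have "U \<bullet> ?t \<bullet> trunc (n + Suc i * m) - T \<bullet> trunc (n + Suc i * m) \<in> A"
              using n le by (intro Ut) simp_all
            then show "U \<bullet> ?t \<bullet> trunc (n + Suc i * m) + r \<bullet> shift u (n + i * m) -
              (T \<bullet> trunc (n + Suc i * m) + r \<bullet> shift u (n + i * m)) \<in> A"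
              by (simp only: add_diff_cancel_right)
          qed
        qed
      qed
    qed
    from this[OF order_refl] obtain T where T: "T \<in> X" "T \<bullet> trunc (n + N * m) = T" "T \<bullet> trunc n - T0 \<in> A"
      and T': "\<And>i. i < N \<Longrightarrow> T \<bullet> trunc (n + Suc i * m) + r \<bullet> shift u (n + i * m) \<in> X"
      by blast
    define \<psi> where "\<psi> = g \<circ> trunc n"
    have \<psi>: "\<psi> \<in> block_maps u"
      unfolding \<psi>_def using g n by (intro block_maps_comp trunc_block_maps)
    \<comment> \<open>\<open>q k\<close> copies the window \<open>{u..<u + m}\<close> onto block
      \<open>k\<close>, so that \<open>\<phi> k\<close> substitutes \<open>\<psi>\<close>
      there.\<close>
    define q :: "nat \<Rightarrow> 'k seq \<Rightarrow> 'k seq" where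
      "q k = cmap (\<lambda>j. if n + k * m \<le> j \<and> j < n + Suc k * m then Some (u + (j - (n + k * m))) else None)"
      for k
    have q: "q k \<in> block_dirs u" for k
      unfolding q_def using n by (intro cmap_block_dirs) (auto split: if_splits)
    define \<phi> where "\<phi> k = q k \<circ> \<psi>" for k
    have \<phi>: "\<phi> k \<in> block_dirs u" for k
      using q[of k] \<psi> unfolding \<phi>_def by (auto simp: block_dirs_def block_maps_def lin_comp)
    have \<phi>n: "\<phi> k \<circ> trunc n = \<phi> k" for k
      by (simp add: \<phi>_def \<psi>_def comp_assoc trunc_comp_trunc)
    have \<phi>j: "\<phi> k w j = (if n + k * m \<le> j \<and> j < n + Suc k * m then \<psi> w (u + (j - (n + k * m))) else 0)"
      for k w j
      by (simp add: \<phi>_def q_def cmap_def)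
    have "\<exists>S \<subseteq> {..<N}. S \<noteq> {} \<and> T \<bullet> (trunc n + sum \<phi> S) = T \<bullet> trunc n"
      by (rule N[rule_format, OF closed_under_forms[OF X T(1)]])
         (simp_all add: trunc_comp_trunc \<phi>n)
    then obtain S where S: "S \<subseteq> {..<N}" "S \<noteq> {}" "T \<bullet> (trunc n + sum \<phi> S) = T \<bullet> trunc n"
      by blast
    define \<Pi> where "\<Pi> = trunc n + sum \<phi> S"
    have \<Pi>: "\<Pi> \<in> block_maps u"
      unfolding \<Pi>_def using n \<phi> by (intro block_maps_add_dirs trunc_block_maps block_dirs_sum)
    define k where "k = Max S"
    have fin: "finite S" using S(1) finite_subset by blast
    then have k: "k \<in> S" "\<And>i. i \<in> S \<Longrightarrow> i \<le> k"
      using S(2) by (simp_all add: k_def)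
    have \<Pi>_block: "\<Pi> w (n + k * m + i) = \<psi> w (u + i)" if "i < m" for w i
    proof -
      have "\<phi> i' w (n + k * m + i) = 0" if "i' \<in> S - {k}" for i'
      proof -
        have "i' < k" using k(2)[of i'] that by auto
        then have "Suc i' * m \<le> k * m" by (intro mult_right_mono) simp_all
        then show ?thesis by (simp add: \<phi>j)
      qed
      moreover have "(\<Sum>i'\<in>S. \<phi> i' w (n + k * m + i)) =
          \<phi> k w (n + k * m + i) + (\<Sum>i'\<in>S - {k}. \<phi> i' w (n + k * m + i))"
        using fin k(1) by (rule sum.remove)
      ultimately show ?thesis
        using that by (simp add: \<Pi>_def sum_fun_apply \<phi>j trunc_def)
    qed
    have \<Pi>_zero: "\<Pi> w j = 0" if j: "n + Suc k * m \<le> j" for w j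
    proof -
      have "\<phi> i w j = 0" if "i \<in> S" for i
      proof -
        have "Suc i * m \<le> Suc k * m" using k(2)[OF that] by (intro mult_le_mono1) simp
        then have "\<not> j < n + Suc i * m" using j by linarith
        then show ?thesis by (simp only: \<phi>j if_False simp_thms)
      qed
      then show ?thesis using j by (simp add: \<Pi>_def sum_fun_apply trunc_def)
    qed
    \<comment> \<open>No block after \<open>k\<close> belongs to \<open>S\<close>, so precomposition
      with \<open>\<Pi>\<close> absorbs the truncation of \<open>T\<close>, and
      \<open>T \<bullet> \<Pi> = T \<bullet> trunc n\<close> by the choice of
      \<open>S\<close>.\<close>
    have "trunc (n + Suc k * m) \<circ> \<Pi> = \<Pi>"
      using \<Pi>_zero by (auto simp: trunc_def fun_eq_iff)
    moreover have "r \<bullet> (shift u (n + k * m) \<circ> \<Pi>) = r \<bullet> \<psi>"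
    proof -
      have low: "\<Pi> w j = \<psi> w j" if "j < u" for w j
      proof -
        have "trunc u (\<Pi> w) j = trunc u (\<psi> w) j" using \<Pi> \<psi> by (simp add: block_maps_def)
        then show ?thesis using that by (simp add: trunc_def)
      qed
      have "trunc (u + m) \<circ> (shift u (n + k * m) \<circ> \<Pi>) = trunc (u + m) \<circ> \<psi>"
      proof (intro ext)
        fix w j
        show "(trunc (u + m) \<circ> (shift u (n + k * m) \<circ> \<Pi>)) w j = (trunc (u + m) \<circ> \<psi>) w j"
        proof (cases "j < u")
          case True
          then show ?thesis by (simp add: trunc_def shift_def low)
        next
          case False
          then obtain i where "j = u + i" using le_Suc_ex not_less by blast
          then show ?thesis
            using \<Pi>_block[of i w] by (simp add: trunc_def shift_def add.commute)
        qed
      qed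
      then show ?thesis using r by (metis act_act)
    qed
    moreover have "(T \<bullet> trunc (n + Suc k * m) + r \<bullet> shift u (n + k * m)) \<bullet> \<Pi> \<in> X"
      using k(1) S(1) by (intro closed_under_act[OF X T' \<Pi>]) auto
    ultimately have *: "T \<bullet> trunc n + r \<bullet> \<psi> \<in> X"
      using S(3) by (simp only: act_add act_act \<Pi>_def)
    have "T0 + r \<bullet> \<psi> - (T \<bullet> trunc n + r \<bullet> \<psi>) \<in> A"
      using submodule_uminus[OF A T(3)] by (simp only: add_diff_cancel_right minus_diff_eq)
    from closed_under_cong[OF X * this] show False using bad by (simp only: \<psi>_def)
  qed
  show ?thesis
    by (rule exI[of _ "n + N * m"], rule conjI, simp, intro allI impI, rule main)
qed

section \<open>The part of a submodule that does not see a block of coordinates\<close>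

definition skipped ::
    "nat \<Rightarrow> nat \<Rightarrow> 'k::{field,finite} form set \<Rightarrow> 'k form set \<Rightarrow> 'k form set" where
  "skipped u n A B = {b + a | b a. b \<in> B \<and> b \<bullet> skip u n = b \<and> a \<in> A}"

lemma skippedI: "b \<in> B \<Longrightarrow> b \<bullet> skip u n = b \<Longrightarrow> a \<in> A \<Longrightarrow> b + a \<in> skipped u n A B"
  unfolding skipped_def by blast

lemma skippedE:
  assumes "x \<in> skipped u n A B"
  obtains b a where "x = b + a" "b \<in> B" "b \<bullet> skip u n = b" "a \<in> A"
  using assms unfolding skipped_def by blast

lemma skipped_superset: "submodule u B \<Longrightarrow> A \<subseteq> skipped u n A B"
  using skippedI[of 0 B u n _ A] by (auto simp: submodule_zero)

lemma skipped_subset: "submodule u B \<Longrightarrow> A \<subseteq> B \<Longrightarrow> skipped u n A B \<subseteq> B"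
  by (blast elim: skippedE intro: submodule_add)

lemma skipped_submodule:
  fixes A :: "'k::{field,finite} form set"
  assumes A: "submodule u A" and B: "submodule u B" and n: "u \<le> n" and AB: "A \<subseteq> B"
  shows "submodule n (skipped u n A B)"
  unfolding submodule_def additive_subgroup_def
proof (intro conjI ballI)
  show "0 \<in> skipped u n A B"
    using skipped_superset[OF B] submodule_zero[OF A] by blast
  show "skipped u n A B \<subseteq> forms"
    using skipped_subset[OF B AB] B by (auto simp: submodule_def)
next
  fix x y assume "x \<in> skipped u n A B" "y \<in> skipped u n A B"
  then obtain b a b' a' where x: "x = b + a" "b \<in> B" "b \<bullet> skip u n = b" "a \<in> A"
    and y: "y = b' + a'" "b' \<in> B" "b' \<bullet> skip u n = b'" "a' \<in> A"
    by (elim skippedE)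
  have "(b - b') + (a - a') \<in> skipped u n A B"
    using x y by (intro skippedI submodule_diff[OF A] submodule_diff[OF B]) (simp_all only: act_diff)
  then show "x - y \<in> skipped u n A B" unfolding x(1) y(1) by (simp only: add_diff_add)
next
  fix x and g :: "'k seq \<Rightarrow> 'k seq" assume "x \<in> skipped u n A B" and g: "g \<in> block_maps n"
  then obtain b a where x: "x = b + a" "b \<in> B" "b \<bullet> skip u n = b" "a \<in> A"
    by (elim skippedE)
  have gu: "g \<in> block_maps u" using g block_maps_antimono[OF n] by blast
  have "b \<bullet> g \<bullet> skip u n = b \<bullet> skip u n \<bullet> g"
    by (simp only: act_act skip_commute[OF n g])
  then have "b \<bullet> g + a \<bullet> g \<in> skipped u n A B"
    using x by (intro skippedI submodule_act[OF A _ gu] submodule_act[OF B _ gu]) simp_all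
  then show "x \<bullet> g \<in> skipped u n A B" unfolding x(1) by (simp only: act_add)
qed

text \<open>Use the bound for \<open>Suc e\<close> with \<open>middle u n\<close> as outermost
  direction: the differences at \<open>h\<close> and at \<open>skip u n \<circ> h\<close> agree
  modulo \<open>A\<close>, and the latter involves only maps invariant under
  \<open>skip u n\<close>.\<close>

lemma skipped_degree_less:
  fixes A :: "'k::{field,finite} form set"
  assumes A: "submodule u A" and B: "submodule u B" and n: "u \<le> n" and AB: "A \<subseteq> B"
    and deg: "degree_less u (Suc e) B A"
  shows "degree_less n e B (skipped u n A B)"
  unfolding degree_less_def
proof (intro ballI allI impI)
  fix T and h :: "'k seq \<Rightarrow> 'k seq" and \<phi> :: "nat \<Rightarrow> 'k seq \<Rightarrow> 'k seq"
  assume T: "T \<in> B" and h: "h \<in> block_maps n" and \<phi>: "\<forall>i<e. \<phi> i \<in> block_dirs n"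
  let ?F = "\<lambda>h. T \<bullet> h" and ?k = "skip u n \<circ> h" and ?\<psi> = "\<phi>(e := middle u n)"
  let ?C = "{b \<in> B. b \<bullet> skip u n = b}"
  have hu: "h \<in> block_maps u" using h block_maps_antimono[OF n] by blast
  have k: "?k \<in> block_maps u" using hu n by (intro block_maps_comp skip_block_maps)
  have \<phi>u: "\<phi> i \<in> block_dirs u" if "i < e" for i
    using \<phi> that block_dirs_antimono[OF n] by blast
  have "fdiff ?F ?k ?\<psi> (Suc e) \<in> A"
    using deg T k \<phi>u middle_block_dirs[of u n] unfolding degree_less_def
    by (metis (no_types, lifting) fun_upd_apply less_antisym)
  moreover have "fdiff ?F h' ?\<psi> e = fdiff ?F h' \<phi> e" for h'
    by (rule fdiff_cong) simp
  then have "fdiff ?F ?k ?\<psi> (Suc e) = fdiff ?F h \<phi> e - fdiff ?F ?k \<phi> e"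
    by (simp only: fdiff.simps fun_upd_same skip_comp_add_middle[OF n h])
  ultimately have 1: "fdiff ?F h \<phi> e - fdiff ?F ?k \<phi> e \<in> A" by (simp only:)
  have 2: "fdiff ?F ?k \<phi> e \<in> ?C"
  proof (rule fdiff_mem)
    show "additive_subgroup ?C"
      unfolding additive_subgroup_def
    proof (intro conjI ballI CollectI)
      fix x y assume "x \<in> ?C" "y \<in> ?C"
      then show "x - y \<in> B" "(x - y) \<bullet> skip u n = x - y"
        using submodule_diff[OF B] by (auto simp only: act_diff)
    qed (simp_all only: submodule_zero[OF B] act_zero)
    fix Q assume Q: "Q \<subseteq> {..<e}"
    let ?h = "?k + sum \<phi> Q"
    have "?h \<in> block_maps u"
      using k \<phi>u Q by (intro block_maps_add_dirs block_dirs_sum) auto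
    then have "T \<bullet> ?h \<in> B" using T by (intro submodule_act[OF B])
    moreover have "?h \<circ> skip u n = ?h"
    proof
      fix w
      have "\<phi> i (skip u n w) = \<phi> i w" if "i \<in> Q" for i
        using block_dirs_skip[OF n, of "\<phi> i"] \<phi> Q that by (metis comp_apply lessThan_iff subsetD)
      moreover have "?k (skip u n w) = ?k w"
        using skip_commute[OF n h] skip_idem[of u n] by (metis comp_apply)
      ultimately show "(?h \<circ> skip u n) w = ?h w"
        by (simp add: sum_fun_apply)
    qed
    ultimately show "T \<bullet> ?h \<in> ?C" by (simp add: act_act)
  qed
  have "fdiff ?F ?k \<phi> e + (fdiff ?F h \<phi> e - fdiff ?F ?k \<phi> e) \<in> skipped u n A B"
    using 2 by (intro skippedI 1) simp_all
  then show "fdiff ?F h \<phi> e \<in> skipped u n A B" by (simp only: add_diff_eq add_diff_cancel_left')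
qed

text \<open>As \<open>r1\<close> does not see \<open>{u..<n}\<close>, the form
  \<open>r1 \<bullet> g \<bullet> skip u n\<close> equals \<open>r1 \<bullet> H\<close>, where
  \<open>H\<close> also fixes the coordinates up to \<open>n\<close>. Thus whatever
  \<open>r1\<close> generates with \<open>block_maps u\<close> is, after \<open>skip u n\<close>,
  generated by \<open>r\<close> with \<open>block_maps n\<close>.\<close>

lemma skipped_irreducible:
  fixes A :: "'k::{field,finite} form set"
  assumes A: "submodule u A" and B: "submodule u B" and n: "u \<le> n" and AB: "A \<subseteq> B"
    and irr: "irreducible_over u A B"
  shows "irreducible_over n A (skipped u n A B)"
  unfolding irreducible_over_def
proof (intro ballI subsetI)
  fix r x assume r: "r \<in> skipped u n A B - A" and x: "x \<in> skipped u n A B"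
  obtain r1 a1 where r1: "r = r1 + a1" "r1 \<in> B" "r1 \<bullet> skip u n = r1" "a1 \<in> A"
    using r by (blast elim: skippedE)
  have "r1 \<in> B - A" using r r1 submodule_add[OF A] by blast
  then have gen: "B \<subseteq> generated u A r1" using irr by (simp only: irreducible_over_def)
  have An: "submodule n A" using A n by (rule submodule_mono)
  have rf: "r \<in> forms" using skipped_submodule[OF A B n AB] r by (auto intro: submodule_forms)
  have G: "submodule n (generated n A r)" by (rule generated_submodule[OF An rf])
  have sk: "y \<bullet> skip u n \<in> generated n A r" if "y \<in> generated u A r1" for y
    using that
  proof induction
    case (base a)
    then show ?case using n by (intro generated.base submodule_act[OF A] skip_block_maps)
  next
    case (step y g)
    let ?s = "skip u n :: 'k seq \<Rightarrow> 'k seq"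
    define H where "H = (?s \<circ> g \<circ> ?s) + middle u n"
    have s: "?s \<in> block_maps u" using n by (rule skip_block_maps)
    have gs: "?s \<circ> g \<circ> ?s \<in> block_maps u" using step(2) s by (intro block_maps_comp)
    have tt: "trunc u (trunc n w) = trunc u w" "trunc n (trunc u w) = trunc u w" for w :: "'k seq"
      using n by (simp_all add: min_absorb1 min_absorb2)
    have ts: "trunc n (?s w) = trunc u w" "?s (trunc n w) = trunc u w" "?s (trunc u w) = trunc u w" for w
      using n by (auto simp: skip_def proj_def trunc_def fun_eq_iff)
    have g: "trunc u (g w) = trunc u w" "g (trunc u w) = trunc u w" for w
      using step(2) by (simp_all add: block_maps_def)
    have H: "H \<in> block_maps n"
    proof -
      have "lin H" unfolding H_def
        using block_maps_lin[OF gs] by (rule lin_plus) (simp add: middle_def lin_cmap)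
      moreover have "trunc n (H w) = trunc n w" for w
      proof -
        have "trunc u (?s w) = trunc u w" using s by (simp add: block_maps_def)
        then show ?thesis
          using n by (simp add: H_def trunc_add ts g middle_eq lin_diff[OF lin_trunc] min_absorb1 min_absorb2)
      qed
      moreover have "H (trunc n w) = trunc n w" for w
        using n by (simp add: H_def ts g middle_eq min_absorb1 min_absorb2)
      ultimately show ?thesis by (simp add: block_maps_def)
    qed
    have "?s \<circ> H = ?s \<circ> (g \<circ> ?s)"
    proof
      fix w
      have "?s (middle u n w) = 0"
        by (auto simp: skip_def proj_def middle_def cmap_def fun_eq_iff)
      moreover have "?s (?s w') = ?s w'" for w' using skip_idem by (metis comp_apply)
      ultimately show "(?s \<circ> H) w = (?s \<circ> (g \<circ> ?s)) w"
        using s by (simp add: H_def lin_add[OF block_maps_lin])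
    qed
    then have eq: "r1 \<bullet> H = r1 \<bullet> g \<bullet> ?s"
      using r1(3) by (metis act_act)
    have "y \<bullet> ?s + r \<bullet> H \<in> generated n A r" using step(3) H by (rule generated.step)
    moreover have "a1 \<bullet> H \<in> generated n A r"
      using r1(4) H by (intro generated.base submodule_act[OF An])
    ultimately have "y \<bullet> ?s + r \<bullet> H - a1 \<bullet> H \<in> generated n A r"
      by (rule submodule_diff[OF G])
    moreover have "y \<bullet> ?s + r \<bullet> H - a1 \<bullet> H = (y + r1 \<bullet> g) \<bullet> ?s"
      unfolding r1(1) act_add eq by (simp only: add_diff_cancel_right' flip: add.assoc)
    ultimately show ?case by (simp only:)
  qed
  obtain b a where "x = b + a" "b \<in> B" "b \<bullet> skip u n = b" "a \<in> A"
    using x by (blast elim: skippedE)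
  moreover from this have "b \<in> generated n A r" using sk[of b] gen by auto
  ultimately show "x \<in> generated n A r"
    using submodule_add[OF G] generated.base by blast
qed

text \<open>\<open>x\<close> arises from an element of \<open>A\<close>, whose addition stays in
  \<open>X\<close>, by adding translates of \<open>r\<close> one at a time; as the walk ends outside
  \<open>X\<close>, some step leaves \<open>X\<close>.\<close>

lemma generated_walk:
  assumes A: "submodule u A" and X: "closed_under u A X" and \<kappa>: "\<kappa> \<in> block_maps u"
    and T0: "T0 \<in> X" and x: "x \<in> generated u A r" and bad: "T0 + x \<bullet> \<kappa> \<notin> X"
  shows "\<exists>y\<in>generated u A r. \<exists>g\<in>block_maps u.
    T0 + y \<bullet> \<kappa> \<in> X \<and> T0 + y \<bullet> \<kappa> + r \<bullet> (g \<circ> \<kappa>) \<notin> X"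
  using x bad
proof induction
  case (base a)
  then have "a \<bullet> \<kappa> \<in> A" using \<kappa> by (intro submodule_act[OF A])
  then have "T0 + a \<bullet> \<kappa> \<in> X" using X T0 by (simp only: closed_under_def)
  then show ?case using base(2) by contradiction
next
  case (step y g)
  show ?case
  proof (cases "T0 + y \<bullet> \<kappa> \<in> X")
    case True
    moreover have "T0 + y \<bullet> \<kappa> + r \<bullet> (g \<circ> \<kappa>) \<notin> X"
      using step.prems by (simp only: act_add act_act add.assoc simp_thms)
    ultimately show ?thesis using step(1,2) by blast
  qed (rule step.IH)
qed

text \<open>
  An element that is blocked for some \<open>r\<close> shows that \<open>X\<close> is not closed under adding elements of \<open>B\<close>, even
  above that element. By irreducibility this instability can be realised by any other \<open>r\<close>, which
  allows the next application of \<open>exists_blocked_at\<close>.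
\<close>

lemma exists_blocked_at_finite:
  fixes A :: "'k::{field,finite} form set"
  assumes A: "submodule u A" and B: "submodule u B" and AB: "A \<subseteq> B"
    and irr: "irreducible_over u A B" and const: "\<And>b. b \<in> B \<Longrightarrow> b \<bullet> trunc u \<in> A"
    and n: "u \<le> n"
    and F: "finite F" "F \<subseteq> {r \<in> B - A. r \<bullet> trunc (u + m) = r}"
  shows "\<exists>n0 n1. u \<le> n0 \<and> n0 \<le> n1 \<and> (\<forall>X T0 b. closed_under u A X \<longrightarrow> T0 \<in> X \<longrightarrow>
      T0 \<bullet> trunc n = T0 \<longrightarrow> b \<in> B \<longrightarrow> b \<bullet> trunc n = b \<longrightarrow> T0 + b \<notin> X \<longrightarrow>
    (\<exists>T\<in>X. \<exists>b\<in>B. T \<bullet> trunc n1 = T \<and> b \<bullet> (skip u n0 \<circ> trunc n1) = b \<and> T + b \<notin> X \<and>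
        (\<forall>r\<in>F. blocked_at u A X n0 T r)))"
  using F
proof (induction F rule: finite_induct)
  case empty
  \<comment> \<open>With no \<open>r\<close> to treat, \<open>n0 = u\<close> and
    \<open>n1 = n\<close> work for the given \<open>T0\<close> and \<open>b\<close>, since
    \<open>skip u u\<close> is the identity.\<close>
  show ?case
    by (rule exI[of _ u], rule exI[of _ n]) (use n in \<open>auto simp: skip_self\<close>)
next
  case (insert r F)
  then obtain n0 n1 where n01: "u \<le> n0" "n0 \<le> n1" and IH:
    "\<And>X T0 b. closed_under u A X \<Longrightarrow> T0 \<in> X \<Longrightarrow> T0 \<bullet> trunc n = T0 \<Longrightarrow> b \<in> B \<Longrightarrow>
      b \<bullet> trunc n = b \<Longrightarrow> T0 + b \<notin> X \<Longrightarrow>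
    (\<exists>T\<in>X. \<exists>b\<in>B. T \<bullet> trunc n1 = T \<and> b \<bullet> (skip u n0 \<circ> trunc n1) = b \<and> T + b \<notin> X \<and>
        (\<forall>r\<in>F. blocked_at u A X n0 T r))"
    by blast
  have n1: "u \<le> n1" using n01 by simp
  obtain n' where n': "n1 \<le> n'" and ex: "\<forall>X A r T0 g. submodule u (A :: 'k form set) \<longrightarrow>
    closed_under u A X \<longrightarrow> r \<bullet> trunc (u + m) = r \<longrightarrow> T0 \<in> X \<longrightarrow> T0 \<bullet> trunc n1 = T0 \<longrightarrow>
    g \<in> block_maps u \<longrightarrow> T0 + r \<bullet> (g \<circ> trunc n1) \<notin> X \<longrightarrow>
    (\<exists>T\<in>X. T \<bullet> trunc n' = T \<and> T \<bullet> trunc n1 - T0 \<in> A \<and> blocked_at u A X n' T r)"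
    using exists_blocked_at[OF n1, where m = m] by (elim exE conjE)
  have r: "r \<in> B" "r \<notin> A" "r \<bullet> trunc (u + m) = r" using insert.prems by auto
  have gB: "generated u A r \<subseteq> B" using generated_subset[OF B AB r(1)] .
  have un': "u \<le> n'" using n1 n' by simp
  show ?case
  proof (rule exI[of _ n'], rule exI[of _ "n' + m"], intro conjI allI impI)
    show "u \<le> n'" "n' \<le> n' + m" using un' by simp_all
    fix X T0' b'
    assume X: "closed_under u A X" and "T0' \<in> X" "T0' \<bullet> trunc n = T0'" "b' \<in> B"
      "b' \<bullet> trunc n = b'" "T0' + b' \<notin> X"
    from IH[OF this] obtain T0 b where T0: "T0 \<in> X" "T0 \<bullet> trunc n1 = T0"
      and b: "b \<in> B" "b \<bullet> (skip u n0 \<circ> trunc n1) = b" "T0 + b \<notin> X"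
      and bl: "\<forall>r\<in>F. blocked_at u A X n0 T0 r"
      by blast
    \<comment> \<open>Walking along \<open>\<kappa>\<close> changes \<open>T0\<close> only by forms
      that do not see \<open>{u..<n0}\<close>; this protects what is already blocked at
      \<open>n0\<close>.\<close>
    define \<kappa> :: "'k seq \<Rightarrow> 'k seq" where "\<kappa> = skip u n0 \<circ> trunc n1"
    have \<kappa>: "\<kappa> \<in> block_maps u"
      unfolding \<kappa>_def using n01 n1 by (intro block_maps_comp skip_block_maps trunc_block_maps)
    have "b \<in> generated u A r" using irr r b(1) unfolding irreducible_over_def by blast
    moreover have "T0 + b \<bullet> \<kappa> \<notin> X" using b(2,3) by (simp only: \<kappa>_def simp_thms)
    ultimately obtain y g where y: "y \<in> generated u A r" and g: "g \<in> block_maps u"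
      and T1: "T0 + y \<bullet> \<kappa> \<in> X" and bad: "T0 + y \<bullet> \<kappa> + r \<bullet> (g \<circ> \<kappa>) \<notin> X"
      using generated_walk[OF A X \<kappa> T0(1)] by blast
    define T1 where "T1 = T0 + y \<bullet> \<kappa>"
    have "\<kappa> \<circ> trunc n1 = \<kappa>" by (simp add: \<kappa>_def comp_assoc trunc_comp_trunc)
    then have T1n: "T1 \<bullet> trunc n1 = T1"
      unfolding T1_def using T0(2) by (simp only: act_add act_act)
    have gs: "g \<circ> skip u n0 \<in> block_maps u" using g n01 by (intro block_maps_comp skip_block_maps)
    have "T1 + r \<bullet> (g \<circ> skip u n0 \<circ> trunc n1) \<notin> X"
      using bad by (simp only: T1_def \<kappa>_def comp_assoc simp_thms)
    with ex A X r(3) T1[folded T1_def] T1n gs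
    obtain T2 where T2: "T2 \<in> X" "T2 \<bullet> trunc n' = T2" "T2 \<bullet> trunc n1 - T1 \<in> A"
      and blr: "blocked_at u A X n' T2 r"
      by blast
    \<comment> \<open>On the first \<open>n0\<close> coordinates the walk contributes just
      \<open>y \<bullet> trunc u\<close>, which lies in \<open>A\<close> by
      \<open>const\<close>.\<close>
    have "T2 \<bullet> trunc n0 - T0 \<bullet> trunc n0 \<in> A"
    proof -
      have "(T2 \<bullet> trunc n1 - T1) \<bullet> trunc n0 \<in> A"
        using T2(3) n01 by (intro submodule_act[OF A] trunc_block_maps)
      moreover have "y \<bullet> trunc u \<in> A" using y gB const by blast
      ultimately have "(T2 \<bullet> trunc n1 - T1) \<bullet> trunc n0 + y \<bullet> trunc u \<in> A"
        by (rule submodule_add[OF A])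
      moreover have "\<kappa> \<circ> trunc n0 = trunc u"
        using n01 by (simp add: \<kappa>_def comp_assoc trunc_comp_trunc min_absorb2 skip_trunc)
      then have "(T2 \<bullet> trunc n1 - T1) \<bullet> trunc n0 + y \<bullet> trunc u = T2 \<bullet> trunc n0 - T0 \<bullet> trunc n0"
        using n01 by (simp add: T1_def act_diff act_add act_act trunc_comp_trunc min_absorb2)
      ultimately show ?thesis by (simp only:)
    qed
    then have "\<forall>r\<in>F. blocked_at u A X n' T2 r"
      using bl n' n01 blocked_at_extend[OF A X n01(1)] order_trans[OF n01(2) n'] by blast
    then have blF: "\<forall>r\<in>insert r F. blocked_at u A X n' T2 r" using blr by blast
    \<comment> \<open>\<open>T2\<close> extends itself, so being blocked for \<open>r\<close> makes
      this copy of \<open>r\<close> the instability witness needed for the next induction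
      step.\<close>
    define b2 where "b2 = r \<bullet> shift u n'"
    have "T2 + b2 \<notin> X"
      unfolding b2_def using blr T2(1) submodule_zero[OF A]
      unfolding blocked_at_def by (metis diff_self)
    moreover have "b2 \<in> B"
      unfolding b2_def using r(1) un' by (intro submodule_act[OF B] shift_block_maps)
    moreover have "shift u n' \<circ> (skip u n' \<circ> trunc (n' + m)) = trunc (u + m) \<circ> shift u n'"
      using shift_trunc[OF un', of m] shift_skip[of u n'] by (metis comp_assoc)
    then have "b2 \<bullet> (skip u n' \<circ> trunc (n' + m)) = b2"
      unfolding b2_def using r(3) by (metis act_act)
    moreover have "T2 \<bullet> trunc (n' + m) = T2" using T2(2) by (rule act_trunc_mono) simp
    ultimately show "\<exists>T\<in>X. \<exists>b\<in>B. T \<bullet> trunc (n' + m) = T \<and>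
        b \<bullet> (skip u n' \<circ> trunc (n' + m)) = b \<and> T + b \<notin> X \<and>
        (\<forall>r\<in>insert r F. blocked_at u A X n' T r)"
      using T2(1) blF by blast
  qed
qed

text \<open>The finitely many \<open>r\<close> on \<open>u + m\<close> coordinates are blocked
  simultaneously, and by the degree bound they account for all of \<open>B\<close>. The bound
  \<open>n'\<close> serves all \<open>X\<close> at once.\<close>

lemma exists_blocked:
  fixes A :: "'k::{field,finite} form set"
  assumes A: "submodule u A" and B: "submodule u B" and AB: "A \<subseteq> B"
    and irr: "irreducible_over u A B" and const: "\<And>b. b \<in> B \<Longrightarrow> b \<bullet> trunc u \<in> A"
    and deg: "degree_less u m B A" and n: "u \<le> n"
  obtains n' where "u \<le> n'"
    "\<And>X T0 b. closed_under u A X \<Longrightarrow> T0 \<in> X \<Longrightarrow> T0 \<bullet> trunc n = T0 \<Longrightarrow> b \<in> B \<Longrightarrow>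
      b \<bullet> trunc n = b \<Longrightarrow> T0 + b \<notin> X \<Longrightarrow> \<exists>T\<in>X. T \<bullet> trunc n' = T \<and> blocked u A B X n' T"
proof -
  let ?F = "{r \<in> B - A. r \<bullet> trunc (u + m) = r}"
  have "finite ?F"
    using finite_forms_level by (rule finite_subset[rotated]) (use B in \<open>auto intro: submodule_forms\<close>)
  from exists_blocked_at_finite[OF A B AB irr const n this order_refl]
  obtain n0 n1 where n01: "u \<le> n0" "n0 \<le> n1" and ex: "\<forall>X T0 b. closed_under u A X \<longrightarrow> T0 \<in> X \<longrightarrow>
      T0 \<bullet> trunc n = T0 \<longrightarrow> b \<in> B \<longrightarrow> b \<bullet> trunc n = b \<longrightarrow> T0 + b \<notin> X \<longrightarrow>
    (\<exists>T\<in>X. \<exists>b\<in>B. T \<bullet> trunc n1 = T \<and> b \<bullet> (skip u n0 \<circ> trunc n1) = b \<and> T + b \<notin> X \<and>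
        (\<forall>r\<in>?F. blocked_at u A X n0 T r))"
    by blast
  show ?thesis
  proof (rule that[OF n01(1)])
    fix X T0 b
    assume X: "closed_under u A X" and "T0 \<in> X" "T0 \<bullet> trunc n = T0" "b \<in> B"
      "b \<bullet> trunc n = b" "T0 + b \<notin> X"
    then obtain T where T: "T \<in> X" "\<forall>r\<in>?F. blocked_at u A X n0 T r"
      using ex by blast
    have "blocked u A B X n0 T"
      using T(2) by (intro blocked_if_blocked_at[OF A B deg X n01(1)]) blast
    \<comment> \<open>The condition depends on \<open>T\<close> only through its first
      \<open>n0\<close> coordinates.\<close>
    then have "blocked u A B X n0 (T \<bullet> trunc n0)"
      unfolding blocked_def by (simp add: act_act trunc_comp_trunc)
    moreover have "T \<bullet> trunc n0 \<in> X"
      using T(1) n01(1) by (intro closed_under_act[OF X] trunc_block_maps)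
    ultimately show "\<exists>T\<in>X. T \<bullet> trunc n0 = T \<and> blocked u A B X n0 T"
      by (intro bexI[of _ "T \<bullet> trunc n0"]) (simp_all add: act_act trunc_comp_trunc)
  qed
qed
subsection \<open>Well-quasi-order modulo a submodule\<close>

lemma wqo_modD:
  fixes T :: "nat \<Rightarrow> 'k::{field,finite} form"
  assumes "wqo_mod u A X" "\<And>i. T i \<in> X"
  shows "\<exists>i j g. i < j \<and> g \<in> block_maps u \<and> T j \<bullet> g - T i \<in> A"
  using assms(1)[unfolded wqo_mod_def, rule_format, of T, OF assms(2)] by blast

lemma wqo_modI:
  assumes "\<And>T :: nat \<Rightarrow> 'k::{field,finite} form. (\<And>i. T i \<in> X) \<Longrightarrow>
    \<exists>i j. i < j \<and> (\<exists>g\<in>block_maps u. T j \<bullet> g - T i \<in> A)"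
  shows "wqo_mod u A X"
  unfolding wqo_mod_def by (intro allI impI assms) simp

lemma wqo_mod_subset: "wqo_mod u A X \<Longrightarrow> Y \<subseteq> X \<Longrightarrow> wqo_mod u A Y"
  unfolding wqo_mod_def by (simp add: subset_iff)

lemma wqo_mod_subsequence:
  fixes T :: "nat \<Rightarrow> 'k::{field,finite} form"
  assumes "wqo_mod u A X" "infinite I" "\<And>i. i \<in> I \<Longrightarrow> T i \<in> X"
  shows "\<exists>i\<in>I. \<exists>j\<in>I. i < j \<and> (\<exists>g\<in>block_maps u. T j \<bullet> g - T i \<in> A)"
proof -
  obtain f :: "nat \<Rightarrow> nat" where f: "strict_mono f" "\<And>i. f i \<in> I"
    using infinite_enumerate[OF assms(2)] by blast
  then obtain i j g where ij: "i < j" "g \<in> block_maps u" "T (f j) \<bullet> g - T (f i) \<in> A"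
    using wqo_modD[OF assms(1), of "\<lambda>i. T (f i)", OF assms(3)] by blast
  then show ?thesis
    using f(2) strict_monoD[OF f(1) ij(1)] by blast
qed

lemma wqo_mod_Un:
  assumes "wqo_mod u A X" "wqo_mod u A Y"
  shows "wqo_mod u A (X \<union> Y)"
proof (rule wqo_modI)
  fix T :: "nat \<Rightarrow> 'a form" assume T: "\<And>i. T i \<in> X \<union> Y"
  have "{i. T i \<in> X} \<union> {i. T i \<in> Y} = UNIV" using T by auto
  then have "infinite ({i. T i \<in> X} \<union> {i. T i \<in> Y})" by simp
  then consider "infinite {i. T i \<in> X}" | "infinite {i. T i \<in> Y}" by blast
  then show "\<exists>i j. i < j \<and> (\<exists>g\<in>block_maps u. T j \<bullet> g - T i \<in> A)"
  proof cases
    case 1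
    from wqo_mod_subsequence[OF assms(1) 1, of T] show ?thesis by blast
  next
    case 2
    from wqo_mod_subsequence[OF assms(2) 2, of T] show ?thesis by blast
  qed
qed

text \<open>By pigeonhole, infinitely many members of the sequence agree on the first
  \<open>u\<close> coordinates. Block maps fix these, so the difference of a good pair among them
  vanishes there.\<close>

lemma wqo_mod_constant_part:
  assumes wq: "wqo_mod u B forms" and A: "submodule u0 A" and u: "u0 \<le> u"
  shows "wqo_mod u {b \<in> B. b \<bullet> trunc u0 \<in> A} forms"
proof (rule wqo_modI)
  fix T :: "nat \<Rightarrow> 'a form" assume T: "\<And>i. T i \<in> forms"
  have "range (\<lambda>i. T i \<bullet> trunc u) \<subseteq> {S \<in> forms. S \<bullet> trunc u = S}"
    using T by (auto intro: forms_act lin_trunc simp: act_act trunc_comp_trunc)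
  then have "finite (range (\<lambda>i. T i \<bullet> trunc u))"
    by (rule finite_subset[OF _ finite_forms_level])
  then obtain k where "infinite {i. T i \<bullet> trunc u = T k \<bullet> trunc u}"
    using pigeonhole_infinite[of UNIV "\<lambda>i. T i \<bullet> trunc u"] by auto
  moreover define I where "I = {i. T i \<bullet> trunc u = T k \<bullet> trunc u}"
  ultimately have "infinite I" by simp
  from wqo_mod_subsequence[OF wq this, of T, OF T]
  obtain i j g where I: "i \<in> I" "j \<in> I" and ij: "i < j" "g \<in> block_maps u" "T j \<bullet> g - T i \<in> B"
    by blast
  have "g \<circ> trunc u = trunc u" using ij(2) by (auto simp: block_maps_def)
  then have "(T j \<bullet> g - T i) \<bullet> trunc u = 0"
    using I by (simp only: I_def mem_Collect_eq act_diff act_act diff_self)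
  then have "(T j \<bullet> g - T i) \<bullet> trunc u \<bullet> trunc u0 = 0" by (simp only: act_zero)
  then have "(T j \<bullet> g - T i) \<bullet> trunc u0 \<in> A"
    using u submodule_zero[OF A] by (simp only: act_act trunc_comp_trunc min_absorb2)
  then show "\<exists>i j. i < j \<and> (\<exists>g\<in>block_maps u. T j \<bullet> g - T i \<in> {b \<in> B. b \<bullet> trunc u0 \<in> A})"
    using ij by blast
qed

lemma closed_under_avoid:
  assumes A: "submodule u A" and X: "closed_under u A X"
  shows "closed_under u A {S \<in> X. \<forall>g\<in>block_maps u. S \<bullet> g - T \<notin> A}"
  unfolding closed_under_def
proof (intro conjI ballI CollectI subsetI)
  fix S assume "S \<in> {S \<in> X. \<forall>g\<in>block_maps u. S \<bullet> g - T \<notin> A}"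
  then have S: "S \<in> X" "\<And>g. g \<in> block_maps u \<Longrightarrow> S \<bullet> g - T \<notin> A" by auto
  show "S \<in> forms" using X S(1) by (rule closed_under_forms)
  fix h :: "'a seq \<Rightarrow> 'a seq" assume h: "h \<in> block_maps u"
  show "S \<bullet> h \<in> X" using S(1) h by (rule closed_under_act[OF X])
  fix g :: "'a seq \<Rightarrow> 'a seq" assume "g \<in> block_maps u"
  then show "S \<bullet> h \<bullet> g - T \<notin> A" using S(2) h by (simp only: act_act block_maps_comp simp_thms)
next
  fix S a assume "S \<in> {S \<in> X. \<forall>g\<in>block_maps u. S \<bullet> g - T \<notin> A}" and a: "a \<in> A"
  then have S: "S \<in> X" "\<And>g. g \<in> block_maps u \<Longrightarrow> S \<bullet> g - T \<notin> A" by auto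
  show "S + a \<in> X" using X S(1) a by (simp only: closed_under_def)
  fix g :: "'a seq \<Rightarrow> 'a seq" assume g: "g \<in> block_maps u"
  show "(S + a) \<bullet> g - T \<notin> A"
  proof
    assume "(S + a) \<bullet> g - T \<in> A"
    then have "(S + a) \<bullet> g - T - a \<bullet> g \<in> A"
      using submodule_diff[OF A] submodule_act[OF A a g] by blast
    moreover have "(S + a) \<bullet> g - T - a \<bullet> g = S \<bullet> g - T"
      unfolding act_add by (simp add: fun_eq_iff)
    ultimately show False using S(2)[OF g] by (simp only: simp_thms)
  qed
qed

text \<open>Each \<open>S\<close> is replaced by an equivalent form that extends \<open>T0\<close>
  modulo \<open>A\<close> on the first \<open>n\<close> coordinates. For a good pair modulo
  \<open>skipped u n A B\<close>, the difference is, modulo \<open>A\<close>, some \<open>b\<close>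
  that does not see \<open>{u..<n}\<close> and whose addition stays in \<open>X\<close>; blockedness
  puts \<open>b\<close> into \<open>A\<close>.\<close>

lemma wqo_mod_blocked:
  fixes A :: "'k::{field,finite} form set"
  assumes A: "submodule u A" and n: "u \<le> n"
    and X: "closed_under u A X" and bl: "blocked u A B X n T0" and T0: "T0 \<bullet> trunc n = T0"
    and wq: "wqo_mod n (skipped u n A B) forms"
  shows "wqo_mod u A {S \<in> X. \<exists>g\<in>block_maps u. S \<bullet> g - T0 \<in> A}"
proof (rule wqo_modI)
  fix T :: "nat \<Rightarrow> 'k form"
  assume T: "\<And>i. T i \<in> {S \<in> X. \<exists>g\<in>block_maps u. S \<bullet> g - T0 \<in> A}"
  have "\<exists>h\<in>block_maps u. \<exists>h'\<in>block_maps u. S \<bullet> h \<bullet> h' = S \<and> S \<bullet> h \<bullet> trunc n - T0 \<bullet> trunc n \<in> A"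
    if S: "S \<in> X" and g: "g \<in> block_maps u" and Sg: "S \<bullet> g - T0 \<in> A" for S g
  proof -
    obtain m where m: "u \<le> m" "S \<bullet> trunc m = S"
      using forms_level[OF closed_under_forms[OF X S]] by blast
    \<comment> \<open>\<open>h\<close> uses \<open>g\<close> on the first \<open>n\<close>
      coordinates, while \<open>q\<close> keeps a copy of the coordinates in \<open>{u..<m}\<close>
      at positions moved up by \<open>n\<close>. \<open>h'\<close> reads this copy back, so that
      \<open>h \<circ> h' = trunc m\<close>.\<close>
    define q h' :: "'k seq \<Rightarrow> 'k seq" where
      "q = cmap (\<lambda>j. if u \<le> j \<and> j < m then Some (n + j) else None)" and
      "h' = cmap (\<lambda>j. if j < u then Some j else if n + u \<le> j then Some (j - n) else None)"
    define h where "h = (g \<circ> trunc n) + q"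
    have q: "q \<in> block_dirs u"
      unfolding q_def using n by (intro cmap_block_dirs) (auto split: if_splits)
    have h: "h \<in> block_maps u"
      unfolding h_def using q g n by (intro block_maps_add_dirs block_maps_comp trunc_block_maps)
    have h': "h' \<in> block_maps u"
      unfolding h'_def using n by (intro cmap_block_maps) (auto split: if_splits)
    have "h \<circ> trunc n = g \<circ> trunc n"
    proof (intro ext)
      fix w j
      have "q (trunc n w) = 0"
        by (auto simp: q_def cmap_def trunc_def fun_eq_iff)
      then show "(h \<circ> trunc n) w j = (g \<circ> trunc n) w j"
        by (simp add: h_def)
    qed
    then have "S \<bullet> h \<bullet> trunc n - T0 \<bullet> trunc n = (S \<bullet> g - T0) \<bullet> trunc n"
      by (simp only: act_act act_diff)
    then have "S \<bullet> h \<bullet> trunc n - T0 \<bullet> trunc n \<in> A"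
      using Sg n by (simp only: submodule_act[OF A] trunc_block_maps)
    moreover have "h \<circ> h' = trunc m"
    proof (intro ext)
      fix w j
      have "trunc n (h' w) = trunc u w"
        using n by (auto simp: h'_def cmap_def trunc_def fun_eq_iff)
      moreover have "g (trunc u w) = trunc u w" using g by (simp add: block_maps_def)
      ultimately show "(h \<circ> h') w j = trunc m w j"
        using m(1) by (auto simp: h_def q_def h'_def cmap_def trunc_def)
    qed
    ultimately show ?thesis using h h' m(2) by (metis act_act)
  qed
  then have "\<forall>i. \<exists>h h'. h \<in> block_maps u \<and> h' \<in> block_maps u \<and> T i \<bullet> h \<bullet> h' = T i \<and>
      T i \<bullet> h \<bullet> trunc n - T0 \<bullet> trunc n \<in> A"
    using T by blast
  then obtain h h' where h: "\<And>i. h i \<in> block_maps u" "\<And>i. h' i \<in> block_maps u"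
      "\<And>i. T i \<bullet> h i \<bullet> h' i = T i" "\<And>i. T i \<bullet> h i \<bullet> trunc n - T0 \<bullet> trunc n \<in> A"
    by metis
  have TX: "T i \<bullet> h i \<in> X" for i using T h(1) by (blast intro: closed_under_act[OF X])
  obtain i j g where ij: "i < j" "g \<in> block_maps n"
    "T j \<bullet> h j \<bullet> g - T i \<bullet> h i \<in> skipped u n A B"
    using wqo_modD[OF wq, of "\<lambda>i. T i \<bullet> h i", OF closed_under_forms[OF X TX]] by blast
  have g: "g \<in> block_maps u" using ij(2) block_maps_antimono[OF n] by blast
  obtain b a where ba: "T j \<bullet> h j \<bullet> g - T i \<bullet> h i = b + a" "b \<in> B" "b \<bullet> skip u n = b" "a \<in> A"
    using ij(3) by (elim skippedE)
  have "T i \<bullet> h i + b - T j \<bullet> h j \<bullet> g = - a"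
    using ba(1) by (simp add: algebra_simps)
  then have "T i \<bullet> h i + b - T j \<bullet> h j \<bullet> g \<in> A" using submodule_uminus[OF A ba(4)] by (simp only:)
  then have "T i \<bullet> h i + b \<in> X"
    by (rule closed_under_cong[OF X closed_under_act[OF X TX g]])
  then have "b \<in> A" using bl TX[of i] h(4)[of i] ba(2,3) unfolding blocked_def by blast
  then have "T j \<bullet> h j \<bullet> g - T i \<bullet> h i \<in> A" unfolding ba(1) using ba(4) by (rule submodule_add[OF A])
  then have "(T j \<bullet> h j \<bullet> g - T i \<bullet> h i) \<bullet> h' i \<in> A" using h(2) by (rule submodule_act[OF A])
  then have "T j \<bullet> (h j \<circ> g \<circ> h' i) - T i \<in> A"
    by (simp only: act_diff h(3)) (simp only: act_act)
  moreover have "h j \<circ> g \<circ> h' i \<in> block_maps u" using h(1,2) g by (intro block_maps_comp)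
  ultimately show "\<exists>i j. i < j \<and> (\<exists>g\<in>block_maps u. T j \<bullet> g - T i \<in> A)"
    using ij(1) by blast
qed

text \<open>Pick an element lost at each step of an infinite descending chain. In a good pair the
  later element lies in the closed set that the earlier one has left, and restricts to it modulo
  \<open>B\<close>.\<close>

lemma closed_under_wf:
  assumes B: "submodule u B" and wq: "wqo_mod u B forms"
  shows "wf {(Z', Z). closed_under u B Z \<and> closed_under u B Z' \<and> Z' \<subset> Z}"
  unfolding wf_iff_no_infinite_down_chain
proof (intro notI, elim exE)
  fix Z assume "\<forall>i. (Z (Suc i), Z i) \<in> {(Z', Z). closed_under u B Z \<and> closed_under u B Z' \<and> Z' \<subset> Z}"
  then have Z: "closed_under u B (Z i)" "Z (Suc i) \<subset> Z i" for i by auto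
  have "\<forall>i. \<exists>T. T \<in> Z i - Z (Suc i)" using Z(2) by blast
  then obtain T where T: "\<And>i. T i \<in> Z i - Z (Suc i)" by metis
  have "T i \<in> forms" for i using T[of i] closed_under_forms[OF Z(1)] by blast
  from wqo_modD[OF wq, of T, OF this]
  obtain i j g where ij: "i < j" "g \<in> block_maps u" "T j \<bullet> g - T i \<in> B"
    by blast
  have "Z j \<subseteq> Z (Suc i)"
    by (rule lift_Suc_antimono_le[of Z]) (use Z(2) ij(1) in auto)
  then have "T j \<bullet> g \<in> Z (Suc i)"
    using T ij(2) by (blast intro: closed_under_act[OF Z(1)])
  moreover have "T i - T j \<bullet> g \<in> B" using submodule_uminus[OF B ij(3)] by (simp only: minus_diff_eq)
  ultimately have "T i \<in> Z (Suc i)" by (rule closed_under_cong[OF Z(1)])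
  then show False using T by blast
qed

lemma closed_under_plus:
  assumes A: "submodule u A" and B: "submodule u B" and AB: "A \<subseteq> B" and X: "closed_under u A X"
  shows "closed_under u B {x + b | x b. x \<in> X \<and> b \<in> B}"
  unfolding closed_under_def
proof (intro conjI ballI subsetI)
  fix S assume "S \<in> {x + b | x b. x \<in> X \<and> b \<in> B}"
  then obtain x b where S: "S = x + b" "x \<in> X" "b \<in> B" by blast
  show "S \<in> forms"
    unfolding S(1) using S(2,3) closed_under_forms[OF X] submodule_forms[OF B]
    by (intro additive_subgroup_add[OF forms_subgroup])
  fix g :: "'a seq \<Rightarrow> 'a seq" assume "g \<in> block_maps u"
  then show "S \<bullet> g \<in> {x + b | x b. x \<in> X \<and> b \<in> B}"
    unfolding S(1) act_add using S(2,3) closed_under_act[OF X] submodule_act[OF B] by blast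
next
  fix S b' assume "S \<in> {x + b | x b. x \<in> X \<and> b \<in> B}" and b': "b' \<in> B"
  then obtain x b where S: "S = x + b" "x \<in> X" "b \<in> B" by blast
  show "S + b' \<in> {x + b | x b. x \<in> X \<and> b \<in> B}"
    unfolding S(1) add.assoc using S(2,3) b' submodule_add[OF B] by blast
qed

text \<open>Noetherian induction over the sets \<open>Z\<close> closed modulo \<open>B\<close>. The
  tail of a bad sequence avoids \<open>T 0\<close>, and for sets avoiding \<open>T 0\<close> one
  counts members on \<open>n'\<close> coordinates. \<open>IH\<close> is descent in degree
  \<open>e\<close>, applied to the quotient by \<open>skipped\<close>.\<close>

lemma wqo_mod_irreducible_step:
  fixes A :: "'k::{field,finite} form set"
  assumes IH: "\<And>n A'. u \<le> n \<Longrightarrow> submodule n A' \<Longrightarrow> A' \<subseteq> B \<Longrightarrow> degree_less n e B A' \<Longrightarrow>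
      wqo_mod n A' forms"
    and A: "submodule u A" and B: "submodule u B" and AB: "A \<subseteq> B"
    and irr: "irreducible_over u A B" and const: "\<And>b. b \<in> B \<Longrightarrow> b \<bullet> trunc u \<in> A"
    and deg: "degree_less u (Suc e) B A" and wq: "wqo_mod u B forms"
  shows "wqo_mod u A forms"
proof -
  have "wqo_mod u A Z" if "closed_under u B Z" for Z
    using closed_under_wf[OF B wq] that
  proof (induction Z rule: wf_induct_rule)
    case (less Z)
    then have Zsmall: "wqo_mod u A Z'" if "closed_under u B Z'" "Z' \<subset> Z" for Z'
      using that by blast
    have Z: "closed_under u B Z" using less.prems .
    have ZA: "closed_under u A Z" using Z AB unfolding closed_under_def by blast
    show ?case
    proof (rule wqo_modI, rule ccontr)
      fix T :: "nat \<Rightarrow> 'k form"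
      assume T: "\<And>i. T i \<in> Z" and "\<not> (\<exists>i j. i < j \<and> (\<exists>g\<in>block_maps u. T j \<bullet> g - T i \<in> A))"
      then have bad: "T j \<bullet> g - T i \<notin> A" if "i < j" "g \<in> block_maps u" for i j g
        using that by blast
      obtain n where n: "u \<le> n" "T 0 \<bullet> trunc n = T 0"
        using forms_level[OF closed_under_forms[OF Z T]] by blast
      \<comment> \<open>\<open>n'\<close> depends on the level \<open>n\<close> of
        \<open>T 0\<close> and is fixed before any \<open>X\<close>, so one level serves throughout
        the count below.\<close>
      obtain n' where n': "u \<le> n'" and ex: "\<And>X T0 b. closed_under u A X \<Longrightarrow> T0 \<in> X \<Longrightarrow>
          T0 \<bullet> trunc n = T0 \<Longrightarrow> b \<in> B \<Longrightarrow> b \<bullet> trunc n = b \<Longrightarrow> T0 + b \<notin> X \<Longrightarrow>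
          \<exists>T\<in>X. T \<bullet> trunc n' = T \<and> blocked u A B X n' T"
        using exists_blocked[OF A B AB irr const deg n(1)] by blast
      have wq': "wqo_mod n' (skipped u n' A B) forms"
        by (intro IH n' skipped_submodule[OF A B n' AB] skipped_subset[OF B AB]
            skipped_degree_less[OF A B n' AB deg])
      have claim: "wqo_mod u A X" if "closed_under u A X" "X \<subseteq> Z" "T 0 \<notin> X" for X
        using that
      proof (induction "card {S \<in> X. S \<bullet> trunc n' = S}" arbitrary: X rule: less_induct)
        case less
        note X = less.prems(1)
        let ?XB = "{x + b | x b. x \<in> X \<and> b \<in> B}"
        show ?case
        proof (cases "T 0 \<in> ?XB")
          \<comment> \<open>\<open>X\<close> loses \<open>T 0\<close> even modulo \<open>B\<close>,
            so the outer induction applies to \<open>X + B\<close>.\<close>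
          case False
          have "?XB \<subseteq> Z" using less.prems(2) Z unfolding closed_under_def by blast
          then have "?XB \<subset> Z" using False T[of 0] by blast
          then have "wqo_mod u A ?XB"
            using closed_under_plus[OF A B AB X] by (intro Zsmall)
          moreover have "X \<subseteq> ?XB"
          proof
            fix x assume "x \<in> X"
            then have "x + 0 \<in> ?XB" using submodule_zero[OF B] by blast
            then show "x \<in> ?XB" by (simp only: add_0_right)
          qed
          ultimately show ?thesis by (rule wqo_mod_subset)
        next
          case True
          then obtain x b where xb: "T 0 = x + b" "x \<in> X" "b \<in> B" by blast
          \<comment> \<open>Truncation brings \<open>x\<close> and \<open>b\<close> down to
            \<open>n\<close> coordinates without changing their sum \<open>T 0\<close>, which is not
            in \<open>X\<close>.\<close>
          have eq: "x \<bullet> trunc n + b \<bullet> trunc n = T 0" using n(2) by (simp only: xb(1) act_add)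
          have t: "trunc n \<in> block_maps u" using n(1) by (rule trunc_block_maps)
          have "\<exists>T\<in>X. T \<bullet> trunc n' = T \<and> blocked u A B X n' T"
          proof (rule ex[OF X])
            show "x \<bullet> trunc n \<in> X" using xb(2) t by (rule closed_under_act[OF X])
            show "b \<bullet> trunc n \<in> B" using xb(3) t by (rule submodule_act[OF B])
            show "x \<bullet> trunc n + b \<bullet> trunc n \<notin> X" using less.prems(3) by (simp only: eq simp_thms)
          qed (simp_all add: act_act trunc_comp_trunc)
          then obtain T' where T': "T' \<in> X" "T' \<bullet> trunc n' = T'" "blocked u A B X n' T'"
            by blast
          \<comment> \<open>\<open>T'\<close> lives on \<open>n'\<close> coordinates and is missing
            from \<open>?X1\<close>, so the count drops; \<open>?X2\<close> is covered by
            \<open>wqo_mod_blocked\<close>.\<close>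
          let ?X1 = "{S \<in> X. \<forall>g\<in>block_maps u. S \<bullet> g - T' \<notin> A}"
          let ?X2 = "{S \<in> X. \<exists>g\<in>block_maps u. S \<bullet> g - T' \<in> A}"
          have "T' \<bullet> id - T' \<in> A" using submodule_zero[OF A] by (simp only: act_id diff_self)
          then have "T' \<notin> ?X1" using block_maps_id by blast
          then have "{S \<in> ?X1. S \<bullet> trunc n' = S} \<subset> {S \<in> X. S \<bullet> trunc n' = S}"
            using T'(1,2) by blast
          moreover have "finite {S \<in> X. S \<bullet> trunc n' = S}"
            by (rule finite_subset[OF _ finite_forms_level[of n']])
               (use closed_under_forms[OF X] in blast)
          ultimately have "card {S \<in> ?X1. S \<bullet> trunc n' = S} < card {S \<in> X. S \<bullet> trunc n' = S}"
            by (intro psubset_card_mono)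
          then have "wqo_mod u A ?X1"
            using less.prems closed_under_avoid[OF A X] by (intro less.hyps) blast+
          moreover have "wqo_mod u A ?X2"
            using wqo_mod_blocked[OF A n' X T'(3,2) wq'] .
          ultimately have "wqo_mod u A (?X1 \<union> ?X2)" by (rule wqo_mod_Un)
          then show ?thesis by (rule wqo_mod_subset) blast
        qed
      qed
      let ?X = "{S \<in> Z. \<forall>g\<in>block_maps u. S \<bullet> g - T 0 \<notin> A}"
      have "T 0 \<bullet> id - T 0 \<in> A" using submodule_zero[OF A] by (simp only: act_id diff_self)
      then have "T 0 \<notin> ?X" using block_maps_id by blast
      then have "wqo_mod u A ?X"
        using closed_under_avoid[OF A ZA] by (intro claim) blast+
      moreover have "T (Suc i) \<in> ?X" for i using T bad[of 0 "Suc i"] by blast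
      ultimately have "\<exists>i j g. i < j \<and> g \<in> block_maps u \<and> T (Suc j) \<bullet> g - T (Suc i) \<in> A"
        by (rule wqo_modD[of u A ?X "\<lambda>i. T (Suc i)"])
      then obtain i j g where "i < j" "g \<in> block_maps u" "T (Suc j) \<bullet> g - T (Suc i) \<in> A"
        by blast
      then show False using bad[of "Suc i" "Suc j" g] by blast
    qed
  qed
  moreover have "closed_under u B (forms :: 'k form set)"
    unfolding closed_under_def
    using submodule_forms[OF B] forms_act block_maps_lin additive_subgroup_add[OF forms_subgroup]
    by blast
  ultimately show ?thesis by blast
qed

text \<open>Choose \<open>r\<close> whose generated submodule has the fewest members on
  \<open>u + m\<close> coordinates. Any \<open>r'\<close> generating less would have a restriction
  at this level outside \<open>A\<close>, and minimality forces that restriction to regenerate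
  \<open>r\<close>.\<close>

lemma exists_irreducible_over:
  fixes A :: "'k::{field,finite} form set"
  assumes A: "submodule u A" and B: "submodule u B" and AB: "A \<subset> B" and deg: "degree_less u m B A"
  obtains r where "r \<in> B - A" "r \<bullet> trunc (u + m) = r" "irreducible_over u A (generated u A r)"
proof -
  let ?P = "\<lambda>r. r \<in> B - A \<and> r \<bullet> trunc (u + m) = r"
  let ?L = "\<lambda>X. {T \<in> X. T \<bullet> trunc (u + m) = T}"
  have level: "\<exists>g\<in>block_maps u. ?P (b \<bullet> g)" if b: "b \<in> B" "b \<notin> A" for b
  proof -
    obtain g where "g \<in> block_maps u" "b \<bullet> g \<notin> A" "b \<bullet> g \<bullet> trunc (u + m) = b \<bullet> g"
      using degree_less_detect_level[OF A deg b(1) submodule_forms[OF B b(1)] b(2)] .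
    then show ?thesis using submodule_act[OF B b(1)] by blast
  qed
  have "\<exists>r. ?P r" using AB level by blast
  then obtain r where r: "?P r"
    and min: "\<And>r'. ?P r' \<Longrightarrow> card (?L (generated u A r)) \<le> card (?L (generated u A r'))"
    using ex_has_least_nat[of ?P _ "\<lambda>r. card (?L (generated u A r))"] by blast
  have sub: "submodule u (generated u A r)" if "r \<in> B" for r
    using generated_submodule[OF A submodule_forms[OF B that]] .
  have "generated u A r \<subseteq> generated u A r'" if r': "r' \<in> generated u A r - A" for r'
  proof -
    have r'B: "r' \<in> B" using r' generated_subset[OF B, of A r] r AB by blast
    then obtain g where g: "g \<in> block_maps u" "?P (r' \<bullet> g)" using level r' by blast
    have 1: "generated u A (r' \<bullet> g) \<subseteq> generated u A r'"
      using generated_self[OF A, of r'] g(1) generated.base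
      by (intro generated_subset[OF sub[OF r'B]] submodule_act[OF sub[OF r'B]] subsetI)
    have 2: "generated u A r' \<subseteq> generated u A r"
      using r r' generated.base by (intro generated_subset[OF sub] subsetI) blast+
    have "?L (generated u A (r' \<bullet> g)) = ?L (generated u A r)"
    proof (rule card_seteq)
      have "generated u A r \<subseteq> forms" using r sub[of r] by (auto intro: submodule_forms)
      then show "finite (?L (generated u A r))"
        by (intro finite_subset[OF _ finite_forms_level[of "u + m"]]) blast
      show "?L (generated u A (r' \<bullet> g)) \<subseteq> ?L (generated u A r)" using 1 2 by blast
    qed (rule min[OF g(2)])
    then have "r \<in> generated u A (r' \<bullet> g)" using r generated_self[OF A, of r] by blast
    then have "r \<in> generated u A r'" using 1 by blast
    then show ?thesis
      using generated.base by (intro generated_subset[OF sub[OF r'B]] subsetI)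
  qed
  then show ?thesis using r that unfolding irreducible_over_def by blast
qed

text \<open>Induction on the degree \<open>e\<close>. Within one degree, \<open>B0 / A\<close> is
  cut into irreducible pieces, each handled by \<open>wqo_mod_irreducible_step\<close>; all
  \<open>u' \<ge> u\<close> are carried along because blocking enlarges the fixed block.\<close>

theorem wqo_mod_descend:
  fixes A :: "'k::{field,finite} form set"
  assumes "submodule u A" "submodule u B" "A \<subseteq> B" "degree_less u e B A"
    and "\<And>u'. u \<le> u' \<Longrightarrow> wqo_mod u' B forms"
  shows "wqo_mod u A forms"
  using assms
proof (induction e arbitrary: u A B)
  case 0
  have "B \<subseteq> A"
  proof
    fix T assume "T \<in> B"
    then have "fdiff (\<lambda>h. T \<bullet> h) id (\<lambda>_. id) 0 \<in> A"
      using 0(4) block_maps_id unfolding degree_less_def by blast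
    then show "T \<in> A" by (simp only: fdiff.simps act_id)
  qed
  then have "A = B" using 0(3) by blast
  then show ?case using 0(5) by blast
next
  case (Suc e)
  note A = Suc.prems(1) and B = Suc.prems(2)
  \<comment> \<open>Restricting to elements constant modulo \<open>A\<close> provides
    \<open>const\<close> for the irreducible step, and \<open>wqo_mod_constant_part\<close>
    transfers the property from \<open>B\<close> to \<open>B0\<close>.\<close>
  define B0 where "B0 = {b \<in> B. b \<bullet> trunc u \<in> A}"
  have B0: "submodule u B0"
    unfolding submodule_def additive_subgroup_def
  proof (intro conjI ballI)
    show "0 \<in> B0" using submodule_zero[OF A] submodule_zero[OF B] by (simp add: B0_def)
    show "B0 \<subseteq> forms" using B by (auto simp: B0_def submodule_def)
    fix x y assume "x \<in> B0" "y \<in> B0"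
    then show "x - y \<in> B0"
      unfolding B0_def using submodule_diff[OF A] submodule_diff[OF B] by (simp only: mem_Collect_eq act_diff)
  next
    fix x and g :: "'k seq \<Rightarrow> 'k seq" assume x: "x \<in> B0" and g: "g \<in> block_maps u"
    have "g \<circ> trunc u = trunc u" using g by (auto simp: block_maps_def)
    then show "x \<bullet> g \<in> B0"
      using x submodule_act[OF B _ g] by (simp add: B0_def act_act)
  qed
  have wqB0: "wqo_mod u' B0 forms" if "u \<le> u'" for u'
    unfolding B0_def using wqo_mod_constant_part[OF Suc.prems(5)[OF that] A that] .
  have AB0: "A \<subseteq> B0"
    using Suc.prems(3) submodule_act[OF A _ trunc_block_maps] by (auto simp: B0_def)
  let ?L = "\<lambda>X. {T \<in> X. T \<bullet> trunc (u + Suc e) = T}"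
  \<comment> \<open>Descent from \<open>B0\<close> to \<open>A\<close> ends after finitely many
    pieces, since each contains a new form on \<open>u + Suc e\<close> coordinates.\<close>
  have "\<forall>u'\<ge>u. wqo_mod u' A' forms" if "submodule u A'" "A \<subseteq> A'" "A' \<subseteq> B0" for A'
    using that
  proof (induction "card (?L (B0 - A'))" arbitrary: A' rule: less_induct)
    case less
    note A' = less.prems(1)
    have "degree_less u (Suc e) B0 A'"
      using Suc.prems(4) less.prems(2) unfolding degree_less_def B0_def by blast
    note deg = this
    show ?case
    proof (cases "A' = B0")
      case True
      then show ?thesis using wqB0 by blast
    next
      case False
      then obtain r where r: "r \<in> B0 - A'" "r \<bullet> trunc (u + Suc e) = r"
        and irr: "irreducible_over u A' (generated u A' r)"
        using exists_irreducible_over[OF A' B0 _ deg] less.prems(3) by blast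
      define C where "C = generated u A' r"
      have C: "submodule u C"
        unfolding C_def using generated_submodule[OF A' submodule_forms[OF B0]] r(1) by blast
      have A'C: "A' \<subseteq> C" unfolding C_def by (blast intro: generated.base)
      have CB0: "C \<subseteq> B0" unfolding C_def using generated_subset[OF B0 less.prems(3)] r(1) by blast
      have "r \<in> C" unfolding C_def using A' by (rule generated_self)
      then have "?L (B0 - C) \<subset> ?L (B0 - A')" using A'C r by blast
      moreover have "finite (?L (B0 - A'))"
        by (rule finite_subset[OF _ finite_forms_level[of "u + Suc e"]])
           (use submodule_forms[OF B0] in blast)
      ultimately have "card (?L (B0 - C)) < card (?L (B0 - A'))" by (intro psubset_card_mono)
      then have wqC: "\<And>u'. u \<le> u' \<Longrightarrow> wqo_mod u' C forms"
        using less.hyps[OF _ C] less.prems(2) A'C CB0 by blast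
      have degC: "degree_less u' (Suc e) C A'" if "u \<le> u'" for u'
        using deg that CB0 by (rule degree_less_mono)
      show ?thesis
      proof (intro allI impI)
        fix u' assume u': "u \<le> u'"
        \<comment> \<open>\<open>C / A'\<close> is irreducible for maps fixing \<open>u\<close>
          coordinates, whereas \<open>u'\<close> are to be fixed. \<open>D / A'\<close> is
          irreducible for the latter, and \<open>C / D\<close> has degree less than
          \<open>e\<close>, so \<open>Suc.IH\<close> leads from \<open>C\<close> to
          \<open>D\<close>.\<close>
        define D where "D = skipped u u' A' C"
        have D: "submodule u' D" unfolding D_def by (rule skipped_submodule[OF A' C u' A'C])
        have DC: "D \<subseteq> C" unfolding D_def by (rule skipped_subset[OF C A'C])
        have A'D: "A' \<subseteq> D" unfolding D_def by (rule skipped_superset[OF C])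
        have degD: "degree_less u' e C D"
          unfolding D_def by (rule skipped_degree_less[OF A' C u' A'C degC[OF order_refl]])
        have wqD: "wqo_mod n D forms" if "u' \<le> n" for n
        proof (rule Suc.IH)
          show "submodule n D" using D that by (rule submodule_mono)
          show "submodule n C" using C order_trans[OF u' that] by (rule submodule_mono)
          show "degree_less n e C D" using degD that order_refl by (rule degree_less_mono)
          show "wqo_mod n' C forms" if "n \<le> n'" for n'
            using u' \<open>u' \<le> n\<close> that by (intro wqC) simp
        qed (rule DC)
        show "wqo_mod u' A' forms"
        proof (rule wqo_mod_irreducible_step)
          show "submodule u' A'" using A' u' by (rule submodule_mono)
          show "submodule u' D" by (rule D)
          show "A' \<subseteq> D" by (rule A'D)
          show "irreducible_over u' A' D"
            unfolding D_def by (rule skipped_irreducible[OF A' C u' A'C irr[folded C_def]])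
          show "degree_less u' (Suc e) D A'"
            using degC[OF u'] order_refl DC by (rule degree_less_mono)
          show "wqo_mod u' D forms" using order_refl by (rule wqD)
          show "wqo_mod n A'' forms"
            if "u' \<le> n" "submodule n A''" "A'' \<subseteq> D" "degree_less n e D A''" for n A''
          proof (rule Suc.IH)
            show "submodule n D" using D that(1) by (rule submodule_mono)
            show "wqo_mod n' D forms" if "n \<le> n'" for n'
              using \<open>u' \<le> n\<close> that by (intro wqD) simp
          qed (fact that)+
          \<comment> \<open>The part \<open>c\<close> does not see \<open>{u..<u'}\<close>, so its
            truncations to \<open>u\<close> and \<open>u'\<close> coordinates agree, and
            \<open>C \<subseteq> B0\<close> applies.\<close>
          show "b \<bullet> trunc u' \<in> A'" if bD: "b \<in> D" for b
          proof -
            obtain c a where b: "b = c + a" "c \<in> C" "c \<bullet> skip u u' = c" "a \<in> A'"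
              using bD unfolding D_def by (elim skippedE)
            have "c \<bullet> trunc u' = c \<bullet> trunc u"
              using b(3) skip_trunc[OF u'] by (metis act_act)
            moreover have "c \<bullet> trunc u \<in> A'" using b(2) CB0 less.prems(2) by (auto simp: B0_def)
            moreover have "a \<bullet> trunc u' \<in> A'"
              using b(4) u' by (intro submodule_act[OF A'] trunc_block_maps)
            ultimately show ?thesis
              unfolding b(1) act_add by (simp only: submodule_add[OF A'])
          qed
        qed
      qed
    qed
  qed
  from this[OF A order_refl AB0] show ?case by blast
qed

text \<open>Descent in degree \<open>Suc d\<close> from \<open>forms\<close>, modulo which any two
  forms are comparable, to \<open>{0}\<close>. For \<open>u = 0\<close> the block maps are all maps
  satisfying \<open>lin\<close>.\<close>

theorem forms_wqo:
  fixes T :: "nat \<Rightarrow> 'k::{field,finite} form"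
  assumes "\<And>i. T i \<in> forms"
  obtains i j g where "i < j" "lin g" "T j \<bullet> g = T i"
proof -
  have "wqo_mod 0 {0 :: 'k form} forms"
  proof (rule wqo_mod_descend)
    have "0 \<in> (forms :: 'k form set)" using forms_subgroup by (rule additive_subgroup_zero)
    then show "submodule 0 {0 :: 'k form}" "{0 :: 'k form} \<subseteq> forms"
      by (auto simp: submodule_def additive_subgroup_def)
    show "submodule 0 (forms :: 'k form set)"
      using forms_subgroup by (auto simp: submodule_def intro: forms_act block_maps_lin)
    show "degree_less 0 (Suc d) (forms :: 'k form set) {0}" by (rule degree_less_forms)
    show "wqo_mod u (forms :: 'k form set) forms" for u
    proof (rule wqo_modI)
      fix T :: "nat \<Rightarrow> 'k form" assume "\<And>i. T i \<in> forms"
      then have "T 1 \<bullet> id - T 0 \<in> forms"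
        by (intro additive_subgroup_diff[OF forms_subgroup] forms_act lin_id)
      then show "\<exists>i j. i < j \<and> (\<exists>g\<in>block_maps u. T j \<bullet> g - T i \<in> forms)"
        using block_maps_id zero_less_one by blast
    qed
  qed
  from wqo_modD[OF this, of T, OF assms] obtain i j g
    where "i < j" "g \<in> block_maps 0" "T j \<bullet> g - T i \<in> {0}"
    by blast
  then show ?thesis using that[of i j g] block_maps_lin by auto
qed
end

section \<open>Tensors as forms\<close>

text \<open>\<open>b\<close> is a basis indexed by \<open>{..<n}\<close> and \<open>c\<close> gives
  the dual basis; entries of \<open>c v\<close> from \<open>n\<close> on are arbitrary.\<close>

definition coordinates ::
    "('k::field \<Rightarrow> 'v::ab_group_add \<Rightarrow> 'v) \<Rightarrow> 'v set \<Rightarrow> nat \<Rightarrow> (nat \<Rightarrow> 'v) \<Rightarrow> ('v \<Rightarrow> 'k seq) \<Rightarrow> bool"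
  where "coordinates s V n b c \<longleftrightarrow>
     (\<forall>j<n. b j \<in> V) \<and> (\<forall>v\<in>V. v = (\<Sum>j<n. s (c v j) (b j))) \<and>
     (\<forall>v\<in>V. \<forall>w\<in>V. \<forall>j<n. c (v + w) j = c v j + c w j) \<and>
     (\<forall>a. \<forall>v\<in>V. \<forall>j<n. c (s a v) j = a * c v j) \<and>
     (\<forall>i<n. \<forall>j<n. c (b i) j = (if i = j then 1 else 0))"

lemma exists_coordinates:
  assumes "vector_space s" "finite_dim_subspace s V"
  shows "\<exists>n b c. coordinates s V n b c"
proof -
  interpret vs: vector_space s by fact
  obtain B0 where B0: "finite B0" "vs.span B0 = V"
    using assms(2) unfolding finite_dim_subspace_def by blast
  obtain B where B: "B \<subseteq> B0" "vs.independent B" "B0 \<subseteq> vs.span B"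
    using vs.maximal_independent_subset[of B0] by blast
  have fin: "finite B" using B(1) B0(1) by (rule finite_subset)
  have span: "vs.span B = V"
    using B B0(2) vs.span_mono[OF B(1)] vs.span_minimal[OF B(3) vs.subspace_span] by auto
  obtain b where b: "bij_betw b {..<card B} B"
    using ex_bij_betw_nat_finite[OF fin] by (auto simp: atLeast0LessThan)
  define c where "c v j = vs.representation B v (b j)" for v j
  have bB: "b j \<in> B" if "j < card B" for j using b that by (auto simp: bij_betw_def)
  have "coordinates s V (card B) b c"
    unfolding coordinates_def
  proof (intro conjI allI ballI impI)
    fix j assume "j < card B"
    then show "b j \<in> V" using bB vs.span_base span by blast
  next
    fix v assume "v \<in> V"
    then have "v = (\<Sum>x\<in>B. s (vs.representation B v x) x)"
      using vs.sum_representation_eq[OF B(2) _ fin order_refl, of v] span by simp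
    also have "\<dots> = (\<Sum>j<card B. s (c v j) (b j))"
      unfolding c_def by (rule sum.reindex_bij_betw[OF b, symmetric])
    finally show "v = (\<Sum>j<card B. s (c v j) (b j))" .
  next
    fix v w j assume "v \<in> V" "w \<in> V"
    then show "c (v + w) j = c v j + c w j"
      using vs.representation_add[OF B(2), of w v] span by (simp add: c_def add.commute)
  next
    fix a v j assume "v \<in> V"
    then show "c (s a v) j = a * c v j"
      using vs.representation_scale[OF B(2), of v a] span by (simp add: c_def)
  next
    fix i j assume "i < card B" "j < card B"
    then show "c (b i) j = (if i = j then 1 else 0)"
      using vs.representation_basis[OF B(2) bB, of i] b
      by (auto simp: c_def bij_betw_def inj_on_def)
  qed
  then show ?thesis by blast
qed

text \<open>The pairing of \<open>v\<close> with the functional whose value on the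
  \<open>j\<close>-th basis vector is \<open>w j\<close>.\<close>

definition contract :: "nat \<Rightarrow> ('v \<Rightarrow> 'k::field seq) \<Rightarrow> 'k seq \<Rightarrow> 'v \<Rightarrow> 'k" where
  "contract n c w v = (\<Sum>j<n. w j * c v j)"

definition unit_seq :: "nat \<Rightarrow> 'k::field seq" where
  "unit_seq j = (\<lambda>i. if i = j then 1 else 0)"

lemma contract_trunc: "contract n c (trunc n w) v = contract n c w v"
  by (simp add: contract_def trunc_def)

lemma contract_add: "contract n c (w + w') v = contract n c w v + contract n c w' v"
  by (simp add: contract_def sum.distrib algebra_simps)

lemma contract_scale: "contract n c (\<lambda>i. a * w i) v = a * contract n c w v"
  by (simp add: contract_def sum_distrib_left algebra_simps)

lemma contract_zero: "contract n c 0 v = 0"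
  by (simp add: contract_def)

lemma contract_unit_seq: "j < n \<Longrightarrow> contract n c (unit_seq j) v = c v j"
  by (simp add: contract_def unit_seq_def if_distrib[of "\<lambda>x. x * _"] cong: if_cong)

lemma contract_lin_trunc:
  assumes g: "lin g"
  shows "contract N c (g (trunc n w)) v = (\<Sum>m<n. w m * contract N c (g (unit_seq m)) v)"
proof (induction n)
  case 0
  show ?case by (simp only: trunc_0 lin_zero[OF g] contract_zero lessThan_0 sum.empty)
next
  case (Suc n)
  have "trunc (Suc n) w = trunc n w + (\<lambda>i. w n * unit_seq n i)"
    by (auto simp: trunc_def unit_seq_def fun_eq_iff less_Suc_eq)
  moreover have "g (\<lambda>i. w n * unit_seq n i) = (\<lambda>i. w n * g (unit_seq n) i)"
    using g by (simp add: lin_def)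
  ultimately have "g (trunc (Suc n) w) = g (trunc n w) + (\<lambda>i. w n * g (unit_seq n) i)"
    by (simp only: lin_add[OF g])
  then show ?case using Suc by (simp only: contract_add contract_scale sum.lessThan_Suc)
qed

lemma coordinates_sum:
  assumes co: "coordinates s V n b c" and vs: "vector_space s" and V: "module.subspace s V" and i: "i < n"
  shows "c (\<Sum>j<n. s (a j) (b j)) i = a i"
proof -
  interpret vs: vector_space s by fact
  have b: "b j \<in> V" if "j < n" for j using co that by (simp add: coordinates_def)
  have "(\<Sum>j<m. s (a j) (b j)) \<in> V \<and> c (\<Sum>j<m. s (a j) (b j)) i = (if i < m then a i else 0)"
    if "m \<le> n" for m
    using that
  proof (induction m)
    case 0
    have "0 \<in> V" using V by (rule vs.subspace_0)
    moreover have "c (s 0 0) i = 0 * c 0 i"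
      using co i \<open>0 \<in> V\<close> unfolding coordinates_def by blast
    ultimately show ?case by simp
  next
    case (Suc m)
    let ?x = "\<Sum>j<m. s (a j) (b j)"
    have x: "?x \<in> V" "c ?x i = (if i < m then a i else 0)" using Suc by simp_all
    have sb: "s (a m) (b m) \<in> V" using Suc.prems b by (intro vs.subspace_scale[OF V]) simp
    have "c (?x + s (a m) (b m)) i = c ?x i + c (s (a m) (b m)) i"
      using co x(1) sb i unfolding coordinates_def by blast
    also have "c (s (a m) (b m)) i = a m * c (b m) i"
      using co b[of m] Suc.prems i unfolding coordinates_def by simp
    also have "c (b m) i = (if m = i then 1 else 0)"
      using co Suc.prems i unfolding coordinates_def by simp
    finally show ?case using x sb by (auto intro: vs.subspace_add[OF V] simp: less_Suc_eq)
  qed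
  from this[of n] show ?thesis using i by simp
qed

text \<open>The tensor represented by \<open>p\<close>, evaluated on \<open>d\<close> functionals in
  coordinates.\<close>

definition form_of ::
    "nat \<Rightarrow> nat \<Rightarrow> ('v \<Rightarrow> 'k::field seq) \<Rightarrow> ('v list \<Rightarrow>\<^sub>0 'k) \<Rightarrow> 'k form" where
  "form_of d n c p = (\<lambda>l. if length l = d then
     \<Sum>t\<in>Poly_Mapping.keys p. Poly_Mapping.lookup p t * (\<Prod>k<d. contract n c (l ! k) (t ! k)) else 0)"

lemma form_of_superset:
  assumes "finite A" "Poly_Mapping.keys p \<subseteq> A" "length l = d"
  shows "form_of d n c p l =
    (\<Sum>t\<in>A. Poly_Mapping.lookup p t * (\<Prod>k<d. contract n c (l ! k) (t ! k)))"
  unfolding form_of_def using assms by (auto intro!: sum.mono_neutral_left simp: in_keys_iff)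

lemma form_of_add: "form_of d n c (p + q) = form_of d n c p + form_of d n c q"
proof
  fix l
  let ?A = "Poly_Mapping.keys p \<union> Poly_Mapping.keys q"
  show "form_of d n c (p + q) l = (form_of d n c p + form_of d n c q) l"
  proof (cases "length l = d")
    case True
    then show ?thesis
      using Poly_Mapping.keys_add[of p q]
      by (simp add: form_of_superset[of ?A] lookup_add sum.distrib algebra_simps)
  qed (simp add: form_of_def)
qed

lemma form_of_zero: "form_of d n c 0 = 0"
  using form_of_add[of d n c 0 0] by (simp only: add_0_right add_cancel_right_right)

lemma form_of_sum: "form_of d n c (\<Sum>i\<in>I. p i) = (\<Sum>i\<in>I. form_of d n c (p i))"
proof (induction I rule: infinite_finite_induct)
  case (insert i I)
  show ?case unfolding sum.insert[OF insert.hyps(1,2)] form_of_add insert.IH ..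
next
  case (infinite I)
  show ?case unfolding sum.infinite[OF infinite.hyps] form_of_zero ..
qed (simp only: sum.empty form_of_zero)

lemma form_of_single:
  "length l = d \<Longrightarrow> form_of d n c (Poly_Mapping.single t a) l =
     a * (\<Prod>k<d. contract n c (l ! k) (t ! k))"
  by (subst form_of_superset[of "{t}"]) auto

lemma form_of_in_forms:
  fixes c :: "'v \<Rightarrow> 'k::{field,finite} seq"
  shows "form_of d n c p \<in> form_degree.forms d"
  unfolding form_degree.forms_def
proof (intro CollectI conjI allI impI)
  show "form_of d n c p l = 0" if "length l \<noteq> d" for l using that by (simp add: form_of_def)
  have "form_of d n c p \<bullet> trunc n = form_of d n c p"
    by (rule ext) (simp add: act_apply form_of_def contract_trunc)
  then show "\<exists>n'. form_of d n c p \<bullet> trunc n' = form_of d n c p" by blast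
  fix l :: "'k seq list"
  show "poly_less (Suc d) (\<lambda>h. form_of d n c p (map h l))"
  proof (cases "length l = d")
    case True
    have "poly_less (Suc (0 + d)) (\<lambda>h :: 'k seq \<Rightarrow> 'k seq.
        Poly_Mapping.lookup p t * (\<Prod>k<d. contract n c (h (l ! k)) (t ! k)))" for t
    proof (rule poly_less_mult[OF poly_less_const])
      have "poly_less (Suc (card {..<d} * 1)) (\<lambda>h :: 'k seq \<Rightarrow> 'k seq.
          \<Prod>k<d. contract n c (h (l ! k)) (t ! k))"
        using poly_less_additive by (intro poly_less_prod) (simp_all add: contract_add)
      then show "poly_less (Suc d) (\<lambda>h :: 'k seq \<Rightarrow> 'k seq.
          \<Prod>k<d. contract n c (h (l ! k)) (t ! k))"
        by (simp only: card_lessThan mult_1_right)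
    qed
    then have "poly_less (Suc d) (\<lambda>h :: 'k seq \<Rightarrow> 'k seq. \<Sum>t\<in>Poly_Mapping.keys p.
        Poly_Mapping.lookup p t * (\<Prod>k<d. contract n c (h (l ! k)) (t ! k)))"
      by (intro poly_less_sum) (simp only: add_0)
    moreover have "form_of d n c p (map h l) = (\<Sum>t\<in>Poly_Mapping.keys p.
        Poly_Mapping.lookup p t * (\<Prod>k<d. contract n c (h (l ! k)) (t ! k)))" for h :: "'k seq \<Rightarrow> 'k seq"
      using True by (simp add: form_of_def)
    ultimately show ?thesis by (simp only:)
  next
    case False
    then have "(\<lambda>h :: 'k seq \<Rightarrow> 'k seq. form_of d n c p (map h l)) = (\<lambda>h. 0)"
      by (simp add: form_of_def)
    then show ?thesis by (simp only: poly_less_zero)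
  qed
qed

section \<open>Expansion of tensors in a basis\<close>

abbreviation rel_span ::
    "('k::field \<Rightarrow> 'v::ab_group_add \<Rightarrow> 'v) \<Rightarrow> nat \<Rightarrow> 'v set \<Rightarrow> ('v list \<Rightarrow>\<^sub>0 'k) set" where
  "rel_span s d V \<equiv> free_vs.span (multilinearity_rels s d V)"

lemma slot_add_rel:
  assumes "pre @ x # t \<in> tuples d V" "y \<in> V"
  shows "Poly_Mapping.single (pre @ (x + y) # t) 1 - Poly_Mapping.single (pre @ x # t) 1
     - Poly_Mapping.single (pre @ y # t) 1 \<in> rel_span s d V"
proof (rule free_vs.span_base)
  have "x \<in> V" "length pre < d" using assms by (auto simp: tuples_def)
  moreover have "(pre @ x # t)[length pre := z] = pre @ z # t" for z by simp
  ultimately show "Poly_Mapping.single (pre @ (x + y) # t) 1 - Poly_Mapping.single (pre @ x # t) 1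
     - Poly_Mapping.single (pre @ y # t) 1 \<in> multilinearity_rels s d V"
    using assms unfolding multilinearity_rels_def
    by (intro UnI1 CollectI exI[of _ "pre @ x # t"] exI[of _ "length pre"] exI[of _ x] exI[of _ y]) simp
qed

lemma slot_scale_rel:
  assumes "pre @ x # t \<in> tuples d V"
  shows "Poly_Mapping.single (pre @ s a x # t) 1 - Poly_Mapping.single (pre @ x # t) a \<in> rel_span s d V"
proof (rule free_vs.span_base)
  have "x \<in> V" "length pre < d" using assms by (auto simp: tuples_def)
  moreover have "(pre @ x # t)[length pre := z] = pre @ z # t" for z by simp
  ultimately show "Poly_Mapping.single (pre @ s a x # t) 1 - Poly_Mapping.single (pre @ x # t) a
      \<in> multilinearity_rels s d V"
    using assms unfolding multilinearity_rels_def
    by (intro UnI2 CollectI exI[of _ "pre @ x # t"] exI[of _ "length pre"] exI[of _ a] exI[of _ x]) simp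
qed

lemma slot_sum_rel:
  assumes vs: "vector_space s" and V: "module.subspace s V"
    and t: "pre @ v # t \<in> tuples d V" and J: "finite J" "\<And>j. j \<in> J \<Longrightarrow> x j \<in> V"
  shows "Poly_Mapping.single (pre @ (\<Sum>j\<in>J. s (a j) (x j)) # t) 1 -
    (\<Sum>j\<in>J. Poly_Mapping.single (pre @ x j # t) (a j)) \<in> rel_span s d V"
  using J
proof (induction J rule: finite_induct)
  case empty
  interpret vs: vector_space s by fact
  \<comment> \<open>The empty sum puts the zero vector into the slot, and this is
    \<open>s 0 v\<close>.\<close>
  have "Poly_Mapping.single (pre @ s 0 v # t) 1 - Poly_Mapping.single (pre @ v # t) 0 \<in> rel_span s d V"
    using t by (rule slot_scale_rel)
  then show ?case by simp
next
  case (insert j J)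
  interpret vs: vector_space s by fact
  let ?Q = "\<lambda>y. Poly_Mapping.single (pre @ y # t) (1::'a)"
  let ?y = "\<Sum>j\<in>J. s (a j) (x j)" and ?z = "s (a j) (x j)"
  have slot: "pre @ z # t \<in> tuples d V" if "z \<in> V" for z using t that by (auto simp: tuples_def)
  have z: "?z \<in> V" using insert.prems by (intro vs.subspace_scale[OF V]) simp
  have y: "?y \<in> V" using insert.prems by (intro vs.subspace_sum[OF V] vs.subspace_scale[OF V]) simp
  have 1: "?Q (?z + ?y) - ?Q ?z - ?Q ?y \<in> rel_span s d V"
    by (intro slot_add_rel slot z y)
  have 2: "?Q ?z - Poly_Mapping.single (pre @ x j # t) (a j) \<in> rel_span s d V"
    using insert.prems by (intro slot_scale_rel slot) simp
  have 3: "?Q ?y - (\<Sum>j\<in>J. Poly_Mapping.single (pre @ x j # t) (a j)) \<in> rel_span s d V"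
    using insert by simp
  have "?Q (?z + ?y) - (Poly_Mapping.single (pre @ x j # t) (a j) +
      (\<Sum>j\<in>J. Poly_Mapping.single (pre @ x j # t) (a j))) \<in> rel_span s d V"
    using free_vs.span_add[OF free_vs.span_add[OF 1 2] 3] by (simp add: algebra_simps)
  then show ?case using insert.hyps by simp
qed

abbreviation index_lists :: "nat \<Rightarrow> nat \<Rightarrow> nat list set" where
  "index_lists n m \<equiv> {f. set f \<subseteq> {..<n} \<and> length f = m}"

lemma sum_index_lists_Suc:
  "(\<Sum>f\<in>index_lists n (Suc m). F f) = (\<Sum>j<n. \<Sum>f\<in>index_lists n m. F (j # f))"
proof -
  have "inj_on (\<lambda>(f, j). j # f) (index_lists n m \<times> {..<n})" by (auto simp: inj_on_def)
  then have "(\<Sum>f\<in>index_lists n (Suc m). F f) =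
      (\<Sum>(f, j)\<in>index_lists n m \<times> {..<n}. F (j # f))"
    unfolding lists_length_Suc_eq by (subst sum.reindex) (auto simp: case_prod_beta)
  also have "\<dots> = (\<Sum>f\<in>index_lists n m. \<Sum>j<n. F (j # f))"
    by (simp add: sum.cartesian_product)
  also have "\<dots> = (\<Sum>j<n. \<Sum>f\<in>index_lists n m. F (j # f))"
    by (rule sum.swap)
  finally show ?thesis .
qed

text \<open>Slots are expanded from left to right; \<open>pre\<close> holds those already treated
  and therefore varies in the induction.\<close>

lemma single_expand:
  assumes vs: "vector_space s" and V: "module.subspace s V" and co: "coordinates s V n b c"
  shows "pre @ t \<in> tuples d V \<Longrightarrow> Poly_Mapping.single (pre @ t) 1 -
    (\<Sum>f\<in>index_lists n (length t). Poly_Mapping.single (pre @ map b f)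
       (\<Prod>k<length t. c (t ! k) (f ! k))) \<in> rel_span s d V"
proof (induction t arbitrary: pre)
  case Nil
  have "{f :: nat list. set f \<subseteq> {..<n} \<and> f = []} = {[]}" by auto
  then show ?case by (simp add: free_vs.span_zero)
next
  case (Cons v t)
  let ?m = "length t"
  let ?E = "\<lambda>j. \<Sum>f\<in>index_lists n ?m. Poly_Mapping.single (pre @ b j # map b f) (\<Prod>k<?m. c (t ! k) (f ! k))"
  have v: "v \<in> V" using Cons.prems by (auto simp: tuples_def)
  have b: "b j \<in> V" if "j < n" for j using co that by (simp add: coordinates_def)
  have 1: "Poly_Mapping.single (pre @ v # t) 1 -
      (\<Sum>j<n. Poly_Mapping.single (pre @ b j # t) (c v j)) \<in> rel_span s d V"
  proof -
    have "v = (\<Sum>j<n. s (c v j) (b j))" using co v unfolding coordinates_def by blast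
    then show ?thesis
      using slot_sum_rel[OF vs V Cons.prems, of "{..<n}" b "c v"] b by simp
  qed
  have 2: "Poly_Mapping.single (pre @ b j # t) 1 - ?E j \<in> rel_span s d V" if "j < n" for j
  proof -
    have "(pre @ [b j]) @ t \<in> tuples d V" using Cons.prems b[OF that] by (auto simp: tuples_def)
    from Cons.IH[OF this] show ?thesis by simp
  qed
  have "free_scale (c v j) (Poly_Mapping.single (pre @ b j # t) 1 - ?E j) \<in> rel_span s d V"
    if "j < n" for j
    using 2[OF that] by (rule free_vs.span_scale)
  then have 3: "(\<Sum>j<n. free_scale (c v j) (Poly_Mapping.single (pre @ b j # t) 1 - ?E j)) \<in> rel_span s d V"
    by (intro free_vs.span_sum) simp
  have "free_scale (c v j) (?E j) = (\<Sum>f\<in>index_lists n ?m.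
      Poly_Mapping.single (pre @ map b (j # f)) (\<Prod>k<Suc ?m. c ((v # t) ! k) ((j # f) ! k)))" for j
    by (simp add: free_vs.scale_sum_right prod.lessThan_Suc_shift del: prod.lessThan_Suc)
  then have "(\<Sum>j<n. free_scale (c v j) (?E j)) = (\<Sum>f\<in>index_lists n (Suc ?m).
      Poly_Mapping.single (pre @ map b f) (\<Prod>k<Suc ?m. c ((v # t) ! k) (f ! k)))"
    by (simp only: sum_index_lists_Suc)
  moreover have "(\<Sum>j<n. free_scale (c v j) (Poly_Mapping.single (pre @ b j # t) 1 - ?E j)) =
      (\<Sum>j<n. Poly_Mapping.single (pre @ b j # t) (c v j)) - (\<Sum>j<n. free_scale (c v j) (?E j))"
    by (simp add: free_vs.scale_right_diff_distrib sum_subtractf)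
  ultimately show ?case
    using free_vs.span_add[OF 1 3] by simp
qed

lemma single_sum:
  "Poly_Mapping.single x (\<Sum>i\<in>I. f i) = (\<Sum>i\<in>I. Poly_Mapping.single x (f i))"
  by (induction I rule: infinite_finite_induct) (simp_all add: single_add)

text \<open>Pairing with unit sequences reads off coordinates, so the values of the form at lists of
  unit sequences are the coefficients of the tensor in the basis.\<close>

lemma expand_in_basis:
  assumes vs: "vector_space s" and V: "module.subspace s V" and co: "coordinates s V n b c"
    and p: "p \<in> free_space d V"
  shows "p - (\<Sum>f\<in>index_lists n d. Poly_Mapping.single (map b f) (form_of d n c p (map unit_seq f)))
    \<in> rel_span s d V"
proof -
  have keys: "t \<in> tuples d V" if "t \<in> Poly_Mapping.keys p" for t
    using p that by (auto simp: free_space_def)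
  let ?C = "\<lambda>t f. \<Prod>k<d. c (t ! k) (f ! k)"
  have "Poly_Mapping.single t 1 - (\<Sum>f\<in>index_lists n d. Poly_Mapping.single (map b f) (?C t f))
      \<in> rel_span s d V" if "t \<in> Poly_Mapping.keys p" for t
    using single_expand[OF vs V co, of "[]" t d] keys[OF that] by (simp add: tuples_def)
  then have 1: "(\<Sum>t\<in>Poly_Mapping.keys p. free_scale (Poly_Mapping.lookup p t)
      (Poly_Mapping.single t 1 - (\<Sum>f\<in>index_lists n d. Poly_Mapping.single (map b f) (?C t f))))
      \<in> rel_span s d V"
    by (intro free_vs.span_sum free_vs.span_scale)
  have "form_of d n c p (map unit_seq f) =
      (\<Sum>t\<in>Poly_Mapping.keys p. Poly_Mapping.lookup p t * ?C t f)" if "f \<in> index_lists n d" for f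
  proof -
    have "f ! k < n" if "k < d" for k using \<open>f \<in> index_lists n d\<close> that nth_mem[of k f] by blast
    then show ?thesis using that by (simp add: form_of_def contract_unit_seq)
  qed
  then have "(\<Sum>f\<in>index_lists n d. Poly_Mapping.single (map b f) (form_of d n c p (map unit_seq f))) =
      (\<Sum>f\<in>index_lists n d. \<Sum>t\<in>Poly_Mapping.keys p.
        Poly_Mapping.single (map b f) (Poly_Mapping.lookup p t * ?C t f))"
    by (simp add: single_sum)
  also have "\<dots> = (\<Sum>t\<in>Poly_Mapping.keys p. \<Sum>f\<in>index_lists n d.
        Poly_Mapping.single (map b f) (Poly_Mapping.lookup p t * ?C t f))"
    by (rule sum.swap)
  finally have "(\<Sum>t\<in>Poly_Mapping.keys p. free_scale (Poly_Mapping.lookup p t)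
      (Poly_Mapping.single t 1 - (\<Sum>f\<in>index_lists n d. Poly_Mapping.single (map b f) (?C t f)))) =
      (\<Sum>t\<in>Poly_Mapping.keys p. Poly_Mapping.single t (Poly_Mapping.lookup p t)) -
      (\<Sum>f\<in>index_lists n d. Poly_Mapping.single (map b f) (form_of d n c p (map unit_seq f)))"
    by (simp add: free_vs.scale_right_diff_distrib free_vs.scale_sum_right sum_subtractf)
  moreover have "(\<Sum>t\<in>Poly_Mapping.keys p. Poly_Mapping.single t (Poly_Mapping.lookup p t)) = p"
    using free_map_def[of id p] by (intro poly_mapping_eqI)
      (auto simp: lookup_sum lookup_single when_def in_keys_iff)
  ultimately show ?thesis using 1 by simp
qed

text \<open>Both have the same basis expansion. This turns an equation of forms back into one of
  tensors.\<close>

lemma tensor_rel_if_form_of_eq: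
  assumes "vector_space s" "module.subspace s V" "coordinates s V n b c"
    and "p \<in> free_space d V" "q \<in> free_space d V" "form_of d n c p = form_of d n c q"
  shows "(p, q) \<in> tensor_rel s d V"
  using free_vs.span_diff[OF expand_in_basis[OF assms(1-3,4)] expand_in_basis[OF assms(1-3,5)]] assms(4-6)
  by (simp add: tensor_rel_def)

theorem theorem1p2p1:
  fixes scale :: "'k::{field,finite} \<Rightarrow> 'v::ab_group_add \<Rightarrow> 'v"
    and d :: nat
    and V :: "nat \<Rightarrow> 'v set"
    and T :: "nat \<Rightarrow> ('v list \<Rightarrow>\<^sub>0 'k) set"
  assumes "vector_space scale"
    and "\<And>i. finite_dim_subspace scale (V i)"
    and "\<And>i. T i \<in> tensor_power scale d (V i)"
  shows "\<exists>i j. i < j \<and> is_restriction scale d (V j) (T j) (V i) (T i)"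
proof -
  interpret vs: vector_space scale by fact
  have V: "vs.subspace (V i)" for i using assms(2)[of i] by (simp add: finite_dim_subspace_def)
  have "\<forall>i. \<exists>p. p \<in> free_space d (V i) \<and> T i = tensor_rel scale d (V i) `` {p}"
  proof
    fix i
    show "\<exists>p. p \<in> free_space d (V i) \<and> T i = tensor_rel scale d (V i) `` {p}"
      using assms(3)[of i] unfolding tensor_power_def by (rule quotientE) blast
  qed
  then obtain p where p: "\<And>i. p i \<in> free_space d (V i)"
    "\<And>i. T i = tensor_rel scale d (V i) `` {p i}"
    by metis
  have "\<forall>i. \<exists>n b c. coordinates scale (V i) n b c"
    using exists_coordinates[OF assms(1,2)] by blast
  then obtain n b c where co: "\<And>i. coordinates scale (V i) (n i) (b i) (c i)" by metis
  let ?F = "\<lambda>i. form_of d (n i) (c i) (p i)"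
  obtain i j g where ij: "i < j" and g: "lin g" and eq: "?F j \<bullet> g = ?F i"
    using form_degree.forms_wqo[of ?F d] form_of_in_forms by blast
  \<comment> \<open>The transpose of \<open>g\<close>: since \<open>g\<close> takes functionals on
    \<open>V i\<close> to functionals on \<open>V j\<close>, it goes from \<open>V j\<close> to
    \<open>V i\<close>.\<close>
  define \<phi> where "\<phi> v = (\<Sum>m<n i. scale (contract (n j) (c j) (g (unit_seq m)) v) (b i m))" for v
  have bV: "b i m \<in> V i" if "m < n i" for m using co[of i] that by (simp add: coordinates_def)
  have lin: "linear_map_on scale scale (V j) (V i) \<phi>"
    unfolding linear_map_on_def
  proof (intro conjI ballI allI)
    fix x show "\<phi> x \<in> V i"
      unfolding \<phi>_def using bV by (intro vs.subspace_sum[OF V] vs.subspace_scale[OF V]) simp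
  next
    fix x y assume "x \<in> V j" "y \<in> V j"
    then have "contract (n j) (c j) w (x + y) = contract (n j) (c j) w x + contract (n j) (c j) w y" for w
      using co[of j] by (simp add: contract_def coordinates_def sum.distrib algebra_simps)
    then show "\<phi> (x + y) = \<phi> x + \<phi> y"
      by (simp add: \<phi>_def vs.scale_left_distrib sum.distrib)
  next
    fix a x assume "x \<in> V j"
    then have "contract (n j) (c j) w (scale a x) = a * contract (n j) (c j) w x" for w
      using co[of j] by (simp add: contract_def coordinates_def sum_distrib_left algebra_simps)
    then show "\<phi> (scale a x) = scale a (\<phi> x)"
      by (simp add: \<phi>_def vs.scale_sum_right)
  qed
  have \<phi>: "contract (n i) (c i) w (\<phi> v) = contract (n j) (c j) (g (trunc (n i) w)) v" for w v
  proof -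
    have "c i (\<phi> v) m = contract (n j) (c j) (g (unit_seq m)) v" if "m < n i" for m
      unfolding \<phi>_def using that by (intro coordinates_sum[OF co assms(1) V])
    then show ?thesis by (simp add: contract_lin_trunc[OF g] contract_def[of "n i"])
  qed
  have "form_of d (n i) (c i) (free_map \<phi> (p j)) l = ?F i l" for l
  proof (cases "length l = d")
    case True
    have "length t = d" if "t \<in> Poly_Mapping.keys (p j)" for t
      using p(1)[of j] that by (auto simp: free_space_def tuples_def)
    then have "form_of d (n i) (c i) (free_map \<phi> (p j)) l = (?F j \<bullet> g \<bullet> trunc (n i)) l"
      unfolding free_map_def form_of_sum sum_fun_apply using True
      by (simp add: form_of_single \<phi>) (simp add: act_apply form_of_def)
    \<comment> \<open>The adjunction between \<open>\<phi>\<close> and \<open>g\<close> involves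
      \<open>trunc (n i)\<close>, which does not change a form on \<open>n i\<close>
      coordinates.\<close>
    also have "?F j \<bullet> g \<bullet> trunc (n i) = ?F i"
      unfolding eq by (rule ext) (simp add: act_apply form_of_def contract_trunc)
    finally show ?thesis .
  qed (simp add: form_of_def)
  then have "(free_map \<phi> (p j), p i) \<in> tensor_rel scale d (V i)"
    using p(1) lin
    by (intro tensor_rel_if_form_of_eq[OF assms(1) V co] free_map_in_free_space ext)
  then have "tensor_power_map scale d (V i) \<phi> (T j) = T i"
    unfolding p(2) tensor_power_map_class[OF lin p(1)]
    by (rule equiv_class_eq[OF equiv_tensor_rel])
  then show ?thesis using ij lin unfolding is_restriction_def by blast
qed
end
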